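(* Let $K$ be a closed nonpolar subset of $\mathbb{C}$ and $Q$ a weakly admissible weight on $K$. Then the weighted diameters $\delta_k^Q(K)$, $k\ge2$, are finite, and: 1. if $\mu_k=\frac1k\sum_{j=1}^k\delta_{x_j^{(k)}}\in\mathcal M(K)$ converge weakly to $\mu\in\mathcal M(K)$, then $\limsup_{k\to\infty}|VDM_k^Q(x_1^{(k)},\dots,x_k^{(k)})|^{2/k(k-1)}\le\exp(-I^Q(\mu))$; 2. $\lim_{k\to\infty}\delta_k^Q(K)=\exp(-V_w)$; 3. if $\{x_j^{(k)}\}_{j=1,\dots,k;\,k\ge2}\subset K$ and $\lim_{k\to\infty}|VDM_k^Q(x_1^{(k)},\dots,x_k^{(k)})|^{2/k(k-1)}=\exp(-V_w)$, then $\frac1k\sum_{j=1}^k\delta_{x_j^{(k)}}\to\mu_{K,Q}$ weakly.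
   Context: $\mathcal M(K)$: Borel probability measures on $K$, weak topology. $Q$ weakly admissible: lower semicontinuous $K\to(-\infty,\infty]$, $\{Q<\infty\}$ nonpolar, $\liminf_{z\in K,|z|\to\infty}(Q(z)-\log|z|)$ finite. $w=e^{-Q}$, $I^Q(\mu)=\int\int\log\frac1{|z-t|w(z)w(t)}d\mu d\mu$, $V_w=\inf_{\mathcal M(K)}I^Q$, $\mu_{K,Q}$ its unique minimizer. $|VDM_k^Q(x_1,\dots,x_k)|=\prod_{i<j}|x_i-x_j|w(x_i)w(x_j)$ and $\delta_k^Q(K)=\sup_{x_1,\dots,x_k\in K}|VDM_k^Q(x_1,\dots,x_k)|^{2/k(k-1)}$. *)

theory Defs
  imports "HOL-Probability.Probability"
begin

text \<open>Integral of an extended-real valued function: positive part minus negative part.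
  Used only for integrands bounded below, where the value lies in (-inf, +inf].\<close>
definition eintegral :: "'a measure \<Rightarrow> ('a \<Rightarrow> ereal) \<Rightarrow> ereal" where
  "eintegral M f =
     enn2ereal (\<integral>\<^sup>+ x. e2ennreal (f x) \<partial>M) - enn2ereal (\<integral>\<^sup>+ x. e2ennreal (- f x) \<partial>M)"

definition exp_neg_ereal :: "ereal \<Rightarrow> ereal" where
  "exp_neg_ereal I = (case I of ereal r \<Rightarrow> ereal (exp (- r)) | PInfty \<Rightarrow> 0 | MInfty \<Rightarrow> \<infinity>)"

definition log_energy :: "complex measure \<Rightarrow> ereal" where
  "log_energy \<mu> = eintegral (\<mu> \<Otimes>\<^sub>M \<mu>)
      (\<lambda>(z,t). if z = t then \<infinity> else ereal (- ln (cmod (z - t))))"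

definition polar :: "complex set \<Rightarrow> bool" where
  "polar E \<longleftrightarrow> (\<forall>\<mu>. sets \<mu> = sets borel \<and> prob_space \<mu> \<and>
      (\<exists>L. compact L \<and> L \<subseteq> E \<and> emeasure \<mu> (UNIV - L) = 0)
      \<longrightarrow> log_energy \<mu> = \<infinity>)"

definition lsc_on :: "complex set \<Rightarrow> (complex \<Rightarrow> ereal) \<Rightarrow> bool" where
  "lsc_on K Q \<longleftrightarrow> (\<forall>z\<in>K. \<forall>c. c < Q z \<longrightarrow> (\<forall>\<^sub>F t in at z within K. c < Q t))"

text \<open>Weakly admissible weight Q : K -> (-inf, inf].  The growth condition at infinity is
  only meaningful (and only imposed) when K is unbounded.\<close>
definition weakly_admissible :: "complex set \<Rightarrow> (complex \<Rightarrow> ereal) \<Rightarrow> bool" where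
  "weakly_admissible K Q \<longleftrightarrow>
     (\<forall>z\<in>K. Q z \<noteq> -\<infinity>) \<and> lsc_on K Q \<and> \<not> polar {z\<in>K. Q z < \<infinity>} \<and>
     (\<not> bounded K \<longrightarrow>
        \<bar>Liminf (inf at_infinity (principal K)) (\<lambda>z. Q z - ereal (ln (cmod z)))\<bar> \<noteq> \<infinity>)"

definition wgt :: "(complex \<Rightarrow> ereal) \<Rightarrow> complex \<Rightarrow> real" where
  "wgt Q z = (if Q z = \<infinity> then 0 else exp (- real_of_ereal (Q z)))"

definition probs_on :: "complex set \<Rightarrow> complex measure set" where
  "probs_on K = {\<mu>. sets \<mu> = sets (restrict_space borel K) \<and> prob_space \<mu>}"

definition weak_conv_on :: "complex set \<Rightarrow> (nat \<Rightarrow> complex measure) \<Rightarrow> complex measure \<Rightarrow> bool" where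
  "weak_conv_on K \<mu>s \<mu> \<longleftrightarrow>
     (\<forall>f :: complex \<Rightarrow> real. continuous_on K f \<and> bounded (f ` K) \<longrightarrow>
        (\<lambda>k. \<integral>x. f x \<partial>(\<mu>s k)) \<longlonglongrightarrow> (\<integral>x. f x \<partial>\<mu>))"

definition empirical :: "complex set \<Rightarrow> nat \<Rightarrow> (nat \<Rightarrow> complex) \<Rightarrow> complex measure" where
  "empirical K k x = measure_of K (sets (restrict_space borel K))
      (\<lambda>A. ennreal ((\<Sum>j=1..k. indicator A (x j)) / real k))"

definition energyQ :: "(complex \<Rightarrow> ereal) \<Rightarrow> complex measure \<Rightarrow> ereal" where
  "energyQ Q \<mu> = eintegral (\<mu> \<Otimes>\<^sub>M \<mu>)
      (\<lambda>(z,t). if z = t then \<infinity> else ereal (- ln (cmod (z - t))) + Q z + Q t)"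

definition V_w :: "complex set \<Rightarrow> (complex \<Rightarrow> ereal) \<Rightarrow> ereal" where
  "V_w K Q = (INF \<mu>\<in>probs_on K. energyQ Q \<mu>)"

definition mu_KQ :: "complex set \<Rightarrow> (complex \<Rightarrow> ereal) \<Rightarrow> complex measure" where
  "mu_KQ K Q = (THE \<mu>. \<mu> \<in> probs_on K \<and> energyQ Q \<mu> = V_w K Q)"

definition VDM :: "(complex \<Rightarrow> ereal) \<Rightarrow> nat \<Rightarrow> (nat \<Rightarrow> complex) \<Rightarrow> real" where
  "VDM Q k x = (\<Prod>i\<in>{1..k}. \<Prod>j\<in>{i<..k}. cmod (x i - x j) * wgt Q (x i) * wgt Q (x j))"

definition VDM_root :: "(complex \<Rightarrow> ereal) \<Rightarrow> nat \<Rightarrow> (nat \<Rightarrow> complex) \<Rightarrow> real" where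
  "VDM_root Q k x = VDM Q k x powr (2 / (real k * (real k - 1)))"

definition diamQ :: "(complex \<Rightarrow> ereal) \<Rightarrow> complex set \<Rightarrow> nat \<Rightarrow> ereal" where
  "diamQ Q K k = (SUP x\<in>{x. \<forall>j\<in>{1..k}. x j \<in> K}. ereal (VDM_root Q k x))"

end

theory Submission
  imports Defs
begin

text \<open>
  Writing \<open>-log|z - t|\<close> in terms of the chordal distance on the Riemann sphere and moving the factors
  \<open>(1 + |z|\<^sup>2)\<^bsup>1/2\<^esup>\<close> into the weight makes the weighted kernel lower semicontinuous and bounded below on
  \<open>K \<times> K\<close>, although \<open>K\<close> may be unbounded; mass at infinity has infinite energy, because the chordal
  distance of two points tending to infinity tends to \<open>0\<close>.

  Empirical measures are lifted to \<open>[0, 1]\<close> along a space-filling curve, where Helly's selection theorem and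
  Skorohod's representation provide almost surely convergent random variables. Fatou's lemma on the
  product space then bounds the energy of the limit by the limit of the discrete energies, and
  averaging the discrete energy over \<open>\<mu>\<^bsup>k\<^esup>\<close> gives the converse inequality \<open>\<delta>\<^sub>k \<ge> exp(-I(\<mu>))\<close>.

  Uniqueness of the minimizer uses that the logarithm of the chordal distance \<open>d\<close> expands as
  \<open>-log d = \<Sum>(1 - d\<^sup>2)\<^bsup>n\<^esup> / 2n\<close>, where \<open>1 - d\<^sup>2\<close> is the squared modulus of the inner product of unit vectors in \<open>\<complex>\<^sup>2\<close>
  and hence positive definite with four real features. Equality of energies forces equality of all
  moments of the features, which determine the measure by the Stone-Weierstrass theorem.
\<close>

subsection \<open>A space-filling curve\<close>

text \<open>Weak admissibility only keeps \<open>Q z - log |z|\<close> bounded below at infinity, so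
  the field need not hold mass back: measures of bounded energy are not known in advance to be
  tight. What forbids escape is repulsion, since any two points near infinity are close on the
  sphere. Hence the proof compactifies first and rules out mass at infinity afterwards. Given
  \<open>Q z \<ge> ln (1 + |z|^2) / 2 - C\<close>, the kernel shifted by \<open>2 * C\<close> is
  nonnegative, and energies become \<open>ennreal\<close> integrals open to Fatou and Tonelli. The
  disc model of the plane is parametrised by an interval so that limits can be taken for laws on the
  real line, where tightness is automatic. The limit variable may leave the open disc; that event is
  the mass at infinity. One compactness statement, \<open>limit_measure\<close>, yields the
  minimizer, the limsup bound, the upper bound for the diameters and the convergence of
  asymptotically optimal points. The infinite diagonal of the discrete energy is tamed by truncating
  the kernel at \<open>N\<close>: the diagonal then costs at most \<open>N / k\<close>, so
  \<open>k\<close> tends to infinity before \<open>N\<close> does.\<close>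

definition clampcos :: "real \<Rightarrow> real" where
  "clampcos t = max 0 (min 1 (1 / 2 - cos (pi * t)))"

text \<open>
  One coordinate of Schoenberg's space-filling curve. The clamped cosine is a continuous function of
  period \<open>2\<close> that is \<open>0\<close> on \<open>[0, 1/3]\<close> and \<open>1\<close> on \<open>[2/3, 1]\<close>; hence its value at \<open>3\<^bsup>m\<^esup>t\<close> reads off the
  digit number \<open>m\<close> of a ternary expansion \<open>t\<close> with digits in \<open>{0, 2}\<close>.
\<close>

definition schoenberg :: "nat \<Rightarrow> real \<Rightarrow> real" where
  "schoenberg p t = (\<Sum>n. clampcos (3 ^ (2 * n + p) * t) / 2 ^ Suc n)"

lemma continuous_on_schoenberg: "continuous_on UNIV (schoenberg p)"
proof -
  have bd: "norm (clampcos (3 ^ (2 * n + p) * t) / 2 ^ Suc n) \<le> (1 / 2) ^ Suc n" for n t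
    by (auto simp: clampcos_def power_one_over divide_simps)
  have "uniform_limit UNIV (\<lambda>n t. \<Sum>i<n. clampcos (3 ^ (2 * i + p) * t) / 2 ^ Suc i)
      (schoenberg p) sequentially"
    unfolding schoenberg_def[abs_def]
    by (rule Weierstrass_m_test[OF bd]) (simp add: summable_geometric)
  then show ?thesis
    by (rule uniform_limit_theorem[rotated])
       (auto simp: clampcos_def intro!: always_eventually continuous_intros)
qed

text \<open>The digits are differences of consecutive floors of \<open>2 ^ n * x\<close>, so the
  partial sums telescope to \<open>F N / 2 ^ N\<close>, which is within \<open>2^-N\<close> of
  \<open>x\<close>. The telescoping starts at \<open>F 0 = 0\<close>, which is where
  \<open>x < 1\<close> enters.\<close>

lemma binary_expansion:
  fixes x :: real
  assumes "0 \<le> x" "x < 1"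
  obtains d :: "nat \<Rightarrow> nat" where "\<And>n. d n \<in> {0, 1}" "(\<lambda>n. real (d n) / 2 ^ Suc n) sums x"
proof -
  define F where "F n = \<lfloor>2 ^ n * x\<rfloor>" for n :: nat
  define d where "d n = nat (F (Suc n) - 2 * F n)" for n
  have F2: "F (Suc n) - 2 * F n \<in> {0, 1}" for n
  proof -
    have "2 * F n \<le> F (Suc n)"
      using of_int_floor_le[of "2 ^ n * x"] by (auto simp: F_def le_floor_iff)
    moreover have "F (Suc n) < 2 * F n + 2"
    proof -
      have "2 ^ n * x < of_int (F n) + 1" unfolding F_def by linarith
      then show ?thesis by (simp add: F_def[of "Suc n"] floor_less_iff)
    qed
    ultimately show ?thesis by auto
  qed
  have dF: "real (d n) = of_int (F (Suc n)) - 2 * of_int (F n)" for n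
    using F2[of n] by (auto simp: d_def)
  have ps: "(\<Sum>n<N. real (d n) / 2 ^ Suc n) = of_int (F N) / 2 ^ N" for N
  proof (induction N)
    case 0
    then show ?case using assms by (simp add: F_def floor_eq_iff)
  next
    case (Suc N)
    then show ?case by (simp add: dF divide_simps)
  qed
  have "(\<lambda>N. of_int (F N) / 2 ^ N) \<longlonglongrightarrow> x"
  proof (rule tendsto_sandwich)
    show "\<forall>\<^sub>F n in sequentially. x - (1 / 2) ^ n \<le> of_int (F n) / 2 ^ n"
    proof (intro always_eventually allI)
      fix n
      have "2 ^ n * x - 1 \<le> of_int (F n)" unfolding F_def by linarith
      then have "(2 ^ n * x - 1) / 2 ^ n \<le> of_int (F n) / 2 ^ n"
        by (rule divide_right_mono) simp
      then show "x - (1 / 2) ^ n \<le> of_int (F n) / 2 ^ n"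
        by (simp add: diff_divide_distrib power_one_over)
    qed
    show "\<forall>\<^sub>F n in sequentially. of_int (F n) / 2 ^ n \<le> x"
    proof (intro always_eventually allI)
      fix n
      have "of_int (F n) \<le> 2 ^ n * x" unfolding F_def by linarith
      then show "of_int (F n) / 2 ^ n \<le> x" by (simp add: divide_simps mult.commute)
    qed
    have "(\<lambda>n. x - (1 / 2) ^ n) \<longlonglongrightarrow> x - 0"
      by (intro tendsto_intros LIMSEQ_power_zero) auto
    then show "(\<lambda>n. x - (1 / 2) ^ n) \<longlonglongrightarrow> x" by simp
  qed auto
  then have "(\<lambda>n. real (d n) / 2 ^ Suc n) sums x"
    by (simp only: sums_def ps)
  moreover have "d n \<in> {0, 1}" for n using F2[of n] by (auto simp: d_def)
  ultimately show ?thesis by (rule that[rotated])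
qed

text \<open>Interleaving the binary digits of \<open>x\<close> and \<open>y\<close> and doubling
  them gives ternary digits in \<open>{0, 2}\<close>: even places encode \<open>x\<close>, odd
  places \<open>y\<close>, and \<open>schoenberg p\<close> reads the places
  \<open>2 * n + p\<close>.\<close>

lemma schoenberg_onto:
  assumes "0 \<le> x" "x < 1" "0 \<le> y" "y < 1"
  obtains t where "t \<in> {0..1}" "schoenberg 0 t = x" "schoenberg 1 t = y"
proof -
  obtain c where c: "\<And>n. c n \<in> {0, 1::nat}" "(\<lambda>n. real (c n) / 2 ^ Suc n) sums x"
    using binary_expansion[of x] assms by metis
  obtain d where d: "\<And>n. d n \<in> {0, 1::nat}" "(\<lambda>n. real (d n) / 2 ^ Suc n) sums y"
    using binary_expansion[of y] assms by metis
  define b where "b n = (if even n then c (n div 2) else d (n div 2))" for n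
  have b01: "b n \<in> {0, 1}" for n using c(1) d(1) by (auto simp: b_def)
  \<comment> \<open>\<open>T m\<close> has the ternary digit sequence with its first
    \<open>m\<close> places dropped; \<open>T 0\<close> is the preimage.\<close>
  define T where "T m = (\<Sum>n. 2 * real (b (n + m)) / 3 ^ Suc n)" for m
  have geo: "(\<lambda>n. 2 * (1 / 3) ^ Suc n) sums (1::real)"
    using sums_mult[OF geometric_sums[of "1 / 3 :: real"], of "2 / 3"] by simp
  have le: "2 * real (b (n + m)) / 3 ^ Suc n \<le> 2 * (1 / 3) ^ Suc n" for n m
    using b01[of "n + m"] by (auto simp: power_one_over)
  have sm: "summable (\<lambda>n. 2 * real (b (n + m)) / 3 ^ Suc n)" for m
    by (rule summable_comparison_test'[OF sums_summable[OF geo]]) (use le in auto)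
  have T0: "0 \<le> T m" for m unfolding T_def by (intro suminf_nonneg sm) auto
  have T1: "T m \<le> 1" for m
  proof -
    have "T m \<le> (\<Sum>n. 2 * (1 / 3) ^ Suc n)"
      unfolding T_def by (intro suminf_le le sm sums_summable[OF geo])
    then show ?thesis by (simp only: sums_unique[OF geo, symmetric])
  qed
  have T3: "3 * T m = 2 * real (b m) + T (Suc m)" for m
  proof -
    have "T m = 2 * real (b m) / 3 + (\<Sum>n. 2 * real (b (Suc n + m)) / 3 ^ Suc (Suc n))"
      unfolding T_def using suminf_split_head[OF sm[of m]] by simp
    also have "(\<Sum>n. 2 * real (b (Suc n + m)) / 3 ^ Suc (Suc n)) = T (Suc m) / 3"
      unfolding T_def using suminf_divide[OF sm[of "Suc m"], of 3]
      by (simp add: mult.commute)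
    finally show ?thesis by simp
  qed
  \<comment> \<open>The doubling of the digits pays off here: removing the leading one changes the
    argument by a whole multiple of \<open>2 * pi\<close>.\<close>
  have cosT: "cos (pi * (3 ^ m * T k)) = cos (pi * T (k + m))" for m k
  proof (induction m arbitrary: k)
    case (Suc m)
    have "pi * (3 ^ Suc m * T k) = pi * (3 ^ m * T (Suc k)) + 2 * real (3 ^ m * b k) * pi"
    proof -
      have "3 ^ Suc m * T k = 3 ^ m * (2 * real (b k) + T (Suc k))"
        by (simp flip: T3)
      then show ?thesis by (simp add: algebra_simps)
    qed
    also have "cos \<dots> = cos (pi * (3 ^ m * T (Suc k)))"
      by (simp only: cos_add cos_2npi sin_2npi)
    finally show ?case using Suc[of "Suc k"] by simp
  qed simp
  have cl: "clampcos (3 ^ m * T 0) = real (b m)" for m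
  proof (cases "b m = 0")
    case True
    then have "T m \<le> 1 / 3" using T3[of m] T1[of "Suc m"] by simp
    then have "cos (pi / 3) \<le> cos (pi * T m)"
      using T0[of m] by (intro cos_monotone_0_pi_le) (auto simp: field_simps)
    then show ?thesis using cosT[of m 0] True by (simp add: clampcos_def cos_60)
  next
    case False
    then have "b m = 1" using b01[of m] by auto
    then have "2 / 3 \<le> T m" using T3[of m] T0[of "Suc m"] by simp
    then have "cos (pi * T m) \<le> cos (pi - pi / 3)"
      using T1[of m] by (intro cos_monotone_0_pi_le) (auto simp: field_simps)
    then have "cos (pi * T m) \<le> - 1 / 2" by (simp add: cos_120)
    then show ?thesis using cosT[of m 0] \<open>b m = 1\<close> by (simp add: clampcos_def)
  qed
  show ?thesis
  proof
    show "T 0 \<in> {0..1}" using T0 T1 by auto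
    show "schoenberg 0 (T 0) = x"
      unfolding schoenberg_def cl using sums_unique[OF c(2)] by (simp add: b_def)
    show "schoenberg 1 (T 0) = y"
      unfolding schoenberg_def cl using sums_unique[OF d(2)] by (simp add: b_def)
  qed
qed

text \<open>The curve fills a square around the open disc, so \<open>g\<close> also takes values of
  modulus at least 1. In the compactification these stand for the point at infinity.\<close>

lemma disc_filling_curve:
  obtains g :: "real \<Rightarrow> complex" where "continuous_on UNIV g"
    "\<And>u. cmod u < 1 \<Longrightarrow> \<exists>t\<in>{0..1}. g t = u"
proof
  let ?g = "\<lambda>t. Complex (2 * schoenberg 0 t - 1) (2 * schoenberg 1 t - 1)"
  show "continuous_on UNIV ?g"
    by (intro continuous_intros continuous_on_schoenberg)
  fix u :: complex assume "cmod u < 1"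
  then have "0 \<le> (Re u + 1) / 2" "(Re u + 1) / 2 < 1" "0 \<le> (Im u + 1) / 2" "(Im u + 1) / 2 < 1"
    using abs_Re_le_cmod[of u] abs_Im_le_cmod[of u] by auto
  then obtain t where "t \<in> {0..1}" "schoenberg 0 t = (Re u + 1) / 2" "schoenberg 1 t = (Im u + 1) / 2"
    by (rule schoenberg_onto)
  then show "\<exists>t\<in>{0..1}. ?g t = u"
    by (intro bexI[of _ t]) (auto simp: complex_eq_iff)
qed

subsection \<open>The logarithmic kernel on the Riemann sphere\<close>

text \<open>
  This is \<open>1 - d\<^sup>2\<close> for the chordal distance \<open>d\<close> of the images of \<open>z\<close> and \<open>t\<close> on a sphere of diameter \<open>1\<close>.
\<close>

definition sph :: "complex \<Rightarrow> complex \<Rightarrow> real" where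
  "sph z t = (cmod (1 + z * cnj t))\<^sup>2 / ((1 + (cmod z)\<^sup>2) * (1 + (cmod t)\<^sup>2))"

text \<open>The real coordinates of the rank-one projection onto the line through
  \<open>(1, z)\<close> in \<open>C^2\<close>, in the space of Hermitian matrices with the trace
  inner product. The two off-diagonal entries contribute equally, whence
  \<open>sqrt 2\<close>.\<close>

definition feat :: "nat \<Rightarrow> complex \<Rightarrow> real" where
  "feat i z = [1, sqrt 2 * Re z, sqrt 2 * Im z, (cmod z)\<^sup>2] ! i / (1 + (cmod z)\<^sup>2)"

lemma one_plus_cmod_square_pos [simp]: "0 < 1 + (cmod z)\<^sup>2" "1 + (cmod z)\<^sup>2 \<noteq> 0"
  using zero_le_power2[of "cmod z"] by linarith+

lemma sph_eq_sum_feat: "sph z t = (\<Sum>i<4. feat i z * feat i t)"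
proof -
  have "(cmod (1 + z * cnj t))\<^sup>2 = 1 + 2 * Re z * Re t + 2 * Im z * Im t + (cmod z)\<^sup>2 * (cmod t)\<^sup>2"
    unfolding cmod_power2 by (simp add: power2_eq_square algebra_simps)
  then have "sph z t = 1 / (1 + (cmod z)\<^sup>2) * (1 / (1 + (cmod t)\<^sup>2)) *
      (1 + 2 * Re z * Re t + 2 * Im z * Im t + (cmod z)\<^sup>2 * (cmod t)\<^sup>2)"
    by (simp add: sph_def)
  also have "\<dots> = (\<Sum>i<4. feat i z * feat i t)"
    by (simp add: feat_def eval_nat_numeral lessThan_Suc algebra_simps add_divide_distrib)
  finally show ?thesis .
qed

lemma sph_commute: "sph z t = sph t z"
  by (simp add: sph_eq_sum_feat mult.commute)

text \<open>Lagrange's identity for the vectors \<open>(1, z)\<close> and \<open>(1, t)\<close>,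
  divided by their squared norms.\<close>

lemma one_minus_sph:
  "1 - sph z t = (cmod (z - t))\<^sup>2 / ((1 + (cmod z)\<^sup>2) * (1 + (cmod t)\<^sup>2))"
proof -
  have "(1 + (cmod z)\<^sup>2) * (1 + (cmod t)\<^sup>2) = (cmod (1 + z * cnj t))\<^sup>2 + (cmod (z - t))\<^sup>2"
    unfolding cmod_power2 by (simp add: power2_eq_square algebra_simps)
  then have "(cmod (z - t))\<^sup>2 = (1 + (cmod z)\<^sup>2) * (1 + (cmod t)\<^sup>2) - (cmod (1 + z * cnj t))\<^sup>2"
    by simp
  then show ?thesis
    unfolding sph_def by (simp add: diff_divide_distrib)
qed

lemma sph_nonneg: "0 \<le> sph z t"
  by (simp add: sph_def)

lemma sph_le_1: "sph z t \<le> 1"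
proof -
  have "0 \<le> 1 - sph z t" unfolding one_minus_sph by simp
  then show ?thesis by simp
qed

lemma sph_less_1: "z \<noteq> t \<Longrightarrow> sph z t < 1"
proof -
  assume "z \<noteq> t"
  then have "0 < 1 - sph z t" unfolding one_minus_sph by simp
  then show ?thesis by simp
qed

lemma sph_self: "sph z z = 1"
  using one_minus_sph[of z z] by simp

lemma continuous_on_sph: "continuous_on UNIV (\<lambda>p. sph (fst p) (snd p))"
  unfolding sph_def by (intro continuous_intros) auto

lemma borel_measurable_sph [measurable]:
  "(\<lambda>p. sph (fst p) (snd p)) \<in> borel_measurable (borel \<Otimes>\<^sub>M borel)"
  unfolding borel_prod by (rule borel_measurable_continuous_onI[OF continuous_on_sph])

lemma continuous_on_feat: "continuous_on UNIV (feat i)" if "i < 4"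
proof -
  have "i \<in> {0, 1, 2, 3}" using that by auto
  then show ?thesis
    unfolding feat_def by (auto intro!: continuous_intros)
qed

text \<open>The squares of the four features add up to \<open>sph z z = 1\<close>.\<close>

lemma abs_feat_le_1: "\<bar>feat i z\<bar> \<le> 1" if "i < 4"
proof -
  have "(feat i z)\<^sup>2 \<le> (\<Sum>i<4. (feat i z)\<^sup>2)"
    using that by (intro member_le_sum) auto
  also have "\<dots> = 1"
    using sph_eq_sum_feat[of z z] by (simp add: sph_self power2_eq_square)
  finally show ?thesis by (simp add: abs_square_le_1)
qed

section \<open>The logarithm as a series of powers\<close>

text \<open>The extended value of \<open>-log(1 - h) / 2\<close>, including \<open>\<infinity>\<close> at \<open>h = 1\<close>.\<close>

definition ell :: "real \<Rightarrow> ennreal" where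
  "ell h = (\<Sum>n. ennreal (h ^ Suc n / (2 * real (Suc n))))"

lemma ell_less_1:
  assumes "0 \<le> h" "h < 1"
  shows "ell h = ennreal (- ln (1 - h) / 2)"
proof -
  have "(\<lambda>n. - (h ^ n) / real n) sums ln (1 - h)"
    using ln_series'[of "- h"] assms by simp
  \<comment> \<open>The term of index 0 is \<open>- 1 / 0\<close>, hence \<open>0\<close>, so the
    series may start at 1.\<close>
  then have "(\<lambda>n. - (h ^ Suc n) / real (Suc n)) sums ln (1 - h)"
    by (subst sums_Suc_iff) simp
  then have "(\<lambda>n. (- 1 / 2) * (- (h ^ Suc n) / real (Suc n))) sums ((- 1 / 2) * ln (1 - h))"
    by (rule sums_mult)
  then have "(\<lambda>n. h ^ Suc n / (2 * real (Suc n))) sums (- ln (1 - h) / 2)"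
    by (simp add: mult.commute)
  then show ?thesis
    unfolding ell_def using assms by (intro suminf_ennreal_eq) auto
qed

lemma ell_1: "ell 1 = \<top>"
proof (rule ccontr)
  assume "ell 1 \<noteq> \<top>"
  then have "summable (\<lambda>n. 1 / (2 * real (Suc n)))"
    unfolding ell_def by (intro summable_suminf_not_top) auto
  from summable_mult[OF this, of 2] have "summable (\<lambda>n. 2 * (1 / (2 * real (Suc n))))" .
  also have "(\<lambda>n. 2 * (1 / (2 * real (Suc n)))) = (\<lambda>n. inverse (real (Suc n)))"
    by (simp add: field_simps fun_eq_iff)
  finally have "summable (\<lambda>n. inverse (real (Suc n)))" .
  then show False
    using not_summable_harmonic[where 'a = real] summable_Suc_iff[of "\<lambda>n. inverse (real n)"] by simp
qed

lemma borel_measurable_ell [measurable]: "ell \<in> borel_measurable borel"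
  unfolding ell_def[abs_def] by measurable

text \<open>A supremum of partial sums that depend continuously on the argument is lower
  semicontinuous. The case \<open>l = 1\<close>, where \<open>ell\<close> is infinite, is the one
  that handles both the diagonal and infinity.\<close>

lemma ell_lsc:
  assumes "(h \<longlongrightarrow> l) F"
  shows "ell l \<le> Liminf F (\<lambda>n. ell (h n))"
  unfolding le_Liminf_iff
proof (intro allI impI)
  fix y assume "y < ell l"
  then obtain N where "y < (\<Sum>n<N. ennreal (l ^ Suc n / (2 * real (Suc n))))"
    unfolding ell_def suminf_eq_SUP by (auto simp: less_SUP_iff)
  moreover have "((\<lambda>k. \<Sum>n<N. ennreal (h k ^ Suc n / (2 * real (Suc n)))) \<longlongrightarrow>
      (\<Sum>n<N. ennreal (l ^ Suc n / (2 * real (Suc n))))) F"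
    by (intro tendsto_sum tendsto_ennrealI tendsto_intros assms) auto
  ultimately have "\<forall>\<^sub>F k in F. y < (\<Sum>n<N. ennreal (h k ^ Suc n / (2 * real (Suc n))))"
    by (simp add: order_tendsto_iff)
  then show "\<forall>\<^sub>F k in F. y < ell (h k)"
  proof eventually_elim
    case (elim k)
    also have "(\<Sum>n<N. ennreal (h k ^ Suc n / (2 * real (Suc n)))) \<le> ell (h k)"
      unfolding ell_def suminf_eq_SUP by (rule SUP_upper) simp
    finally show ?case .
  qed
qed

lemma ln_one_minus_sph:
  assumes "z \<noteq> t"
  shows "ln (1 - sph z t) = 2 * ln (cmod (z - t)) - (ln (1 + (cmod z)\<^sup>2) + ln (1 + (cmod t)\<^sup>2))"
  unfolding one_minus_sph using assms by (simp add: ln_div ln_mult ln_realpow)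

lemma ell_sph:
  assumes "z \<noteq> t"
  shows "ell (sph z t) = ennreal (- ln (cmod (z - t)) + ln (1 + (cmod z)\<^sup>2) / 2 + ln (1 + (cmod t)\<^sup>2) / 2)"
proof -
  have "- ln (1 - sph z t) / 2 =
      - ln (cmod (z - t)) + ln (1 + (cmod z)\<^sup>2) / 2 + ln (1 + (cmod t)\<^sup>2) / 2"
    by (simp add: ln_one_minus_sph[OF assms])
  then show ?thesis
    by (simp only: ell_less_1[OF sph_nonneg sph_less_1[OF assms]])
qed

lemma log_dist_le:
  assumes "z \<noteq> t"
  shows "ln (cmod (z - t)) \<le> ln (1 + (cmod z)\<^sup>2) / 2 + ln (1 + (cmod t)\<^sup>2) / 2"
proof -
  have "ln (1 - sph z t) \<le> 0"
    using sph_nonneg[of z t] sph_less_1[OF assms] by simp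
  then show ?thesis by (simp add: ln_one_minus_sph[OF assms])
qed

lemma sph_tendsto:
  assumes "(z \<longlongrightarrow> a) F" "(t \<longlongrightarrow> b) F"
  shows "((\<lambda>n. sph (z n) (t n)) \<longlongrightarrow> sph a b) F"
  unfolding sph_def by (intro tendsto_intros assms) auto

text \<open>Both points tend to the pole of the sphere, so their chordal distance tends to 0.
  Quantitatively, \<open>|a - b|^2 \<le> 2 |a|^2 + 2 |b|^2\<close> controls
  \<open>1 - sph a b\<close>.\<close>

lemma sph_tendsto_at_infinity:
  assumes "filterlim z at_infinity F" "filterlim t at_infinity F"
  shows "((\<lambda>n. sph (z n) (t n)) \<longlongrightarrow> 1) F"
proof -
  have lim: "((\<lambda>n. 2 / (1 + (cmod (u n))\<^sup>2)) \<longlongrightarrow> 0) F" if "filterlim u at_infinity F" for u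
  proof (rule tendsto_divide_0[OF tendsto_const])
    have "filterlim (\<lambda>n. cmod (u n)) at_top F"
      by (rule filterlim_compose[OF filterlim_norm_at_top that])
    then have "filterlim (\<lambda>n. 1 + (cmod (u n))\<^sup>2) at_top F"
      by (intro filterlim_tendsto_add_at_top[OF tendsto_const] filterlim_pow_at_top) auto
    then show "filterlim (\<lambda>n. 1 + (cmod (u n))\<^sup>2) at_infinity F"
      by (rule filterlim_at_top_imp_at_infinity)
  qed
  have *: "1 - sph a b \<le> 2 / (1 + (cmod a)\<^sup>2) + 2 / (1 + (cmod b)\<^sup>2)" for a b
  proof -
    have "cmod (a - b) \<le> cmod a + cmod b" by (rule norm_triangle_ineq4)
    then have "(cmod (a - b))\<^sup>2 \<le> (cmod a + cmod b)\<^sup>2" by (intro power_mono) auto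
    also have "\<dots> \<le> 2 * (1 + (cmod b)\<^sup>2) + 2 * (1 + (cmod a)\<^sup>2)"
      using sum_squares_bound[of "cmod a" "cmod b"] by (simp add: power2_sum)
    finally have "1 - sph a b \<le> (2 * (1 + (cmod b)\<^sup>2) + 2 * (1 + (cmod a)\<^sup>2)) / ((1 + (cmod a)\<^sup>2) * (1 + (cmod b)\<^sup>2))"
      unfolding one_minus_sph by (intro divide_right_mono) auto
    moreover have "(2 * y + 2 * x) / (x * y) = 2 / x + 2 / y" if "x > 0" "y > 0" for x y :: real
      using that by (simp add: field_simps)
    ultimately show ?thesis by (metis one_plus_cmod_square_pos(1))
  qed
  have "((\<lambda>n. 1 - sph (z n) (t n)) \<longlongrightarrow> 0) F"
  proof (rule tendsto_sandwich[OF _ _ tendsto_const])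
    show "((\<lambda>n. 2 / (1 + (cmod (z n))\<^sup>2) + 2 / (1 + (cmod (t n))\<^sup>2)) \<longlongrightarrow> 0) F"
      using tendsto_add[OF lim[OF assms(1)] lim[OF assms(2)]] by simp
  qed (use sph_le_1 * in \<open>auto intro!: always_eventually\<close>)
  from tendsto_diff[OF tendsto_const[of 1] this] show ?thesis by simp
qed

subsection \<open>Positive definiteness and uniqueness\<close>

definition feat_monomial :: "nat \<Rightarrow> (nat \<Rightarrow> nat) \<Rightarrow> complex \<Rightarrow> real" where
  "feat_monomial n w z = (\<Prod>j<n. feat (w j) z)"

text \<open>Expanding the power gives one product per word \<open>w\<close> of length
  \<open>n\<close> over the four features, so each power of the kernel is again a Gram kernel with
  finitely many features.\<close>

lemma sph_power_eq_sum_monomial: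
  "sph z t ^ n = (\<Sum>w\<in>{..<n} \<rightarrow>\<^sub>E {..<4}. feat_monomial n w z * feat_monomial n w t)"
proof -
  have "sph z t ^ n = (\<Prod>j<n. \<Sum>i<4. feat i z * feat i t)"
    by (simp add: sph_eq_sum_feat)
  also have "\<dots> = (\<Sum>w\<in>{..<n} \<rightarrow>\<^sub>E {..<4}. \<Prod>j<n. feat (w j) z * feat (w j) t)"
    by (rule prod_sum_PiE) auto
  finally show ?thesis by (simp add: feat_monomial_def prod.distrib)
qed

lemma abs_monomial_le_1: "w \<in> {..<n} \<rightarrow> {..<4} \<Longrightarrow> \<bar>feat_monomial n w z\<bar> \<le> 1"
  unfolding feat_monomial_def abs_prod by (rule prod_le_1) (auto intro!: abs_feat_le_1)

lemma borel_measurable_monomial: "w \<in> {..<n} \<rightarrow> {..<4} \<Longrightarrow> feat_monomial n w \<in> borel_measurable borel"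
  unfolding feat_monomial_def[abs_def]
  by (intro borel_measurable_continuous_onI continuous_on_prod continuous_on_feat) auto

section \<open>Energies as series of products of moments\<close>

locale borel_prob = prob_space M for M :: "'a::topological_space measure" +
  assumes sets_M [measurable_cong, simp]: "sets M = sets borel"
begin

lemma space_M [simp]: "space M = UNIV"
  using sets_eq_imp_space_eq[OF sets_M] by simp

lemma integrable_bounded:
  fixes f :: "'a \<Rightarrow> real"
  assumes "f \<in> borel_measurable borel" "\<And>x. \<bar>f x\<bar> \<le> B"
  shows "integrable M f"
  by (rule integrable_const_bound[where B = B])
     (use assms measurable_cong_sets[OF sets_M refl] in auto)

end

lemma integrable_monomial:
  assumes "borel_prob M" "w \<in> {..<n} \<rightarrow> {..<4}"
  shows "integrable M (feat_monomial n w)"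
  using borel_prob.integrable_bounded[OF assms(1) borel_measurable_monomial[OF assms(2)]]
    abs_monomial_le_1[OF assms(2)] by blast

text \<open>The second claim makes the first one usable: \<open>ennreal\<close> would send a
  negative sum to \<open>0\<close>, and single products of moments may well be negative.\<close>

lemma nn_integral_sph_power:
  assumes M: "borel_prob M" and N: "borel_prob N"
  shows "(\<integral>\<^sup>+z. \<integral>\<^sup>+t. ennreal (sph z t ^ n) \<partial>N \<partial>M) =
    ennreal (\<Sum>w\<in>{..<n} \<rightarrow>\<^sub>E {..<4}. (\<integral>z. feat_monomial n w z \<partial>M) * (\<integral>t. feat_monomial n w t \<partial>N))"
    and "0 \<le> (\<Sum>w\<in>{..<n} \<rightarrow>\<^sub>E {..<4}. (\<integral>z. feat_monomial n w z \<partial>M) * (\<integral>t. feat_monomial n w t \<partial>N))"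
proof -
  let ?W = "{..<n} \<rightarrow>\<^sub>E {..<4::nat}"
  have int: "integrable M (feat_monomial n w)" "integrable N (feat_monomial n w)" if "w \<in> ?W" for w
    using that by (auto intro!: integrable_monomial M N)
  have inner: "(\<integral>t. sph z t ^ n \<partial>N) = (\<Sum>w\<in>?W. feat_monomial n w z * (\<integral>t. feat_monomial n w t \<partial>N))" for z
    unfolding sph_power_eq_sum_monomial by (subst Bochner_Integration.integral_sum) (auto intro!: int)
  have intN: "integrable N (\<lambda>t. sph z t ^ n)" for z
    unfolding sph_power_eq_sum_monomial by (intro Bochner_Integration.integrable_sum integrable_mult_right int)
  have intM: "integrable M (\<lambda>z. \<Sum>w\<in>?W. feat_monomial n w z * (\<integral>t. feat_monomial n w t \<partial>N))"
    by (intro Bochner_Integration.integrable_sum integrable_mult_left int)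
  have nn: "0 \<le> (\<Sum>w\<in>?W. feat_monomial n w z * (\<integral>t. feat_monomial n w t \<partial>N))" for z
    unfolding inner[symmetric] by (intro Bochner_Integration.integral_nonneg) (simp add: sph_nonneg)
  have outer: "(\<integral>z. (\<Sum>w\<in>?W. feat_monomial n w z * (\<integral>t. feat_monomial n w t \<partial>N)) \<partial>M) =
      (\<Sum>w\<in>?W. (\<integral>z. feat_monomial n w z \<partial>M) * (\<integral>t. feat_monomial n w t \<partial>N))"
    by (subst Bochner_Integration.integral_sum) (auto intro!: int)
  have "(\<integral>\<^sup>+z. \<integral>\<^sup>+t. ennreal (sph z t ^ n) \<partial>N \<partial>M) =
      (\<integral>\<^sup>+z. ennreal (\<Sum>w\<in>?W. feat_monomial n w z * (\<integral>t. feat_monomial n w t \<partial>N)) \<partial>M)"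
    by (intro nn_integral_cong) (simp add: nn_integral_eq_integral[OF intN] sph_nonneg inner)
  then show "(\<integral>\<^sup>+z. \<integral>\<^sup>+t. ennreal (sph z t ^ n) \<partial>N \<partial>M) =
    ennreal (\<Sum>w\<in>?W. (\<integral>z. feat_monomial n w z \<partial>M) * (\<integral>t. feat_monomial n w t \<partial>N))"
    by (simp add: nn_integral_eq_integral[OF intM] nn outer)
  show "0 \<le> (\<Sum>w\<in>?W. (\<integral>z. feat_monomial n w z \<partial>M) * (\<integral>t. feat_monomial n w t \<partial>N))"
    unfolding outer[symmetric] by (intro Bochner_Integration.integral_nonneg nn)
qed

text \<open>All terms are nonnegative, so series and integrals may be exchanged even if the energy
  is infinite.\<close>

lemma nn_integral_ell_sph:
  assumes M: "borel_prob M" and N: "borel_prob N"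
  shows "(\<integral>\<^sup>+z. \<integral>\<^sup>+t. ell (sph z t) \<partial>N \<partial>M) =
    (\<Sum>n. ennreal ((\<Sum>w\<in>{..<Suc n} \<rightarrow>\<^sub>E {..<4}.
       (\<integral>z. feat_monomial (Suc n) w z \<partial>M) * (\<integral>t. feat_monomial (Suc n) w t \<partial>N)) / (2 * real (Suc n))))"
proof -
  interpret M: borel_prob M by fact
  interpret N: borel_prob N by fact
  have [measurable]: "(\<lambda>p. sph (fst p) (snd p)) \<in> borel_measurable (M \<Otimes>\<^sub>M N)"
    using borel_measurable_sph by (simp cong: measurable_cong_sets)
  have meas: "(\<lambda>p. ennreal (sph (fst p) (snd p) ^ n / c)) \<in> borel_measurable (M \<Otimes>\<^sub>M N)" for n c
    by measurable
  have measN: "(\<lambda>t. ennreal (sph z t ^ n / c)) \<in> borel_measurable N" for z n c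
    using measurable_compose[OF measurable_Pair1' meas] by simp
  have measM: "(\<lambda>z. \<integral>\<^sup>+t. ennreal (sph z t ^ n / c) \<partial>N) \<in> borel_measurable M" for n c
    using N.borel_measurable_nn_integral_fst[OF meas] by simp
  have "(\<integral>\<^sup>+z. \<integral>\<^sup>+t. ell (sph z t) \<partial>N \<partial>M) =
      (\<Sum>n. \<integral>\<^sup>+z. \<integral>\<^sup>+t. ennreal (sph z t ^ Suc n / (2 * real (Suc n))) \<partial>N \<partial>M)"
    unfolding ell_def by (simp only: nn_integral_suminf[OF measN] nn_integral_suminf[OF measM])
  also have "\<dots> = (\<Sum>n. ennreal (1 / (2 * real (Suc n))) * (\<integral>\<^sup>+z. \<integral>\<^sup>+t. ennreal (sph z t ^ Suc n) \<partial>N \<partial>M))"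
  proof (rule suminf_cong)
    fix n
    have eq: "ennreal (sph z t ^ Suc n / (2 * real (Suc n))) =
        ennreal (1 / (2 * real (Suc n))) * ennreal (sph z t ^ Suc n)" for z t
      by (subst ennreal_mult[symmetric]) (auto simp: sph_nonneg)
    show "(\<integral>\<^sup>+z. \<integral>\<^sup>+t. ennreal (sph z t ^ Suc n / (2 * real (Suc n))) \<partial>N \<partial>M) =
        ennreal (1 / (2 * real (Suc n))) * (\<integral>\<^sup>+z. \<integral>\<^sup>+t. ennreal (sph z t ^ Suc n) \<partial>N \<partial>M)"
    proof -
      have mN: "(\<lambda>t. ennreal (sph z t ^ Suc n)) \<in> borel_measurable N" for z
        using measN[of z "Suc n" 1] by (simp only: div_by_1)
      have mM: "(\<lambda>z. \<integral>\<^sup>+t. ennreal (sph z t ^ Suc n) \<partial>N) \<in> borel_measurable M"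
        using measM[of "Suc n" 1] by (simp only: div_by_1)
      show ?thesis
        unfolding eq by (simp only: nn_integral_cmult[OF mN] nn_integral_cmult[OF mM])
    qed
  qed
  also have "\<dots> = (\<Sum>n. ennreal ((\<Sum>w\<in>{..<Suc n} \<rightarrow>\<^sub>E {..<4}.
       (\<integral>z. feat_monomial (Suc n) w z \<partial>M) * (\<integral>t. feat_monomial (Suc n) w t \<partial>N)) / (2 * real (Suc n))))"
  proof (rule suminf_cong)
    fix n
    let ?S = "\<Sum>w\<in>{..<Suc n} \<rightarrow>\<^sub>E {..<4}. (\<integral>z. feat_monomial (Suc n) w z \<partial>M) * (\<integral>t. feat_monomial (Suc n) w t \<partial>N)"
    have "ennreal (1 / (2 * real (Suc n))) * ennreal ?S = ennreal (1 / (2 * real (Suc n)) * ?S)"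
      by (rule ennreal_mult[symmetric]) (simp_all only: nn_integral_sph_power(2)[OF M N], simp)
    then show "ennreal (1 / (2 * real (Suc n))) * (\<integral>\<^sup>+z. \<integral>\<^sup>+t. ennreal (sph z t ^ Suc n) \<partial>N \<partial>M) =
        ennreal (?S / (2 * real (Suc n)))"
      by (simp only: nn_integral_sph_power(1)[OF M N] times_divide_eq_left mult_1_left)
  qed
  finally show ?thesis .
qed

text \<open>Let \<open>a\<close>, \<open>c\<close> and \<open>b\<close> be the terms of the series
  for the energies of \<open>M\<close> and \<open>N\<close> and for their mutual energy. Then
  \<open>a + c - 2 * b\<close> is a weighted sum of squared differences of moments, and
  \<open>le\<close> makes this series of nonnegative terms sum to at most \<open>0\<close>. The
  energy series begins with first powers, hence \<open>n > 0\<close>.\<close>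

lemma moments_eq_of_energy_le:
  assumes M: "borel_prob M" and N: "borel_prob N"
    and fin: "(\<integral>\<^sup>+z. \<integral>\<^sup>+t. ell (sph z t) \<partial>M \<partial>M) < \<infinity>" "(\<integral>\<^sup>+z. \<integral>\<^sup>+t. ell (sph z t) \<partial>N \<partial>N) < \<infinity>"
    and le: "(\<integral>\<^sup>+z. \<integral>\<^sup>+t. ell (sph z t) \<partial>M \<partial>M) + (\<integral>\<^sup>+z. \<integral>\<^sup>+t. ell (sph z t) \<partial>N \<partial>N)
        \<le> 2 * (\<integral>\<^sup>+z. \<integral>\<^sup>+t. ell (sph z t) \<partial>N \<partial>M)"
    and n: "n > 0" and w: "w \<in> {..<n} \<rightarrow>\<^sub>E {..<4}"
  shows "(\<integral>z. feat_monomial n w z \<partial>M) = (\<integral>z. feat_monomial n w z \<partial>N)"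
proof -
  define m where "m n w = (\<integral>z. feat_monomial n w z \<partial>M)" for n w
  define l where "l n w = (\<integral>z. feat_monomial n w z \<partial>N)" for n w
  let ?W = "\<lambda>n::nat. {..<n} \<rightarrow>\<^sub>E {..<4::nat}"
  have finW: "finite (?W n)" for n by (intro finite_PiE) auto
  define a where "a n = (\<Sum>w\<in>?W (Suc n). m (Suc n) w * m (Suc n) w) / (2 * real (Suc n))" for n
  define b where "b n = (\<Sum>w\<in>?W (Suc n). m (Suc n) w * l (Suc n) w) / (2 * real (Suc n))" for n
  define c where "c n = (\<Sum>w\<in>?W (Suc n). l (Suc n) w * l (Suc n) w) / (2 * real (Suc n))" for n
  note E = nn_integral_ell_sph[OF M M, folded m_def, folded a_def]
    nn_integral_ell_sph[OF M N, folded m_def l_def, folded b_def]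
    nn_integral_ell_sph[OF N N, folded l_def, folded c_def]
  have nn: "0 \<le> a n" "0 \<le> b n" "0 \<le> c n" for n
    using nn_integral_sph_power(2)[OF M M, of "Suc n"] nn_integral_sph_power(2)[OF M N, of "Suc n"]
      nn_integral_sph_power(2)[OF N N, of "Suc n"]
    unfolding a_def b_def c_def m_def l_def by simp_all
  have abc: "a n + c n - 2 * b n = (\<Sum>w\<in>?W (Suc n). (m (Suc n) w - l (Suc n) w)\<^sup>2) / (2 * real (Suc n))" for n
  proof -
    have "(\<Sum>w\<in>?W (Suc n). (m (Suc n) w - l (Suc n) w)\<^sup>2) =
        (\<Sum>w\<in>?W (Suc n). m (Suc n) w * m (Suc n) w) + (\<Sum>w\<in>?W (Suc n). l (Suc n) w * l (Suc n) w)
        - 2 * (\<Sum>w\<in>?W (Suc n). m (Suc n) w * l (Suc n) w)"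
      unfolding sum_distrib_left sum.distrib[symmetric] sum_subtractf[symmetric]
      by (intro sum.cong refl) (simp add: power2_eq_square algebra_simps)
    then show ?thesis unfolding a_def b_def c_def by (simp add: add_divide_distrib diff_divide_distrib)
  qed
  have abc0: "0 \<le> a n + c n - 2 * b n" for n
    unfolding abc by (intro divide_nonneg_nonneg sum_nonneg) auto
  have sa: "summable a"
    by (rule summable_suminf_not_top[OF nn(1)]) (use fin(1) in \<open>simp only: E infinity_ennreal_def less_top\<close>)
  have sc: "summable c"
    by (rule summable_suminf_not_top[OF nn(3)]) (use fin(2) in \<open>simp only: E infinity_ennreal_def less_top\<close>)
  \<comment> \<open>The mutual energy is finite by \<open>2 * b n \<le> a n + c n\<close>, so the
    three series can be combined as real numbers.\<close>
  have sb: "summable b"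
  proof (rule summable_comparison_test'[OF summable_add[OF sa sc]])
    show "norm (b n) \<le> a n + c n" for n using abc0[of n] nn[of n] by simp
  qed
  have "ennreal (suminf a) + ennreal (suminf c) \<le> 2 * ennreal (suminf b)"
    using le unfolding E by (simp add: suminf_ennreal2 nn sa sb sc)
  also have "2 * ennreal (suminf b) = ennreal (2 * suminf b)"
    by (simp add: ennreal_mult suminf_nonneg nn sb)
  finally have "suminf a + suminf c \<le> 2 * suminf b"
    by (simp add: ennreal_plus[symmetric] suminf_nonneg nn sa sb sc del: ennreal_plus)
  moreover have "(\<lambda>n. a n + c n - 2 * b n) sums (suminf a + suminf c - 2 * suminf b)"
    by (intro sums_diff sums_add sums_mult summable_sums sa sb sc)
  ultimately have "(\<Sum>n. a n + c n - 2 * b n) \<le> 0"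
    by (simp add: sums_iff)
  moreover have sd: "summable (\<lambda>n. a n + c n - 2 * b n)"
    by (intro summable_diff summable_add summable_mult sa sb sc)
  ultimately have "(\<Sum>n. a n + c n - 2 * b n) = 0"
    using suminf_nonneg[OF sd abc0] by simp
  then have "a k + c k - 2 * b k = 0" for k
    using suminf_eq_zero_iff[OF sd abc0] by blast
  then have "(\<Sum>w\<in>?W (Suc k). (m (Suc k) w - l (Suc k) w)\<^sup>2) = 0" for k
    by (simp add: abc)
  then have "w \<in> ?W (Suc k) \<Longrightarrow> m (Suc k) w = l (Suc k) w" for k w
    by (subst (asm) sum_nonneg_eq_0_iff) (auto simp: finW)
  then show ?thesis using n w unfolding m_def l_def by (metis Suc_pred)
qed

section \<open>Recovering a measure from integrals of continuous functions and from its
  moments\<close>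

lemma borel_prob_eqI_continuous:
  fixes M N :: "'a::metric_space measure"
  assumes M: "borel_prob M" and N: "borel_prob N"
    and eq: "\<And>f :: 'a \<Rightarrow> real. continuous_on UNIV f \<Longrightarrow> (\<And>x. \<bar>f x\<bar> \<le> 1) \<Longrightarrow> (\<integral>x. f x \<partial>M) = (\<integral>x. f x \<partial>N)"
  shows "M = N"
proof (rule measure_eqI_generator_eq[where E = "Collect closed" and \<Omega> = UNIV and A = "\<lambda>_. UNIV"])
  interpret M: borel_prob M by fact
  interpret N: borel_prob N by fact
  show "Int_stable (Collect closed :: 'a set set)" by (auto simp: Int_stable_def)
  show "sets M = sigma_sets UNIV (Collect closed)" "sets N = sigma_sets UNIV (Collect closed)"
    by (simp_all add: borel_eq_closed)
  show "emeasure M UNIV \<noteq> \<infinity>" for i :: nat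
    using M.emeasure_finite[of UNIV] by simp
  fix S :: "'a set" assume "S \<in> Collect closed"
  then have S: "closed S" by simp
  show "emeasure M S = emeasure N S"
  \<comment> \<open>\<open>infdist x {}\<close> is \<open>0\<close> by convention, so the functions
    \<open>f n\<close> would not tend to the indicator of the empty set.\<close>
  proof (cases "S = {}")
    case False
    \<comment> \<open>Tents of slope \<open>n\<close> over \<open>S\<close> decrease to its
      indicator, because \<open>infdist\<close> is positive off a nonempty closed set.\<close>
    define f where "f n x = max 0 (1 - real n * infdist x S)" for n x
    have f01: "\<bar>f n x\<bar> \<le> 1" for n x
      by (auto simp: f_def infdist_nonneg)
    have cf: "continuous_on UNIV (f n)" for n
      unfolding f_def by (intro continuous_intros)
    have lim: "(\<lambda>n. f n x) \<longlonglongrightarrow> indicator S x" for x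
    proof (cases "x \<in> S")
      case True
      then show ?thesis by (simp add: f_def)
    next
      case xS: False
      then have pos: "infdist x S > 0"
        using infdist_pos_not_in_closed[OF S False] by simp
      then obtain m :: nat where m: "real m * infdist x S > 1"
        by (metis reals_Archimedean3)
      have "\<forall>\<^sub>F n in sequentially. f n x = 0"
        using eventually_ge_at_top[of m]
      proof eventually_elim
        case (elim n)
        have "real m * infdist x S \<le> real n * infdist x S"
          using elim pos by (intro mult_right_mono) auto
        then show ?case using m by (simp add: f_def)
      qed
      then show ?thesis using xS by (simp add: tendsto_eventually)
    qed
    have conv: "(\<lambda>n. \<integral>x. f n x \<partial>L) \<longlonglongrightarrow> measure L S" if L: "borel_prob L" for L
    proof -
      interpret L: borel_prob L by fact
      have "(\<lambda>n. \<integral>x. f n x \<partial>L) \<longlonglongrightarrow> (\<integral>x. indicator S x \<partial>L)"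
      proof (rule integral_dominated_convergence[where w = "\<lambda>_. 1"])
        show "f n \<in> borel_measurable L" for n
          using borel_measurable_continuous_onI[OF cf] by (simp cong: measurable_cong_sets)
        show "(indicator S :: 'a \<Rightarrow> real) \<in> borel_measurable L"
          using S by (intro borel_measurable_indicator) (simp add: borel_closed)
      qed (use lim f01 in auto)
      then show ?thesis by simp
    qed
    have "(\<lambda>n. \<integral>x. f n x \<partial>M) = (\<lambda>n. \<integral>x. f n x \<partial>N)"
      by (intro ext eq cf f01)
    with conv[OF M] conv[OF N] have "measure M S = measure N S"
      by (metis LIMSEQ_unique)
    then show ?thesis by (simp add: M.emeasure_eq_measure N.emeasure_eq_measure)
  qed simp
qed auto

text \<open>Inverse stereographic projection up to an affine change of coordinates, with image in an
  ellipsoid. \<open>feat 0\<close> is left out because it equals \<open>1 - feat 3\<close>.\<close>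

definition sphere_emb :: "complex \<Rightarrow> complex \<times> real" where
  "sphere_emb z = (Complex (feat 1 z) (feat 2 z), feat 3 z)"

lemma continuous_on_sphere_emb: "continuous_on UNIV sphere_emb"
  unfolding sphere_emb_def by (intro continuous_intros continuous_on_feat) auto

lemma norm_sphere_emb: "norm (sphere_emb z) \<le> 3"
proof -
  have "norm (sphere_emb z) \<le> norm (Complex (feat 1 z) (feat 2 z)) + norm (feat 3 z)"
    unfolding sphere_emb_def by (rule norm_Pair_le)
  also have "\<dots> \<le> (\<bar>feat 1 z\<bar> + \<bar>feat 2 z\<bar>) + \<bar>feat 3 z\<bar>"
    using cmod_le[of "Complex (feat 1 z) (feat 2 z)"] by simp
  finally show ?thesis using abs_feat_le_1[of 1 z] abs_feat_le_1[of 2 z] abs_feat_le_1[of 3 z] by simp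
qed

text \<open>
  Testing against all feature monomials makes this class closed under multiplication by features, and
  thus by polynomials in them.
\<close>

definition indist :: "complex measure \<Rightarrow> complex measure \<Rightarrow> (complex \<Rightarrow> real) \<Rightarrow> bool" where
  "indist M N g \<longleftrightarrow> g \<in> borel_measurable borel \<and> (\<exists>B. \<forall>z. \<bar>g z\<bar> \<le> B) \<and>
     (\<forall>n w. w \<in> {..<n} \<rightarrow> {..<4} \<longrightarrow> (\<integral>z. g z * feat_monomial n w z \<partial>M) = (\<integral>z. g z * feat_monomial n w z \<partial>N))"

context
  fixes M N :: "complex measure"
  assumes M: "borel_prob M" and N: "borel_prob N"
begin

lemma indist_integrable:
  assumes "indist M N g" "w \<in> {..<n} \<rightarrow> {..<4}" "L = M \<or> L = N"
  shows "integrable L (\<lambda>z. g z * feat_monomial n w z)"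
proof -
  obtain B where B: "\<And>z. \<bar>g z\<bar> \<le> B" using assms(1) by (auto simp: indist_def)
  have "\<bar>g z * feat_monomial n w z\<bar> \<le> B * 1" for z
    unfolding abs_mult using B[of z] abs_monomial_le_1[OF assms(2), of z]
    by (intro mult_mono) auto
  moreover have "(\<lambda>z. g z * feat_monomial n w z) \<in> borel_measurable borel"
    using assms(1) by (intro borel_measurable_times borel_measurable_monomial assms) (auto simp: indist_def)
  ultimately show ?thesis
    using assms(3) M N borel_prob.integrable_bounded by blast
qed

lemma indist_add:
  assumes f: "indist M N f" and g: "indist M N g"
  shows "indist M N (\<lambda>z. f z + g z)"
proof -
  obtain B C where BC: "\<And>z. \<bar>f z\<bar> \<le> B" "\<And>z. \<bar>g z\<bar> \<le> C" using f g by (auto simp: indist_def)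
  have "\<bar>f z + g z\<bar> \<le> B + C" for z using BC(1)[of z] BC(2)[of z] by linarith
  moreover have "(\<integral>z. (f z + g z) * feat_monomial n w z \<partial>M) = (\<integral>z. (f z + g z) * feat_monomial n w z \<partial>N)"
    if "w \<in> {..<n} \<rightarrow> {..<4}" for n w
    using f g that by (simp add: distrib_right indist_integrable) (simp add: indist_def)
  ultimately show ?thesis using f g unfolding indist_def by (intro conjI) auto
qed

lemma indist_cmult:
  assumes f: "indist M N f"
  shows "indist M N (\<lambda>z. c * f z)"
proof -
  obtain B where "\<And>z. \<bar>f z\<bar> \<le> B" using f by (auto simp: indist_def)
  then have "\<bar>c * f z\<bar> \<le> \<bar>c\<bar> * B" for z by (simp add: abs_mult mult_left_mono)
  then show ?thesis using f unfolding indist_def by (auto simp: mult.assoc)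
qed

text \<open>A further feature only lengthens the word by one letter, which stays within the tested
  family of monomials.\<close>

lemma indist_feat:
  assumes f: "indist M N f" and i: "i < 4"
  shows "indist M N (\<lambda>z. feat i z * f z)"
proof -
  obtain B where B: "\<And>z. \<bar>f z\<bar> \<le> B" using f by (auto simp: indist_def)
  have "\<bar>feat i z * f z\<bar> \<le> 1 * B" for z
    unfolding abs_mult using B[of z] abs_feat_le_1[OF i, of z] by (intro mult_mono) auto
  moreover have "(\<integral>z. feat i z * f z * feat_monomial n w z \<partial>M) = (\<integral>z. feat i z * f z * feat_monomial n w z \<partial>N)"
    if w: "w \<in> {..<n} \<rightarrow> {..<4}" for n w
  proof -
    have monomial_Suc: "feat_monomial (Suc n) (w(n := i)) z = feat_monomial n w z * feat i z" for z
    proof -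
      have "(\<Prod>j<n. feat ((w(n := i)) j) z) = (\<Prod>j<n. feat (w j) z)" by (intro prod.cong) auto
      then show ?thesis by (simp add: feat_monomial_def)
    qed
    have "w(n := i) \<in> {..<Suc n} \<rightarrow> {..<4}" using w i by (auto simp: less_Suc_eq)
    have "feat i z * f z * feat_monomial n w z = f z * feat_monomial (Suc n) (w(n := i)) z" for z
      by (simp add: monomial_Suc)
    moreover have "(\<integral>z. f z * feat_monomial (Suc n) (w(n := i)) z \<partial>M) = (\<integral>z. f z * feat_monomial (Suc n) (w(n := i)) z \<partial>N)"
      using f \<open>w(n := i) \<in> _\<close> unfolding indist_def by blast
    ultimately show ?thesis by (simp only:)
  qed
  moreover have "(\<lambda>z. feat i z * f z) \<in> borel_measurable borel"
    using f borel_measurable_continuous_onI[OF continuous_on_feat[OF i]]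
    by (intro borel_measurable_times) (auto simp: indist_def)
  ultimately show ?thesis using f unfolding indist_def by (intro conjI) auto
qed

text \<open>The factor \<open>g\<close> is kept arbitrary so that a product of polynomials can be
  absorbed one factor at a time.\<close>

lemma indist_polynomial:
  assumes "real_polynomial_function h" "indist M N g"
  shows "indist M N (\<lambda>z. h (sphere_emb z) * g z)"
  using assms
proof (induction arbitrary: g)
  case (linear h)
  have "h (sphere_emb z) = h (1, 0) * feat 1 z + h (\<i>, 0) * feat 2 z + h (0, 1) * feat 3 z" for z
  proof -
    have "sphere_emb z = feat 1 z *\<^sub>R (1, 0) + feat 2 z *\<^sub>R (\<i>, 0) + feat 3 z *\<^sub>R (0, 1)"
      by (simp add: sphere_emb_def complex_eq_iff)
    then have "h (sphere_emb z) = h (feat 1 z *\<^sub>R (1, 0) + feat 2 z *\<^sub>R (\<i>, 0) + feat 3 z *\<^sub>R (0, 1))"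
      by (rule arg_cong)
    also have "\<dots> = feat 1 z * h (1, 0) + feat 2 z * h (\<i>, 0) + feat 3 z * h (0, 1)"
      using linear.hyps
      by (simp only: linear_add[OF bounded_linear.linear] linear_scale[OF bounded_linear.linear] real_scaleR_def)
    finally show ?thesis by simp
  qed
  then have *: "(\<lambda>z. h (sphere_emb z) * g z) = (\<lambda>z. h (1, 0) * (feat 1 z * g z) +
     h (\<i>, 0) * (feat 2 z * g z) + h (0, 1) * (feat 3 z * g z))"
    by (simp add: algebra_simps)
  show ?case unfolding * by (intro indist_add indist_cmult indist_feat linear) auto
next
  case (const c)
  then show ?case by (intro indist_cmult)
next
  case (add h1 h2)
  then show ?case by (simp add: distrib_right indist_add)
next
  case (mult h1 h2)
  then show ?case by (simp add: mult.assoc)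
qed

text \<open>A bounded continuous function on the plane need not extend to infinity, so polynomials
  in the features need not approximate it uniformly. The images under \<open>sphere_emb\<close> live
  in a compact ball, where Stone-Weierstrass applies; a measurable left inverse then transports the
  equality back.\<close>

lemma borel_prob_eqI_moments:
  assumes "\<And>n w. w \<in> {..<n} \<rightarrow> {..<4} \<Longrightarrow> (\<integral>z. feat_monomial n w z \<partial>M) = (\<integral>z. feat_monomial n w z \<partial>N)"
  shows "M = N"
proof -
  interpret M: borel_prob M by (rule M)
  interpret N: borel_prob N by (rule N)
  have one: "indist M N (\<lambda>z. 1)" using assms by (auto simp: indist_def)
  have emb [measurable]: "sphere_emb \<in> measurable borel borel"
    by (rule borel_measurable_continuous_onI[OF continuous_on_sphere_emb])
  have embL: "sphere_emb \<in> measurable M borel" "sphere_emb \<in> measurable N borel"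
    using emb by (simp_all cong: measurable_cong_sets)
  have distr_eq: "distr M borel sphere_emb = distr N borel sphere_emb"
  proof (rule borel_prob_eqI_continuous)
    show "borel_prob (distr M borel sphere_emb)" "borel_prob (distr N borel sphere_emb)"
      by (auto simp: borel_prob_def borel_prob_axioms_def intro!: M.prob_space_distr N.prob_space_distr embL)
    fix f :: "complex \<times> real \<Rightarrow> real"
    assume f: "continuous_on UNIV f" "\<And>x. \<bar>f x\<bar> \<le> 1"
    have fm: "f \<in> borel_measurable borel" using f by (intro borel_measurable_continuous_onI)
    have int: "integrable M (\<lambda>z. f (sphere_emb z))" "integrable N (\<lambda>z. f (sphere_emb z))"
      using M.integrable_bounded[OF measurable_compose[OF emb fm] f(2)]
        N.integrable_bounded[OF measurable_compose[OF emb fm] f(2)] by auto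
    have "\<bar>(\<integral>z. f (sphere_emb z) \<partial>M) - (\<integral>z. f (sphere_emb z) \<partial>N)\<bar> \<le> e" if e: "e > 0" for e
    proof -
      obtain h where h: "real_polynomial_function h"
        "\<And>x. x \<in> cball 0 3 \<Longrightarrow> \<bar>f x - h x\<bar> < e / 2"
        by (rule Stone_Weierstrass_real_polynomial_function
          [OF compact_cball[of 0 3] continuous_on_subset[OF f(1) subset_UNIV] half_gt_zero[OF e]]) blast
      have close: "\<bar>f (sphere_emb z) - h (sphere_emb z)\<bar> \<le> e / 2" for z
        using h(2)[of "sphere_emb z"] norm_sphere_emb[of z] by force
      have ind: "indist M N (\<lambda>z. h (sphere_emb z))"
        using indist_polynomial[OF h(1) one] by simp
      have eq: "(\<integral>z. h (sphere_emb z) \<partial>M) = (\<integral>z. h (sphere_emb z) \<partial>N)"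
      proof -
        \<comment> \<open>The word of length 0 has the constant monomial \<open>1\<close>.\<close>
        have "(\<integral>z. h (sphere_emb z) * feat_monomial 0 (\<lambda>_. 0) z \<partial>M) = (\<integral>z. h (sphere_emb z) * feat_monomial 0 (\<lambda>_. 0) z \<partial>N)"
          using ind unfolding indist_def by blast
        then show ?thesis by (simp add: feat_monomial_def)
      qed
      have inth: "integrable M (\<lambda>z. h (sphere_emb z))" "integrable N (\<lambda>z. h (sphere_emb z))"
        using indist_integrable[OF ind, of "\<lambda>_. 0" 0 M] indist_integrable[OF ind, of "\<lambda>_. 0" 0 N]
        by (simp_all add: feat_monomial_def)
      have "\<bar>(\<integral>z. f (sphere_emb z) \<partial>M) - (\<integral>z. h (sphere_emb z) \<partial>M)\<bar> \<le> e / 2"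
      proof -
        have "\<bar>\<integral>z. f (sphere_emb z) - h (sphere_emb z) \<partial>M\<bar> \<le> (\<integral>z. e / 2 \<partial>M)"
          by (rule integral_abs_bound[THEN order_trans], rule integral_mono)
             (use close int inth in auto)
        then show ?thesis using int inth M.prob_space by simp
      qed
      moreover have "\<bar>(\<integral>z. f (sphere_emb z) \<partial>N) - (\<integral>z. h (sphere_emb z) \<partial>N)\<bar> \<le> e / 2"
      proof -
        have "\<bar>\<integral>z. f (sphere_emb z) - h (sphere_emb z) \<partial>N\<bar> \<le> (\<integral>z. e / 2 \<partial>N)"
          by (rule integral_abs_bound[THEN order_trans], rule integral_mono)
             (use close int inth in auto)
        then show ?thesis using int inth N.prob_space by simp
      qed
      ultimately show ?thesis using eq by linarith
    qed
    then have "\<bar>(\<integral>z. f (sphere_emb z) \<partial>M) - (\<integral>z. f (sphere_emb z) \<partial>N)\<bar> \<le> 0"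
      by (rule field_le_epsilon) simp
    then have "(\<integral>z. f (sphere_emb z) \<partial>M) = (\<integral>z. f (sphere_emb z) \<partial>N)"
      by simp
    then show "(\<integral>x. f x \<partial>distr M borel sphere_emb) = (\<integral>x. f x \<partial>distr N borel sphere_emb)"
      by (simp add: integral_distr[OF embL(1) fm] integral_distr[OF embL(2) fm])
  qed
  \<comment> \<open>Projection back to the plane. It divides by \<open>0\<close> at the pole, which
    is not in the image; measurability is all that is asked there.\<close>
  define unemb :: "complex \<times> real \<Rightarrow> complex"
    where "unemb = (\<lambda>p. fst p / of_real (sqrt 2 * (1 - snd p)))"
  have [measurable]: "unemb \<in> measurable borel borel"
    unfolding unemb_def borel_prod[symmetric] by measurable
  have unemb: "unemb (sphere_emb z) = z" for z
  proof -
    have "1 - feat 3 z = 1 / (1 + (cmod z)\<^sup>2)"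
      by (simp add: feat_def field_simps)
    then show ?thesis
      by (simp add: unemb_def sphere_emb_def feat_def complex_eq_iff Re_divide_of_real Im_divide_of_real)
  qed
  have recover: "distr (distr L borel sphere_emb) borel unemb = L" if L: "borel_prob L" for L
  proof -
    interpret L: borel_prob L by fact
    have "sphere_emb \<in> measurable L borel" using emb by (simp cong: measurable_cong_sets)
    then have "distr (distr L borel sphere_emb) borel unemb = distr L borel (\<lambda>z. z)"
      by (subst distr_distr) (auto simp: comp_def unemb)
    then show ?thesis by (simp add: distr_id2)
  qed
  have "M = distr (distr M borel sphere_emb) borel unemb" by (rule recover[OF M, symmetric])
  also have "\<dots> = N" unfolding distr_eq by (rule recover[OF N])
  finally show ?thesis .
qed

end

theorem spherical_energy_unique:
  assumes M: "borel_prob M" and N: "borel_prob N"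
    and fin: "(\<integral>\<^sup>+z. \<integral>\<^sup>+t. ell (sph z t) \<partial>M \<partial>M) < \<infinity>" "(\<integral>\<^sup>+z. \<integral>\<^sup>+t. ell (sph z t) \<partial>N \<partial>N) < \<infinity>"
    and le: "(\<integral>\<^sup>+z. \<integral>\<^sup>+t. ell (sph z t) \<partial>M \<partial>M) + (\<integral>\<^sup>+z. \<integral>\<^sup>+t. ell (sph z t) \<partial>N \<partial>N)
        \<le> 2 * (\<integral>\<^sup>+z. \<integral>\<^sup>+t. ell (sph z t) \<partial>N \<partial>M)"
  shows "M = N"
proof (rule borel_prob_eqI_moments[OF M N])
  fix n :: nat and w assume w: "w \<in> {..<n} \<rightarrow> {..<4::nat}"
  show "(\<integral>z. feat_monomial n w z \<partial>M) = (\<integral>z. feat_monomial n w z \<partial>N)"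
  proof (cases "n = 0")
    \<comment> \<open>For the empty word both sides are the total mass \<open>1\<close>; the energy
      series only sees words of positive length.\<close>
    case True
    interpret M: borel_prob M by fact
    interpret N: borel_prob N by fact
    show ?thesis using True M.prob_space N.prob_space by (simp add: feat_monomial_def)
  next
    case False
    have "feat_monomial n w = feat_monomial n (restrict w {..<n})" by (auto simp: feat_monomial_def fun_eq_iff intro!: prod.cong)
    moreover have "restrict w {..<n} \<in> {..<n} \<rightarrow>\<^sub>E {..<4}" using w by auto
    ultimately show ?thesis using moments_eq_of_energy_le[OF M N fin le] False by auto
  qed
qed

subsection \<open>Mean pair interactions\<close>

lemma ennreal_less_e2ennreal_iff: "0 \<le> a \<Longrightarrow> ennreal a < e2ennreal x \<longleftrightarrow> ereal a < x"
  by (cases x) (auto simp: ennreal_less_iff e2ennreal_neg e2ennreal_infty)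

text \<open>Pointwise, the positive part of \<open>f\<close> plus \<open>c\<close> equals
  \<open>f + c\<close> plus the negative part. The negative part is at most \<open>c\<close>, so its
  integral is finite and can be cancelled even if the positive part has infinite integral.\<close>

lemma eintegral_shift:
  assumes M: "prob_space M" and f [measurable]: "f \<in> borel_measurable M"
    and c: "0 \<le> c" and ge: "\<And>x. x \<in> space M \<Longrightarrow> - ereal c \<le> f x"
  shows "eintegral M f = enn2ereal (\<integral>\<^sup>+x. e2ennreal (f x + ereal c) \<partial>M) - ereal c"
proof -
  interpret prob_space M by fact
  have "(\<integral>\<^sup>+x. e2ennreal (f x) \<partial>M) + ennreal c = (\<integral>\<^sup>+x. e2ennreal (f x) + ennreal c \<partial>M)"
    by (subst nn_integral_add) (auto simp: emeasure_space_1)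
  also have "\<dots> = (\<integral>\<^sup>+x. e2ennreal (f x + ereal c) + e2ennreal (- f x) \<partial>M)"
  proof (rule nn_integral_cong)
    fix x assume x: "x \<in> space M"
    show "e2ennreal (f x) + ennreal c = e2ennreal (f x + ereal c) + e2ennreal (- f x)"
    proof (cases "f x")
      case (real a)
      then have "- c \<le> a" using ge[OF x] by simp
      then show ?thesis using real c
        by (cases "0 \<le> a") (auto simp: ennreal_neg ennreal_plus[symmetric] simp del: ennreal_plus)
    qed (use ge[OF x] in \<open>auto simp: e2ennreal_infty e2ennreal_neg\<close>)
  qed
  also have "\<dots> = (\<integral>\<^sup>+x. e2ennreal (f x + ereal c) \<partial>M) + (\<integral>\<^sup>+x. e2ennreal (- f x) \<partial>M)"
    by (rule nn_integral_add) auto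
  finally have eq: "(\<integral>\<^sup>+x. e2ennreal (f x) \<partial>M) + ennreal c =
      (\<integral>\<^sup>+x. e2ennreal (f x + ereal c) \<partial>M) + (\<integral>\<^sup>+x. e2ennreal (- f x) \<partial>M)" .
  have "(\<integral>\<^sup>+x. e2ennreal (- f x) \<partial>M) \<le> (\<integral>\<^sup>+x. ennreal c \<partial>M)"
  proof (rule nn_integral_mono)
    fix x assume "x \<in> space M"
    from ge[OF this] c show "e2ennreal (- f x) \<le> ennreal c"
      by (cases "f x") (auto simp: e2ennreal_neg intro!: ennreal_leI)
  qed
  also have "\<dots> = ennreal c" by (simp add: emeasure_space_1)
  finally have "(\<integral>\<^sup>+x. e2ennreal (- f x) \<partial>M) < \<infinity>"
    unfolding infinity_ennreal_def by (rule le_less_trans[OF _ ennreal_less_top])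
  then obtain n where n: "0 \<le> n" "(\<integral>\<^sup>+x. e2ennreal (- f x) \<partial>M) = ennreal n"
    by (auto simp: less_top_ennreal infinity_ennreal_def)
  show ?thesis
  proof (cases "\<integral>\<^sup>+x. e2ennreal (f x + ereal c) \<partial>M" rule: ennreal_cases)
    case (real s)
    have "(\<integral>\<^sup>+x. e2ennreal (f x) \<partial>M) + ennreal c \<noteq> \<top>"
      unfolding eq real n(2) by (simp add: ennreal_add_eq_top)
    then obtain p where p: "0 \<le> p" "(\<integral>\<^sup>+x. e2ennreal (f x) \<partial>M) = ennreal p"
      by (cases "\<integral>\<^sup>+x. e2ennreal (f x) \<partial>M" rule: ennreal_cases) auto
    then have "ennreal (p + c) = ennreal (s + n)"
      using eq p n real c by simp
    then have "p + c = s + n" using p n real c by (subst (asm) ennreal_inj) auto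
    then show ?thesis unfolding eintegral_def using p n real c by simp
  next
    case top
    then have "(\<integral>\<^sup>+x. e2ennreal (f x) \<partial>M) = \<infinity>" using eq n by (auto simp: ennreal_add_eq_top)
    then show ?thesis unfolding eintegral_def n(2) top using n c by simp
  qed
qed

lemma liminf_add_le_ennreal:
  fixes f g :: "nat \<Rightarrow> ennreal"
  shows "liminf f + liminf g \<le> liminf (\<lambda>n. f n + g n)"
proof -
  have "liminf f + liminf g = (SUP n. (INF m\<in>{n..}. f m) + (INF m\<in>{n..}. g m))"
    unfolding liminf_SUP_INF
    by (rule ennreal_SUP_add[symmetric]) (auto simp: incseq_def intro!: INF_superset_mono)
  also have "\<dots> \<le> liminf (\<lambda>n. f n + g n)"
    unfolding liminf_SUP_INF
    by (intro SUP_mono bexI[where x = n for n]) (auto intro!: INF_greatest add_mono INF_lower)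
  finally show ?thesis .
qed

definition pair_sum :: "('a \<Rightarrow> 'a \<Rightarrow> ennreal) \<Rightarrow> nat \<Rightarrow> (nat \<Rightarrow> 'a) \<Rightarrow> ennreal" where
  "pair_sum f k x = (\<Sum>i\<in>{1..k}. \<Sum>j\<in>{i<..k}. f (x i) (x j))"

lemma pair_sum_0 [simp]: "pair_sum f 0 x = 0"
  by (simp add: pair_sum_def)

lemma pair_sum_Suc: "pair_sum f (Suc k) x = pair_sum f k x + (\<Sum>i\<in>{1..k}. f (x i) (x (Suc k)))"
proof -
  have "(\<Sum>j\<in>{i<..Suc k}. f (x i) (x j)) = (\<Sum>j\<in>{i<..k}. f (x i) (x j)) + f (x i) (x (Suc k))"
    if "i \<in> {1..k}" for i
  proof -
    have "{i<..Suc k} = insert (Suc k) {i<..k}" using that by auto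
    then show ?thesis by (simp add: add.commute)
  qed
  then show ?thesis by (simp add: pair_sum_def sum.distrib cong: sum.cong_simp)
qed

lemma sum_square_eq_pair_sum:
  assumes "\<And>a b. f a b = f b a"
  shows "(\<Sum>i\<in>{1..k}. \<Sum>j\<in>{1..k}. f (x i) (x j)) = 2 * pair_sum f k x + (\<Sum>i\<in>{1..k}. f (x i) (x i))"
proof (induction k)
  case (Suc k)
  have "(\<Sum>j\<in>{1..k}. f (x (Suc k)) (x j)) = (\<Sum>i\<in>{1..k}. f (x i) (x (Suc k)))"
    by (intro sum.cong assms refl)
  note sw = this
  have "(\<Sum>i\<in>{1..Suc k}. \<Sum>j\<in>{1..Suc k}. f (x i) (x j)) =
     (\<Sum>i\<in>{1..k}. \<Sum>j\<in>{1..k}. f (x i) (x j)) + 2 * (\<Sum>i\<in>{1..k}. f (x i) (x (Suc k))) + f (x (Suc k)) (x (Suc k))"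
    by (simp add: sum.distrib sw mult_2 add_ac del: One_nat_def)
  then show ?case by (simp only: Suc pair_sum_Suc) (simp add: distrib_left add_ac del: One_nat_def)
qed simp

text \<open>The function \<open>exp (- a)\<close> for kernel values that were raised by
  \<open>2 * C\<close> to be nonnegative; the factor \<open>exp (2 * C)\<close> undoes the shift.
  Being strictly decreasing, \<open>psi C\<close> translates bounds on Vandermonde roots into bounds
  on energies and back.\<close>

definition psi :: "real \<Rightarrow> ennreal \<Rightarrow> real" where
  "psi C a = (if a = \<infinity> then 0 else exp (2 * C - enn2real a))"

lemma psi_ennreal: "0 \<le> a \<Longrightarrow> psi C (ennreal a) = exp (2 * C - a)"
  by (simp add: psi_def)

lemma psi_top [simp]: "psi C \<top> = 0"
  by (simp add: psi_def)

lemma psi_mono: "a \<le> b \<Longrightarrow> psi C b \<le> psi C a"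
  by (cases a rule: ennreal_cases; cases b rule: ennreal_cases) (auto simp: psi_ennreal top_unique)

lemma psi_strict_mono: "a < b \<Longrightarrow> psi C b < psi C a"
  by (cases a rule: ennreal_cases; cases b rule: ennreal_cases) (auto simp: psi_ennreal ennreal_less_iff)

lemma psi_le_iff: "psi C b \<le> psi C a \<longleftrightarrow> a \<le> b"
  using psi_mono psi_strict_mono by (metis not_le)

lemma exp_neg_ereal_eq_psi: "exp_neg_ereal (enn2ereal a - ereal (2 * C)) = ereal (psi C a)"
  by (cases a rule: ennreal_cases) (auto simp: exp_neg_ereal_def psi_ennreal)

lemma prod_psi:
  assumes "finite I"
  shows "(\<Prod>p\<in>I. psi C (e p)) = (if (\<Sum>p\<in>I. e p) = \<infinity> then 0
     else exp (2 * C * real (card I) - enn2real (\<Sum>p\<in>I. e p)))"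
  using assms
proof (induction I)
  case (insert p I)
  show ?case
  proof (cases "e p = \<infinity> \<or> sum e I = \<infinity>")
    case False
    then have "enn2real (e p + sum e I) = enn2real (e p) + enn2real (sum e I)"
      by (intro enn2real_plus) (auto simp: less_top)
    with False insert show ?thesis
      by (auto simp: psi_def mult_exp_exp algebra_simps)
  qed (use insert in \<open>auto simp: psi_def\<close>)
qed simp

lemma card_pairs: "2 * real (card (SIGMA i:{1..k}. {i<..k})) = real k * (real k - 1)"
proof (induction k)
  case (Suc k)
  have "card (SIGMA i:{1..Suc k}. {i<..Suc k}) = (\<Sum>i\<in>{1..k}. Suc (k - i))"
    by (subst card_SigmaI) (auto simp: Suc_diff_le intro!: sum.cong)
  also have "\<dots> = card (SIGMA i:{1..k}. {i<..k}) + k"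
    by (subst card_SigmaI) (auto simp: sum.distrib[of "\<lambda>i. k - i" "\<lambda>_. 1", simplified])
  finally show ?case using Suc by (simp add: algebra_simps)
qed simp

definition pair_mean :: "('a \<Rightarrow> 'a \<Rightarrow> ennreal) \<Rightarrow> nat \<Rightarrow> (nat \<Rightarrow> 'a) \<Rightarrow> ennreal" where
  "pair_mean f k x = ennreal (2 / (real k * (real k - 1))) * pair_sum f k x"

text \<open>The exponent is the reciprocal of the number of pairs, so the product turns into a mean,
  and the shift \<open>2 * C\<close>, incurred once per pair, survives exactly once.\<close>

lemma prod_psi_powr:
  assumes "2 \<le> k"
  shows "(\<Prod>i\<in>{1..k}. \<Prod>j\<in>{i<..k}. psi C (f (x i) (x j))) powr (2 / (real k * (real k - 1))) =
    psi C (pair_mean f k x)"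
proof -
  let ?I = "SIGMA i:{1..k}. {i<..k}" and ?n = "real k * (real k - 1)"
  have n: "?n > 0" using assms by simp
  have "(\<Prod>i\<in>{1..k}. \<Prod>j\<in>{i<..k}. psi C (f (x i) (x j))) = (\<Prod>p\<in>?I. psi C (f (x (fst p)) (x (snd p))))"
    by (subst prod.Sigma) (auto simp: case_prod_unfold)
  also have "\<dots> = (if pair_sum f k x = \<infinity> then 0 else exp (C * ?n - enn2real (pair_sum f k x)))"
  proof -
    have "pair_sum f k x = (\<Sum>p\<in>?I. f (x (fst p)) (x (snd p)))"
      unfolding pair_sum_def by (subst sum.Sigma) (auto simp: case_prod_unfold)
    moreover have "2 * C * real (card ?I) = C * ?n" using card_pairs[of k] by simp
    ultimately show ?thesis by (subst prod_psi) auto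
  qed
  finally have *: "(\<Prod>i\<in>{1..k}. \<Prod>j\<in>{i<..k}. psi C (f (x i) (x j))) =
    (if pair_sum f k x = \<infinity> then 0 else exp (C * ?n - enn2real (pair_sum f k x)))" .
  show ?thesis
  proof (cases "pair_sum f k x" rule: ennreal_cases)
    case (real s)
    have "psi C (pair_mean f k x) = exp (2 * C - 2 / ?n * s)"
      unfolding pair_mean_def real using n real(1)
      by (subst ennreal_mult[symmetric]) (auto simp: psi_ennreal)
    moreover have "exp (C * ?n - s) powr (2 / ?n) = exp ((C * ?n - s) * (2 / ?n))"
      by (simp add: powr_def)
    moreover have "(C * ?n - s) * (2 / ?n) = 2 * C - 2 / ?n * s"
    proof -
      have "(a * b - s) * (2 / b) = 2 * a - 2 / b * s" if "b > 0" for a b :: real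
        using that by (simp add: field_simps)
      then show ?thesis using n by blast
    qed
    ultimately show ?thesis unfolding * using real by simp
  next
    \<comment> \<open>An infinite interaction makes the product \<open>0\<close>, and
      \<open>0 powr r\<close> is \<open>0\<close>.\<close>
    case top
    then show ?thesis unfolding * pair_mean_def using n assms by (simp add: ennreal_mult_top)
  qed
qed

section \<open>Configurations whose mean interaction is at most the energy\<close>

lemma (in prob_space) exists_le_nn_integral:
  assumes [measurable]: "h \<in> borel_measurable M"
  shows "\<exists>y\<in>space M. h y \<le> (\<integral>\<^sup>+x. h x \<partial>M)"
proof (rule ccontr)
  let ?c = "\<integral>\<^sup>+x. h x \<partial>M"
  assume "\<not> ?thesis"
  then have less: "?c < h y" if "y \<in> space M" for y using that by (auto simp: not_le)
  obtain y where "y \<in> space M" using not_empty by auto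
  then have fin: "?c \<noteq> \<infinity>" using less[of y] by (auto simp: infinity_ennreal_def less_top[symmetric] dest: order_less_trans)
  have "(\<integral>\<^sup>+x. ?c \<partial>M) < (\<integral>\<^sup>+x. h x \<partial>M)"
  proof (rule nn_integral_less)
    show "(\<integral>\<^sup>+x. ?c \<partial>M) \<noteq> \<infinity>" using fin by (simp add: emeasure_space_1)
    show "AE x in M. ?c \<le> h x" using less by (intro AE_I2 less_imp_le)
    show "\<not> (AE x in M. h x \<le> ?c)"
    proof
      assume "AE x in M. h x \<le> ?c"
      then have "AE x in M. False" by (rule AE_mp) (use less in \<open>auto simp: not_le\<close>)
      then show False by simp
    qed
  qed auto
  then show False by (simp add: emeasure_space_1)
qed

text \<open>Points are fixed one after another without worsening the expectation, which avoids
  integrating over a \<open>k\<close>-fold product. \<open>F\<close> is the charge on each point for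
  its expected interaction with points still to be chosen, so it must vary in the induction.\<close>

lemma (in prob_space) exists_pair_sum_le:
  fixes f :: "'a \<Rightarrow> 'a \<Rightarrow> ennreal"
  assumes f: "(\<lambda>p. f (fst p) (snd p)) \<in> borel_measurable (M \<Otimes>\<^sub>M M)"
    and F: "F \<in> borel_measurable M"
  shows "\<exists>x. (\<forall>j\<in>{1..k}. x j \<in> space M) \<and> pair_sum f k x + (\<Sum>i\<in>{1..k}. F (x i))
    \<le> of_nat (k * (k - 1) div 2) * (\<integral>\<^sup>+z. \<integral>\<^sup>+t. f z t \<partial>M \<partial>M) + of_nat k * (\<integral>\<^sup>+z. F z \<partial>M)"
  using F
proof (induction k arbitrary: F)
  case (Suc k)
  let ?U = "\<lambda>z. \<integral>\<^sup>+t. f z t \<partial>M" and ?E = "\<integral>\<^sup>+z. \<integral>\<^sup>+t. f z t \<partial>M \<partial>M"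
  have U: "?U \<in> borel_measurable M" using borel_measurable_nn_integral_fst[OF f] by simp
  have fz: "f z \<in> borel_measurable M" if "z \<in> space M" for z
    using measurable_compose[OF measurable_Pair1'[OF that] f] by simp
  \<comment> \<open>The potential \<open>?U\<close> is the expected interaction with point number
    \<open>Suc k\<close>, which is chosen last.\<close>
  obtain x where x: "\<forall>j\<in>{1..k}. x j \<in> space M"
    and le: "pair_sum f k x + (\<Sum>i\<in>{1..k}. F (x i) + ?U (x i))
      \<le> of_nat (k * (k - 1) div 2) * ?E + of_nat k * (\<integral>\<^sup>+z. F z + ?U z \<partial>M)"
    using Suc.IH[OF borel_measurable_add[OF Suc.prems U]] by blast
  have "(\<lambda>y. (\<Sum>i\<in>{1..k}. f (x i) y) + F y) \<in> borel_measurable M"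
    using x Suc.prems by (intro borel_measurable_add borel_measurable_sum fz) auto
  from exists_le_nn_integral[OF this] obtain y where y: "y \<in> space M"
    and "(\<Sum>i\<in>{1..k}. f (x i) y) + F y \<le> (\<integral>\<^sup>+y. (\<Sum>i\<in>{1..k}. f (x i) y) + F y \<partial>M)"
    by blast
  note this(2)
  also have "(\<integral>\<^sup>+y. (\<Sum>i\<in>{1..k}. f (x i) y) + F y \<partial>M) = (\<Sum>i\<in>{1..k}. ?U (x i)) + (\<integral>\<^sup>+y. F y \<partial>M)"
  proof -
    have "(\<integral>\<^sup>+y. (\<Sum>i\<in>{1..k}. f (x i) y) \<partial>M) = (\<Sum>i\<in>{1..k}. ?U (x i))"
      using x by (intro nn_integral_sum fz) auto
    then show ?thesis
      using x Suc.prems by (subst nn_integral_add) (auto intro!: borel_measurable_sum fz)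
  qed
  finally have y_le: "(\<Sum>i\<in>{1..k}. f (x i) y) + F y \<le> (\<Sum>i\<in>{1..k}. ?U (x i)) + (\<integral>\<^sup>+y. F y \<partial>M)" .
  define x' where "x' = x(Suc k := y)"
  have eq: "x' i = x i" if "i \<in> {1..k}" for i using that by (auto simp: x'_def)
  have "pair_sum f k x' = pair_sum f k x"
    unfolding pair_sum_def by (intro sum.cong refl) (simp add: x'_def)
  then have "pair_sum f (Suc k) x' + (\<Sum>i\<in>{1..Suc k}. F (x' i)) =
      pair_sum f k x + (\<Sum>i\<in>{1..k}. f (x i) y) + ((\<Sum>i\<in>{1..k}. F (x i)) + F y)"
    by (simp add: pair_sum_Suc eq x'_def add_ac cong: sum.cong_simp)
  also have "\<dots> = pair_sum f k x + (\<Sum>i\<in>{1..k}. F (x i)) + ((\<Sum>i\<in>{1..k}. f (x i) y) + F y)"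
    by (simp only: add_ac)
  also have "\<dots> \<le> pair_sum f k x + (\<Sum>i\<in>{1..k}. F (x i)) + ((\<Sum>i\<in>{1..k}. ?U (x i)) + (\<integral>\<^sup>+y. F y \<partial>M))"
    by (rule add_left_mono[OF y_le])
  also have "\<dots> = pair_sum f k x + (\<Sum>i\<in>{1..k}. F (x i) + ?U (x i)) + (\<integral>\<^sup>+y. F y \<partial>M)"
    by (simp only: sum.distrib add_ac)
  also have "\<dots> \<le> of_nat (k * (k - 1) div 2) * ?E + of_nat k * (\<integral>\<^sup>+z. F z + ?U z \<partial>M) + (\<integral>\<^sup>+y. F y \<partial>M)"
    by (rule add_right_mono[OF le])
  also have "(\<integral>\<^sup>+z. F z + ?U z \<partial>M) = (\<integral>\<^sup>+z. F z \<partial>M) + ?E"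
    by (rule nn_integral_add[OF Suc.prems U])
  also have "of_nat (k * (k - 1) div 2) * ?E + of_nat k * ((\<integral>\<^sup>+z. F z \<partial>M) + ?E) + (\<integral>\<^sup>+y. F y \<partial>M)
     = of_nat (k * (k - 1) div 2 + k) * ?E + of_nat (Suc k) * (\<integral>\<^sup>+z. F z \<partial>M)"
    by (simp only: of_nat_add of_nat_Suc distrib_left distrib_right mult_1_left add_ac)
  also have "k * (k - 1) div 2 + k = Suc k * (Suc k - 1) div 2"
  proof (cases k)
    case (Suc m)
    have "Suc (Suc m) * Suc m = Suc m * m + Suc m * 2" by simp
    then show ?thesis unfolding Suc diff_Suc_1 by (simp only: div_mult_self3) simp
  qed simp
  finally have "pair_sum f (Suc k) x' + (\<Sum>i\<in>{1..Suc k}. F (x' i))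
    \<le> of_nat (Suc k * (Suc k - 1) div 2) * ?E + of_nat (Suc k) * (\<integral>\<^sup>+z. F z \<partial>M)" .
  moreover have "\<forall>j\<in>{1..Suc k}. x' j \<in> space M" using x y by (auto simp: x'_def)
  ultimately show ?case by blast
qed simp

lemma (in prob_space) exists_pair_mean_le:
  fixes f :: "'a \<Rightarrow> 'a \<Rightarrow> ennreal"
  assumes f: "(\<lambda>p. f (fst p) (snd p)) \<in> borel_measurable (M \<Otimes>\<^sub>M M)" and k: "2 \<le> k"
  shows "\<exists>x. (\<forall>j\<in>{1..k}. x j \<in> space M) \<and> pair_mean f k x \<le> (\<integral>\<^sup>+z. \<integral>\<^sup>+t. f z t \<partial>M \<partial>M)"
proof -
  let ?E = "\<integral>\<^sup>+z. \<integral>\<^sup>+t. f z t \<partial>M \<partial>M"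
  obtain x where x: "\<forall>j\<in>{1..k}. x j \<in> space M" and le: "pair_sum f k x \<le> of_nat (k * (k - 1) div 2) * ?E"
    using exists_pair_sum_le[OF f, of "\<lambda>_. 0" k] by auto
  have "pair_mean f k x \<le> ennreal (2 / (real k * (real k - 1))) * (of_nat (k * (k - 1) div 2) * ?E)"
    unfolding pair_mean_def by (rule mult_left_mono[OF le]) simp
  also have "\<dots> = (ennreal (2 / (real k * (real k - 1))) * ennreal (real (k * (k - 1) div 2))) * ?E"
    by (simp only: ennreal_of_nat_eq_real_of_nat mult.assoc)
  also have "ennreal (2 / (real k * (real k - 1))) * ennreal (real (k * (k - 1) div 2)) = 1"
  proof -
    have "real (k * (k - 1) div 2) = real (k * (k - 1)) / 2"
      using real_of_nat_div[of 2 "k * (k - 1)"] by (cases "even k") auto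
    also have "\<dots> = real k * (real k - 1) / 2" using k by (simp add: of_nat_diff)
    finally show ?thesis using k by (subst ennreal_mult[symmetric]) auto
  qed
  finally show ?thesis using x by auto
qed

subsection \<open>The weighted kernel\<close>

text \<open>This is what weak admissibility provides: the growth condition bounds \<open>Q\<close>
  from below near infinity, lower semicontinuity bounds it on bounded parts of \<open>K\<close>, and
  one constant \<open>C\<close> covers both.\<close>

locale weighted_set =
  fixes K :: "complex set" and Q :: "complex \<Rightarrow> ereal" and C :: real
  assumes closed_K: "closed K"
    and Q_lsc: "lsc_on K Q"
    and C_nonneg: "0 \<le> C"
    and Q_ge: "z \<in> K \<Longrightarrow> ereal (ln (1 + (cmod z)\<^sup>2) / 2 - C) \<le> Q z"
begin

text \<open>The value \<open>\<infinity>\<close> outside the closed set \<open>K\<close> makes the function lower semicontinuous on the whole plane.\<close>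

definition ext_field :: "complex \<Rightarrow> ennreal" where
  "ext_field z = (if z \<in> K then e2ennreal (Q z + ereal (C - ln (1 + (cmod z)\<^sup>2) / 2)) else \<infinity>)"

text \<open>The logarithms of \<open>1 + |z|^2\<close> contained in \<open>ell (sph z t)\<close> and
  in \<open>ext_field\<close> cancel, so on \<open>K\<close> this is the weighted kernel
  \<open>log (1 / (|z - t| w(z) w(t)))\<close> raised by \<open>2 * C\<close>.\<close>

definition wkernel :: "complex \<Rightarrow> complex \<Rightarrow> ennreal" where
  "wkernel z t = ell (sph z t) + (ext_field z + ext_field t)"

lemma wkernel_commute: "wkernel z t = wkernel t z"
  by (simp add: wkernel_def sph_commute add.commute)

lemma eventually_less_ext_field:
  assumes "y < ext_field z"
  shows "\<forall>\<^sub>F t in nhds z. y < ext_field t"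
proof (cases "z \<in> K")
  case False
  then have "\<forall>\<^sub>F t in nhds z. t \<in> - K"
    using closed_K by (intro eventually_nhds_in_open) auto
  moreover have "y < \<infinity>" using assms by (metis le_less_trans less_le not_less top_greatest infinity_ennreal_def)
  ultimately show ?thesis
    by (auto simp: ext_field_def elim!: eventually_mono)
next
  case True
  let ?g = "\<lambda>z. C - ln (1 + (cmod z)\<^sup>2) / 2"
  obtain a where a: "0 \<le> a" "y = ennreal a"
    using assms by (cases y rule: ennreal_cases) auto
  have "ereal a < Q z + ereal (?g z)"
    using assms True a by (simp add: ext_field_def ennreal_less_e2ennreal_iff)
  then have "ereal (a - ?g z) < Q z"
    by (cases "Q z") auto
  \<comment> \<open>A level strictly in between leaves room for the continuous term
    \<open>?g\<close> to vary near \<open>z\<close>.\<close>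
  then obtain b where b: "a - ?g z < b" "ereal b < Q z"
    using ereal_dense2 by (metis less_ereal.simps(1))
  have "\<forall>\<^sub>F t in at z within K. ereal b < Q t"
    using Q_lsc True b(2) unfolding lsc_on_def by blast
  then have "\<forall>\<^sub>F t in nhds z. t \<noteq> z \<longrightarrow> t \<in> K \<longrightarrow> ereal b < Q t"
    by (simp add: eventually_at_filter)
  moreover have "isCont (\<lambda>t. a - ?g t) z"
    by (intro continuous_intros) auto
  then have "((\<lambda>t. a - ?g t) \<longlongrightarrow> a - ?g z) (nhds z)"
    using tendsto_at_iff_tendsto_nhds[of "\<lambda>t. a - ?g t" z] by (simp only: isCont_def)
  then have "\<forall>\<^sub>F t in nhds z. a - ?g t < b"
    using b(1) by (auto simp: order_tendsto_iff)
  ultimately show ?thesis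
  proof eventually_elim
    case (elim t)
    show ?case
    proof (cases "t \<in> K")
      case tK: True
      \<comment> \<open>\<open>lsc_on\<close> speaks of punctured neighbourhoods, so
        \<open>b(2)\<close> supplies the point \<open>z\<close> itself.\<close>
      then have "ereal b < Q t" using elim b(2) by (cases "t = z") auto
      then have "ereal a < Q t + ereal (?g t)" using elim by (cases "Q t") auto
      then show ?thesis using tK a by (simp add: ext_field_def ennreal_less_e2ennreal_iff)
    qed (use a in \<open>auto simp: ext_field_def\<close>)
  qed
qed

lemma ext_field_lsc:
  assumes "(u \<longlongrightarrow> z) F"
  shows "ext_field z \<le> Liminf F (\<lambda>n. ext_field (u n))"
  unfolding le_Liminf_iff
  using eventually_less_ext_field eventually_compose_filterlim[OF _ assms] by blast

lemma borel_measurable_ext_field [measurable]: "ext_field \<in> borel_measurable borel"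
proof (rule borel_measurableI_greater)
  fix y
  have "open {z. y < ext_field z}"
    by (subst open_subopen) (use eventually_less_ext_field in \<open>force simp: eventually_nhds\<close>)
  then show "{x \<in> space borel. y < ext_field x} \<in> sets borel" by simp
qed

lemma borel_measurable_wkernel [measurable]:
  "(\<lambda>p. wkernel (fst p) (snd p)) \<in> borel_measurable (borel \<Otimes>\<^sub>M borel)"
  unfolding wkernel_def by measurable

lemma wkernel_lsc:
  assumes "z \<longlonglongrightarrow> a" "t \<longlonglongrightarrow> b"
  shows "wkernel a b \<le> liminf (\<lambda>n. wkernel (z n) (t n))"
proof -
  have "wkernel a b \<le> liminf (\<lambda>n. ell (sph (z n) (t n))) + (liminf (\<lambda>n. ext_field (z n)) + liminf (\<lambda>n. ext_field (t n)))"
    unfolding wkernel_def by (intro add_mono ell_lsc sph_tendsto ext_field_lsc assms)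
  also have "\<dots> \<le> liminf (\<lambda>n. ell (sph (z n) (t n))) + liminf (\<lambda>n. ext_field (z n) + ext_field (t n))"
    by (intro add_left_mono liminf_add_le_ennreal)
  also have "\<dots> \<le> liminf (\<lambda>n. wkernel (z n) (t n))"
    unfolding wkernel_def by (rule liminf_add_le_ennreal)
  finally show ?thesis .
qed

lemma enn2ereal_ext_field: "z \<in> K \<Longrightarrow> enn2ereal (ext_field z) = Q z + ereal (C - ln (1 + (cmod z)\<^sup>2) / 2)"
proof -
  assume z: "z \<in> K"
  have "0 \<le> Q z + ereal (C - ln (1 + (cmod z)\<^sup>2) / 2)"
    using Q_ge[OF z] by (cases "Q z") auto
  then show ?thesis using z by (simp add: ext_field_def enn2ereal_e2ennreal)
qed

lemma enn2ereal_wkernel: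
  assumes "z \<in> K" "t \<in> K"
  shows "enn2ereal (wkernel z t) =
    (if z = t then \<infinity> else ereal (- ln (cmod (z - t))) + Q z + Q t) + ereal (2 * C)"
proof (cases "z = t")
  case True
  then show ?thesis by (simp add: wkernel_def sph_self ell_1 plus_ennreal.rep_eq)
next
  case False
  let ?l = "- ln (cmod (z - t)) + ln (1 + (cmod z)\<^sup>2) / 2 + ln (1 + (cmod t)\<^sup>2) / 2"
  have "enn2ereal (ell (sph z t)) = ereal ?l"
    using log_dist_le[OF False] by (simp add: ell_sph[OF False] enn2ereal_ennreal)
  then show ?thesis
    using False Q_ge[OF assms(1)] Q_ge[OF assms(2)]
    by (cases "Q z"; cases "Q t") (auto simp: wkernel_def plus_ennreal.rep_eq enn2ereal_ext_field assms)
qed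

lemma wkernel_ge: assumes "z \<in> K" "t \<in> K" "z \<noteq> t"
  shows "- ereal (2 * C) \<le> ereal (- ln (cmod (z - t))) + Q z + Q t"
proof -
  have "0 \<le> enn2ereal (wkernel z t)" by simp
  then show ?thesis unfolding enn2ereal_wkernel[OF assms(1,2)] using assms(3) C_nonneg
    by (cases "ereal (- ln (cmod (z - t))) + Q z + Q t") auto
qed

lemma psi_wkernel:
  assumes "z \<in> K" "t \<in> K"
  shows "cmod (z - t) * wgt Q z * wgt Q t = psi C (wkernel z t)"
proof -
  have "ereal (psi C (wkernel z t)) = exp_neg_ereal (if z = t then \<infinity> else ereal (- ln (cmod (z - t))) + Q z + Q t)"
  proof -
    have "x + ereal (2 * C) - ereal (2 * C) = x" for x by (cases x) auto
    then show ?thesis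
      unfolding exp_neg_ereal_eq_psi[symmetric] enn2ereal_wkernel[OF assms] by simp
  qed
  also have "\<dots> = ereal (cmod (z - t) * wgt Q z * wgt Q t)"
  proof (cases "z = t")
    case False
    then have *: "exp (ln (cmod (z - t)) - a - b) = cmod (z - t) * exp (- a) * exp (- b)" for a b
      by (simp add: exp_diff exp_minus divide_inverse)
    show ?thesis
      using False Q_ge[OF assms(1)] Q_ge[OF assms(2)] *
      by (cases "Q z"; cases "Q t") (auto simp: exp_neg_ereal_def wgt_def algebra_simps)
  qed (simp add: exp_neg_ereal_def)
  finally show ?thesis by simp
qed

lemma VDM_root_eq:
  assumes "2 \<le> k" "\<And>j. j \<in> {1..k} \<Longrightarrow> x j \<in> K"
  shows "VDM_root Q k x = psi C (pair_mean wkernel k x)"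
proof -
  have "VDM Q k x = (\<Prod>i\<in>{1..k}. \<Prod>j\<in>{i<..k}. psi C (wkernel (x i) (x j)))"
    unfolding VDM_def using assms(2) by (intro prod.cong refl psi_wkernel) auto
  then show ?thesis unfolding VDM_root_def by (simp only: prod_psi_powr[OF assms(1)])
qed

definition energy :: "complex measure \<Rightarrow> ennreal" where
  "energy \<mu> = (\<integral>\<^sup>+z. \<integral>\<^sup>+t. wkernel z t \<partial>\<mu> \<partial>\<mu>)"

lemma probs_onD:
  assumes "\<mu> \<in> probs_on K"
  shows "prob_space \<mu>" "sets \<mu> = sets (restrict_space borel K)" "space \<mu> = K"
    and "f \<in> borel_measurable borel \<Longrightarrow> f \<in> borel_measurable \<mu>"
    and "g \<in> borel_measurable (borel \<Otimes>\<^sub>M borel) \<Longrightarrow> g \<in> borel_measurable (\<mu> \<Otimes>\<^sub>M \<mu>)"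
proof -
  show 1: "prob_space \<mu>" "sets \<mu> = sets (restrict_space borel K)"
    using assms by (auto simp: probs_on_def)
  then show "space \<mu> = K"
    using sets_eq_imp_space_eq[OF 1(2)] by (simp add: space_restrict_space)
  have id: "(\<lambda>x. x) \<in> measurable \<mu> borel"
    by (subst measurable_cong_sets[OF 1(2) refl]) (intro measurable_restrict_space1 measurable_ident_sets refl)
  show "f \<in> borel_measurable borel \<Longrightarrow> f \<in> borel_measurable \<mu>"
    by (rule measurable_compose[OF id])
  have [measurable]: "fst \<in> measurable (\<mu> \<Otimes>\<^sub>M \<mu>) borel" "snd \<in> measurable (\<mu> \<Otimes>\<^sub>M \<mu>) borel"
    using measurable_compose[OF measurable_fst id] measurable_compose[OF measurable_snd id] by auto
  have "(\<lambda>p. (fst p, snd p)) \<in> measurable (\<mu> \<Otimes>\<^sub>M \<mu>) (borel \<Otimes>\<^sub>M borel)"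
    by measurable
  then show "g \<in> borel_measurable (borel \<Otimes>\<^sub>M borel) \<Longrightarrow> g \<in> borel_measurable (\<mu> \<Otimes>\<^sub>M \<mu>)"
    using measurable_compose[of "\<lambda>p. (fst p, snd p)" "\<mu> \<Otimes>\<^sub>M \<mu>" "borel \<Otimes>\<^sub>M borel" g] by simp
qed

text \<open>The shifted integrand is nonnegative, so after \<open>eintegral_shift\<close> Tonelli
  turns the integral over the product into an iterated one.\<close>

lemma energyQ_eq:
  assumes \<mu>: "\<mu> \<in> probs_on K"
  shows "energyQ Q \<mu> = enn2ereal (energy \<mu>) - ereal (2 * C)"
proof -
  interpret prob_space \<mu> by (rule probs_onD[OF \<mu>])
  interpret P: pair_prob_space \<mu> \<mu> ..
  let ?f = "\<lambda>(z, t). if z = t then \<infinity> else ereal (- ln (cmod (z - t))) + Q z + Q t"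
  have sp: "space (\<mu> \<Otimes>\<^sub>M \<mu>) = K \<times> K" by (simp add: space_pair_measure probs_onD(3)[OF \<mu>])
  have km: "(\<lambda>p. wkernel (fst p) (snd p)) \<in> borel_measurable (\<mu> \<Otimes>\<^sub>M \<mu>)"
    by (rule probs_onD(5)[OF \<mu> borel_measurable_wkernel])
  have eq: "?f p + ereal (2 * C) = enn2ereal (wkernel (fst p) (snd p))" if "p \<in> space (\<mu> \<Otimes>\<^sub>M \<mu>)" for p
    using that enn2ereal_wkernel by (auto simp: sp)
  have eq': "?f p = enn2ereal (wkernel (fst p) (snd p)) - ereal (2 * C)" if "p \<in> space (\<mu> \<Otimes>\<^sub>M \<mu>)" for p
    unfolding eq[OF that, symmetric] by (cases "?f p") auto
  have fm: "?f \<in> borel_measurable (\<mu> \<Otimes>\<^sub>M \<mu>)"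
    by (subst measurable_cong[OF eq']) (use km in measurable)
  have "energyQ Q \<mu> = enn2ereal (\<integral>\<^sup>+p. e2ennreal (?f p + ereal (2 * C)) \<partial>(\<mu> \<Otimes>\<^sub>M \<mu>)) - ereal (2 * C)"
    unfolding energyQ_def
  proof (rule eintegral_shift[OF P.prob_space_axioms fm])
    show "0 \<le> 2 * C" using C_nonneg by simp
    fix p assume "p \<in> space (\<mu> \<Otimes>\<^sub>M \<mu>)"
    then show "- ereal (2 * C) \<le> ?f p" using wkernel_ge by (auto simp: sp split: if_splits)
  qed
  also have "(\<integral>\<^sup>+p. e2ennreal (?f p + ereal (2 * C)) \<partial>(\<mu> \<Otimes>\<^sub>M \<mu>)) = (\<integral>\<^sup>+p. wkernel (fst p) (snd p) \<partial>(\<mu> \<Otimes>\<^sub>M \<mu>))"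
    by (intro nn_integral_cong) (simp only: eq e2ennreal_enn2ereal)
  also have "\<dots> = energy \<mu>"
    unfolding energy_def using nn_integral_fst[OF km] by simp
  finally show ?thesis .
qed

end

section \<open>Measures on \<open>K\<close> and on the plane; uniqueness of the minimizer\<close>

lemma restrict_probs_on:
  fixes h :: "complex \<Rightarrow> real"
  assumes M: "borel_prob M" and K: "closed K" and AE_K: "AE z in M. z \<in> K"
  shows "restrict_space M K \<in> probs_on K"
    and "f \<in> borel_measurable borel \<Longrightarrow> (\<integral>\<^sup>+z. f z \<partial>restrict_space M K) = (\<integral>\<^sup>+z. f z \<partial>M)"
    and "(\<integral>z. h z \<partial>restrict_space M K) = (\<integral>z. indicator K z * h z \<partial>M)"
proof -
  interpret borel_prob M by fact
  have K': "K \<in> sets M" using K by (simp add: borel_closed)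
  have sets_eq: "sets (restrict_space M K) = sets (restrict_space borel K)"
    by (rule sets_restrict_space_cong) simp
  have "emeasure M K = 1"
    using AE_K K' by (intro emeasure_eq_1_AE) auto
  then have "prob_space (restrict_space M K)"
    using K' by (intro prob_spaceI) (simp add: emeasure_restrict_space space_restrict_space)
  with sets_eq show "restrict_space M K \<in> probs_on K" by (simp add: probs_on_def)
  show "(\<integral>\<^sup>+z. f z \<partial>restrict_space M K) = (\<integral>\<^sup>+z. f z \<partial>M)" if "f \<in> borel_measurable borel"
  proof -
    have "(\<integral>\<^sup>+z. f z \<partial>restrict_space M K) = (\<integral>\<^sup>+z. f z * indicator K z \<partial>M)"
      using K' by (intro nn_integral_restrict_space) auto
    also have "\<dots> = (\<integral>\<^sup>+z. f z \<partial>M)"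
      using AE_K by (intro nn_integral_cong_AE) (auto simp: indicator_def)
    finally show ?thesis .
  qed
  show "(\<integral>z. h z \<partial>restrict_space M K) = (\<integral>z. indicator K z * h z \<partial>M)"
    using K' by (subst integral_restrict_space) auto
qed

lemma borel_prob_distr:
  assumes "prob_space M" "f \<in> borel_measurable M"
  shows "borel_prob (distr M borel f)"
  using prob_space.prob_space_distr[OF assms]
  by (simp add: borel_prob_def borel_prob_axioms_def)

text \<open>A fair coin decides between \<open>M\<close> and \<open>N\<close>; as a monadic bind
  this yields the integral formula at once.\<close>

lemma borel_prob_mixture:
  assumes M: "borel_prob M" and N: "borel_prob N"
  obtains P where "borel_prob P"
    "\<And>f. f \<in> borel_measurable borel \<Longrightarrow> (\<integral>\<^sup>+z. f z \<partial>P) = ((\<integral>\<^sup>+z. f z \<partial>M) + (\<integral>\<^sup>+z. f z \<partial>N)) / 2"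
proof
  interpret M: borel_prob M by fact
  interpret N: borel_prob N by fact
  let ?p = "measure_pmf (bernoulli_pmf (1 / 2))" and ?N = "\<lambda>b. if b then M else N"
  let ?P = "?p \<bind> ?N"
  have N_meas: "?N \<in> measurable ?p (subprob_algebra borel)"
    by (simp add: measurable_def space_subprob_algebra M.subprob_space_axioms N.subprob_space_axioms)
  have sets_P: "sets ?P = sets borel"
    by (rule sets_bind[OF sets_kernel[OF N_meas]]) auto
  show int: "(\<integral>\<^sup>+z. f z \<partial>?P) = ((\<integral>\<^sup>+z. f z \<partial>M) + (\<integral>\<^sup>+z. f z \<partial>N)) / 2" if "f \<in> borel_measurable borel" for f
  proof -
    have half: "ennreal (1 / 2) = inverse 2"
      using inverse_ennreal[of 2] by (simp add: inverse_eq_divide)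
    have "(\<integral>\<^sup>+z. f z \<partial>?P) = (\<integral>\<^sup>+b. \<integral>\<^sup>+z. f z \<partial>?N b \<partial>?p)"
      by (rule nn_integral_bind[OF that N_meas])
    also have "\<dots> = (\<integral>\<^sup>+z. f z \<partial>M) * inverse 2 + (\<integral>\<^sup>+z. f z \<partial>N) * inverse 2"
      by (subst nn_integral_bernoulli_pmf) (auto simp: half)
    finally show ?thesis by (simp only: divide_ennreal_def distrib_right)
  qed
  have "emeasure ?P UNIV = (\<integral>\<^sup>+z. 1 \<partial>?P)"
    using sets_eq_imp_space_eq[OF sets_P] by simp
  also have "\<dots> = 1"
    using M.emeasure_space_1 N.emeasure_space_1 by (subst int) (auto simp: ennreal_divide_self)
  finally have "emeasure ?P (space ?P) = 1"
    using sets_eq_imp_space_eq[OF sets_P] by simp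
  then show "borel_prob ?P"
    by (simp add: borel_prob_def borel_prob_axioms_def sets_P prob_spaceI)
qed

context weighted_set
begin

lemma nn_integral_wkernel_measurable:
  assumes "borel_prob N"
  shows "(\<lambda>z. \<integral>\<^sup>+t. wkernel z t \<partial>N) \<in> borel_measurable borel"
proof -
  interpret N: borel_prob N by fact
  have "(\<lambda>p. wkernel (fst p) (snd p)) \<in> borel_measurable (borel \<Otimes>\<^sub>M N)"
    using borel_measurable_wkernel by (simp cong: measurable_cong_sets)
  from N.borel_measurable_nn_integral_fst[OF this] show ?thesis by simp
qed

lemma borel_measurable_wkernel_left: "(\<lambda>z. wkernel z t) \<in> borel_measurable borel"
  using measurable_compose[OF measurable_Pair2' borel_measurable_wkernel] by simp

lemma borel_measurable_wkernel_right: "wkernel z \<in> borel_measurable borel"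
  using measurable_compose[OF measurable_Pair1' borel_measurable_wkernel] by simp

lemma energy_restrict:
  assumes M: "borel_prob M" and AE_K: "AE z in M. z \<in> K"
  shows "energy (restrict_space M K) = energy M"
  unfolding energy_def
  by (simp add: restrict_probs_on(2)[OF M closed_K AE_K] borel_measurable_wkernel_right
      nn_integral_wkernel_measurable[OF M])

lemma nn_integral_wkernel_eq:
  assumes M: "borel_prob M" and N: "borel_prob N"
  shows "(\<integral>\<^sup>+z. \<integral>\<^sup>+t. wkernel z t \<partial>N \<partial>M) =
    (\<integral>\<^sup>+z. \<integral>\<^sup>+t. ell (sph z t) \<partial>N \<partial>M) + ((\<integral>\<^sup>+z. ext_field z \<partial>M) + (\<integral>\<^sup>+z. ext_field z \<partial>N))"
proof -
  interpret M: borel_prob M by fact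
  interpret N: borel_prob N by fact
  have es: "(\<lambda>p. ell (sph (fst p) (snd p))) \<in> borel_measurable (M \<Otimes>\<^sub>M N)"
    using measurable_compose[OF borel_measurable_sph borel_measurable_ell] by (simp cong: measurable_cong_sets)
  have e1: "(\<lambda>t. ell (sph z t)) \<in> borel_measurable N" for z
    using measurable_compose[OF measurable_Pair1' es] by simp
  have e2: "(\<lambda>z. \<integral>\<^sup>+t. ell (sph z t) \<partial>N) \<in> borel_measurable M"
    using N.borel_measurable_nn_integral_fst[OF es] by simp
  have [measurable]: "ext_field \<in> borel_measurable M" "ext_field \<in> borel_measurable N"
    using borel_measurable_ext_field by (simp_all cong: measurable_cong_sets)
  have "(\<integral>\<^sup>+t. wkernel z t \<partial>N) = (\<integral>\<^sup>+t. ell (sph z t) \<partial>N) + (ext_field z + (\<integral>\<^sup>+t. ext_field t \<partial>N))" for z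
    unfolding wkernel_def using e1 N.emeasure_space_1 by (simp add: nn_integral_add)
  then show ?thesis
    using e2 M.emeasure_space_1 by (simp add: nn_integral_add)
qed

lemma nn_integral_wkernel_commute:
  assumes M: "borel_prob M" and N: "borel_prob N"
  shows "(\<integral>\<^sup>+z. \<integral>\<^sup>+t. wkernel z t \<partial>N \<partial>M) = (\<integral>\<^sup>+z. \<integral>\<^sup>+t. wkernel z t \<partial>M \<partial>N)"
proof -
  interpret M: borel_prob M by fact
  interpret N: borel_prob N by fact
  interpret pair_sigma_finite M N ..
  have "(\<lambda>p. wkernel (fst p) (snd p)) \<in> borel_measurable (M \<Otimes>\<^sub>M N)"
    using borel_measurable_wkernel by (simp cong: measurable_cong_sets)
  from Fubini[OF this] show ?thesis by (simp add: wkernel_commute)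
qed

definition to_borel :: "complex measure \<Rightarrow> complex measure" where
  "to_borel \<mu> = distr \<mu> borel (\<lambda>z. z)"

lemma measurable_ident_probs_on: "\<mu> \<in> probs_on K \<Longrightarrow> (\<lambda>z. z) \<in> borel_measurable \<mu>"
  by (rule probs_onD(4)) simp_all

lemma borel_prob_to_borel: "\<mu> \<in> probs_on K \<Longrightarrow> borel_prob (to_borel \<mu>)"
  unfolding to_borel_def by (intro borel_prob_distr probs_onD(1) measurable_ident_probs_on)

lemma to_borel_inject:
  assumes \<mu>: "\<mu> \<in> probs_on K" and \<nu>: "\<nu> \<in> probs_on K" and eq: "to_borel \<mu> = to_borel \<nu>"
  shows "\<mu> = \<nu>"
proof (rule measure_eqI)
  show "sets \<mu> = sets \<nu>" by (simp add: probs_onD(2) \<mu> \<nu>)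
  fix A assume "A \<in> sets \<mu>"
  then have A: "A \<subseteq> K" "A \<in> sets borel"
    using closed_K by (auto simp: probs_onD(2)[OF \<mu>] sets_restrict_space borel_closed)
  have "emeasure \<rho> A = emeasure (to_borel \<rho>) A" if "\<rho> \<in> probs_on K" for \<rho>
    using A probs_onD(3)[OF that] measurable_ident_probs_on[OF that]
    by (simp add: to_borel_def emeasure_distr Int_absorb2)
  then show "emeasure \<mu> A = emeasure \<nu> A" using \<mu> \<nu> eq by simp
qed

text \<open>The midpoint \<open>P\<close> has energy \<open>(V + 2 E + V) / 4\<close>, where
  \<open>E\<close> is the mutual energy, so minimality gives \<open>V \<le> E\<close>. The field
  contributes the same finite amount to \<open>V + V\<close> and to \<open>E + E\<close>; cancelling
  it leaves the inequality between logarithmic energies that \<open>spherical_energy_unique\<close>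
  turns into equality of measures.\<close>

lemma energy_minimizer_unique:
  assumes \<mu>: "\<mu> \<in> probs_on K" and \<nu>: "\<nu> \<in> probs_on K"
    and V: "energy \<mu> = V" "energy \<nu> = V" "V < \<infinity>"
    and min: "\<And>\<rho>. \<rho> \<in> probs_on K \<Longrightarrow> V \<le> energy \<rho>"
  shows "\<mu> = \<nu>"
proof -
  have int: "(\<integral>\<^sup>+z. f z \<partial>to_borel \<rho>) = (\<integral>\<^sup>+z. f z \<partial>\<rho>)" if "\<rho> \<in> probs_on K" "f \<in> borel_measurable borel" for f \<rho>
    unfolding to_borel_def using that by (simp add: nn_integral_distr[OF measurable_ident_probs_on])
  have en: "(\<integral>\<^sup>+z. \<integral>\<^sup>+t. wkernel z t \<partial>to_borel \<rho> \<partial>to_borel \<rho>) = energy \<rho>" if "\<rho> \<in> probs_on K" for \<rho>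
    unfolding energy_def int[OF that nn_integral_wkernel_measurable[OF borel_prob_to_borel[OF that]]]
    by (simp add: int[OF that borel_measurable_wkernel_right])
  let ?M = "to_borel \<mu>" and ?N = "to_borel \<nu>"
  note M = borel_prob_to_borel[OF \<mu>] and N = borel_prob_to_borel[OF \<nu>]
  obtain P where P: "borel_prob P" and intP: "\<And>f. f \<in> borel_measurable borel \<Longrightarrow>
      (\<integral>\<^sup>+z. f z \<partial>P) = ((\<integral>\<^sup>+z. f z \<partial>?M) + (\<integral>\<^sup>+z. f z \<partial>?N)) / 2"
    using borel_prob_mixture[OF M N] by metis
  interpret P: borel_prob P by (rule P)
  have out: "(\<integral>\<^sup>+z. indicator (- K) z \<partial>to_borel \<rho>) = 0" if "\<rho> \<in> probs_on K" for \<rho>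
  proof -
    have "(\<integral>\<^sup>+z. indicator (- K) z \<partial>to_borel \<rho>) = (\<integral>\<^sup>+z. indicator (- K) z \<partial>\<rho>)"
      using closed_K by (intro int[OF that] borel_measurable_indicator) (simp add: borel_closed borel_comp)
    also have "\<dots> = (\<integral>\<^sup>+z. 0 \<partial>\<rho>)"
      by (rule nn_integral_cong) (simp add: probs_onD(3)[OF that])
    finally show ?thesis by simp
  qed
  have nK: "- K \<in> sets borel" using closed_K by (simp add: borel_closed borel_comp)
  have "emeasure P (- K) = (\<integral>\<^sup>+z. indicator (- K) z \<partial>P)" using nK by simp
  also have "\<dots> = 0" using nK by (subst intP) (auto simp: out \<mu> \<nu>)
  finally have P_K: "AE z in P. z \<in> K"
    using nK by (intro AE_I[of _ _ "- K"]) auto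
  let ?E = "\<integral>\<^sup>+z. \<integral>\<^sup>+t. wkernel z t \<partial>?N \<partial>?M"
  have "V \<le> energy P"
    using min[OF restrict_probs_on(1)[OF P closed_K P_K]] energy_restrict[OF P P_K] by simp
  also have "energy P = (\<integral>\<^sup>+z. ((\<integral>\<^sup>+t. wkernel z t \<partial>?M) + (\<integral>\<^sup>+t. wkernel z t \<partial>?N)) / 2 \<partial>P)"
    unfolding energy_def by (simp add: intP borel_measurable_wkernel_right)
  also have "\<dots> = ((\<integral>\<^sup>+z. \<integral>\<^sup>+t. wkernel z t \<partial>?M \<partial>P) + (\<integral>\<^sup>+z. \<integral>\<^sup>+t. wkernel z t \<partial>?N \<partial>P)) / 2"
  proof -
    have "(\<lambda>z. \<integral>\<^sup>+t. wkernel z t \<partial>?M) \<in> borel_measurable P" "(\<lambda>z. \<integral>\<^sup>+t. wkernel z t \<partial>?N) \<in> borel_measurable P"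
      using nn_integral_wkernel_measurable[OF M] nn_integral_wkernel_measurable[OF N] by (simp_all cong: measurable_cong_sets)
    then show ?thesis by (simp add: nn_integral_divide nn_integral_add)
  qed
  also have "\<dots> = ((V + ?E) / 2 + (?E + V) / 2) / 2"
    using nn_integral_wkernel_commute[OF M N] en[OF \<mu>] en[OF \<nu>] V
    by (simp add: intP nn_integral_wkernel_measurable M N)
  finally have le: "V \<le> ((V + ?E) / 2 + (?E + V) / 2) / 2" .
  have V_le: "V \<le> ?E"
  proof (cases "?E" rule: ennreal_cases)
    case (real e)
    obtain v where v: "0 \<le> v" "V = ennreal v" using V(3) by (cases V rule: ennreal_cases) auto
    have "((V + ?E) / 2 + (?E + V) / 2) / 2 = ennreal (((v + e) / 2 + (e + v) / 2) / 2)"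
      unfolding real v(2) using v(1) real(1) 
      by (simp add: ennreal_plus[symmetric] ennreal_divide_numeral del: ennreal_plus)
    with le have "ennreal v \<le> ennreal (((v + e) / 2 + (e + v) / 2) / 2)"
      by (simp only: v(2))
    then have "v \<le> ((v + e) / 2 + (e + v) / 2) / 2"
      using v real(1) by (subst (asm) ennreal_le_iff) auto
    then show ?thesis using v real by (simp add: field_simps)
  qed auto
  let ?R = "(\<integral>\<^sup>+z. ext_field z \<partial>?M) + (\<integral>\<^sup>+z. ext_field z \<partial>?N)"
  let ?MM = "\<integral>\<^sup>+z. \<integral>\<^sup>+t. ell (sph z t) \<partial>?M \<partial>?M" and ?NN = "\<integral>\<^sup>+z. \<integral>\<^sup>+t. ell (sph z t) \<partial>?N \<partial>?N"
    and ?MN = "\<integral>\<^sup>+z. \<integral>\<^sup>+t. ell (sph z t) \<partial>?N \<partial>?M"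
  have VM: "V = ?MM + ((\<integral>\<^sup>+z. ext_field z \<partial>?M) + (\<integral>\<^sup>+z. ext_field z \<partial>?M))"
    using en[OF \<mu>] V nn_integral_wkernel_eq[OF M M] by simp
  have VN: "V = ?NN + ((\<integral>\<^sup>+z. ext_field z \<partial>?N) + (\<integral>\<^sup>+z. ext_field z \<partial>?N))"
    using en[OF \<nu>] V nn_integral_wkernel_eq[OF N N] by simp
  have fin: "?MM < \<infinity>" "?NN < \<infinity>" "?R < \<infinity>"
  proof -
    have "?MM + ((\<integral>\<^sup>+z. ext_field z \<partial>?M) + (\<integral>\<^sup>+z. ext_field z \<partial>?M)) \<noteq> \<top>"
      "?NN + ((\<integral>\<^sup>+z. ext_field z \<partial>?N) + (\<integral>\<^sup>+z. ext_field z \<partial>?N)) \<noteq> \<top>"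
      using V(3) unfolding VM[symmetric] VN[symmetric] by auto
    then show "?MM < \<infinity>" "?NN < \<infinity>" "?R < \<infinity>"
      by (simp_all add: less_top[symmetric] ennreal_add_eq_top)
  qed
  have "2 * ?R + (?MM + ?NN) = V + V"
    by (subst VM, subst VN) (simp add: mult_2 add_ac)
  also have "\<dots> \<le> ?E + ?E" by (intro add_mono V_le)
  also have "\<dots> = 2 * ?R + 2 * ?MN"
    by (simp add: nn_integral_wkernel_eq[OF M N] mult_2 add_ac)
  finally have "?MM + ?NN \<le> 2 * ?MN"
    using fin(3) by (subst (asm) ennreal_add_left_cancel_le) (auto simp: ennreal_mult_eq_top_iff)
  then have "?M = ?N"
    by (rule spherical_energy_unique[OF M N fin(1,2)])
  then show "\<mu> = \<nu>" by (rule to_borel_inject[OF \<mu> \<nu>])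
qed

end

subsection \<open>Subsequential limits of empirical measures\<close>

text \<open>The plane is shrunk to the open unit disc by \<open>\<phi>\<close>, and the points are
  pulled back along the filling curve to \<open>[0, 1]\<close>. There a subsequence converges in
  law, and Skorohod makes the convergence pointwise. \<open>B\<close> is the event that the limit
  leaves the open disc, so on \<open>B\<close> the points themselves tend to infinity.\<close>

lemma empirical_measures_subsequence:
  fixes x :: "nat \<Rightarrow> nat \<Rightarrow> complex" and m :: "nat \<Rightarrow> nat"
  assumes m: "\<And>n. 0 < m n"
  obtains s :: "nat \<Rightarrow> nat" and \<Omega> :: "real measure" and Z Zn B where
    "strict_mono s" "prob_space \<Omega>" "\<And>n. Zn n \<in> borel_measurable \<Omega>" "Z \<in> borel_measurable \<Omega>" "B \<in> sets \<Omega>"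
    "\<And>n. distr \<Omega> borel (Zn n) = distr (measure_pmf (pmf_of_set {1..m (s n)})) borel (x (s n))"
    "AE \<omega> in \<Omega>. \<omega> \<in> B \<longrightarrow> filterlim (\<lambda>n. Zn n \<omega>) at_infinity sequentially"
    "AE \<omega> in \<Omega>. \<omega> \<notin> B \<longrightarrow> (\<lambda>n. Zn n \<omega>) \<longlonglongrightarrow> Z \<omega>"
proof -
  obtain g :: "real \<Rightarrow> complex" where g: "continuous_on UNIV g"
    and onto: "\<And>u. cmod u < 1 \<Longrightarrow> \<exists>t\<in>{0..1}. g t = u"
    using disc_filling_curve by metis
  define \<phi> where "\<phi> z = z / of_real (1 + cmod z)" for z
  define \<zeta> where "\<zeta> u = u / of_real (1 - cmod u)" for u
  have pos: "0 < 1 + cmod z" for z by (simp add: add_pos_nonneg)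
  have norm_\<phi>: "cmod (\<phi> z) = cmod z / (1 + cmod z)" for z
    unfolding \<phi>_def norm_divide norm_of_real using pos[of z] by simp
  have less_1: "cmod (\<phi> z) < 1" for z
    unfolding norm_\<phi> using pos[of z] by simp
  have \<zeta>\<phi>: "\<zeta> (\<phi> z) = z" for z
  proof -
    have "1 - cmod (\<phi> z) = 1 / (1 + cmod z)"
      unfolding norm_\<phi> using pos[of z] by (simp add: field_simps)
    then have "\<zeta> (\<phi> z) = z / of_real (1 + cmod z) / of_real (1 / (1 + cmod z))"
      by (simp only: \<zeta>_def) (simp add: \<phi>_def)
    also have "\<dots> = z" using pos[of z]
      by (metis (no_types, lifting) divide_divide_eq_right divide_self_if less_irrefl mult.right_neutral
          nonzero_eq_divide_eq of_real_1 of_real_divide of_real_eq_0_iff times_divide_eq_right)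
    finally show ?thesis .
  qed
  have [measurable]: "g \<in> borel_measurable borel" using g by (rule borel_measurable_continuous_onI)
  have "(\<lambda>u. u * inverse (complex_of_real (1 - cmod u))) \<in> borel_measurable borel" by measurable
  then have [measurable]: "\<zeta> \<in> borel_measurable borel" by (simp add: \<zeta>_def[abs_def] divide_inverse)
  have "\<forall>n j. \<exists>t\<in>{0..1}. g t = \<phi> (x n j)" using onto[OF less_1] by blast
  then obtain t where t: "\<And>n j. t n j \<in> {0..1}" "\<And>n j. g (t n j) = \<phi> (x n j)" by metis
  define \<eta> where "\<eta> n = distr (measure_pmf (pmf_of_set {1..m n})) borel (t n)" for n
  have \<eta>: "real_distribution (\<eta> n)" for n
    unfolding real_distribution_def real_distribution_axioms_def \<eta>_def
    by (auto intro!: measure_pmf.prob_space_distr)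
  have "tight \<eta>"
    unfolding tight_def
  proof (intro conjI allI impI \<eta>)
    fix \<epsilon> :: real assume "\<epsilon> > 0"
    have "t n j \<in> {-1<..2}" for n j
      using t(1)[of n j] by auto
    then have "t n -` {-1<..2} = UNIV" for n by blast
    then have "measure (\<eta> n) {-1<..2} = 1" for n
      unfolding \<eta>_def by (subst measure_distr) auto
    then show "\<exists>a b. a < b \<and> (\<forall>n. 1 - \<epsilon> < measure (\<eta> n) {a<..b})"
      using \<open>\<epsilon> > 0\<close> by (intro exI[of _ "-1"] exI[of _ 2]) auto
  qed
  from tight_imp_convergent_subsubsequence[OF this strict_mono_id] obtain s :: "nat \<Rightarrow> nat" and M
    where s: "strict_mono s" and M: "real_distribution M" and conv: "weak_conv_m (\<eta> \<circ> id \<circ> s) M"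
    by auto
  then have conv': "weak_conv_m (\<lambda>n. \<eta> (s n)) M" by (simp add: comp_def)
  obtain \<Omega> :: "real measure" and Yn Y where \<Omega>: "prob_space \<Omega>"
    and Yn: "\<And>n. Yn n \<in> measurable \<Omega> borel" "\<And>n. distr \<Omega> borel (Yn n) = \<eta> (s n)"
    and Y: "Y \<in> measurable \<Omega> lborel" "\<forall>\<omega>\<in>space \<Omega>. (\<lambda>n. Yn n \<omega>) \<longlonglongrightarrow> Y \<omega>"
    using Skorohod[OF \<eta> M conv'] by blast
  note [measurable] = Yn(1)
  have [measurable]: "Y \<in> borel_measurable \<Omega>" using Y(1) by simp
  interpret \<Omega>: prob_space \<Omega> by (rule \<Omega>)
  define Zn where "Zn n \<omega> = \<zeta> (g (Yn n \<omega>))" for n \<omega>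
  define Z where "Z \<omega> = \<zeta> (g (Y \<omega>))" for \<omega>
  define B where "B = {\<omega>\<in>space \<Omega>. 1 \<le> cmod (g (Y \<omega>))}"
  have Zn_meas [measurable]: "Zn n \<in> borel_measurable \<Omega>" for n unfolding Zn_def[abs_def] by measurable
  have Z_meas: "Z \<in> borel_measurable \<Omega>" unfolding Z_def[abs_def] by measurable
  have B: "B \<in> sets \<Omega>" unfolding B_def by measurable
  have distr: "distr \<Omega> borel (Zn n) = distr (measure_pmf (pmf_of_set {1..m (s n)})) borel (x (s n))" for n
  proof -
    have "distr \<Omega> borel (Zn n) = distr (distr \<Omega> borel (Yn n)) borel (\<lambda>y. \<zeta> (g y))"
      by (subst distr_distr) (auto simp: comp_def Zn_def[abs_def])
    also have "\<dots> = distr (measure_pmf (pmf_of_set {1..m (s n)})) borel (\<lambda>j. \<zeta> (g (t (s n) j)))"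
      unfolding Yn(2) \<eta>_def by (subst distr_distr) (auto simp: comp_def)
    finally show ?thesis by (simp add: t(2) \<zeta>\<phi>)
  qed
  \<comment> \<open>Only the laws of \<open>Yn\<close> are prescribed, so its values are lifted
    points almost surely rather than everywhere. This is what gives
    \<open>g (Yn n \<omega>) = \<phi> (Zn n \<omega>)\<close> below.\<close>
  have "AE \<omega> in \<Omega>. g (Yn n \<omega>) \<in> range \<phi>" for n
  proof -
    have fin: "finite (t (s n) ` {1..m (s n)})" by simp
    have "AE y in \<eta> (s n). y \<in> t (s n) ` {1..m (s n)}"
      unfolding \<eta>_def using m[of "s n"] fin
      by (subst AE_distr_iff) (auto simp: AE_measure_pmf_iff borel_closed finite_imp_closed)
    then have "AE \<omega> in \<Omega>. Yn n \<omega> \<in> t (s n) ` {1..m (s n)}"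
      unfolding Yn(2)[symmetric] using fin
      by (subst (asm) AE_distr_iff) (auto simp: borel_closed finite_imp_closed)
    then show ?thesis by (rule AE_mp) (auto simp: t(2) intro!: AE_I2)
  qed
  then have ran: "AE \<omega> in \<Omega>. \<forall>n. g (Yn n \<omega>) \<in> range \<phi>" by (simp add: AE_all_countable)
  have lim: "(\<lambda>n. g (Yn n \<omega>)) \<longlonglongrightarrow> g (Y \<omega>)" if "\<omega> \<in> space \<Omega>" for \<omega>
    using continuous_on_tendsto_compose[OF g] Y(2) that by auto
  have escape: "filterlim (\<lambda>n. Zn n \<omega>) at_infinity sequentially"
    if \<omega>: "\<omega> \<in> space \<Omega>" and all: "\<forall>n. g (Yn n \<omega>) \<in> range \<phi>" and "\<omega> \<in> B" for \<omega>
  proof -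
    have eq: "g (Yn n \<omega>) = \<phi> (Zn n \<omega>)" for n
      using all unfolding Zn_def by (metis \<zeta>\<phi> imageE)
    have lim1: "(\<lambda>n. cmod (\<phi> (Zn n \<omega>))) \<longlonglongrightarrow> cmod (g (Y \<omega>))"
      using tendsto_norm[OF lim[OF \<omega>]] unfolding eq .
    have "\<forall>\<^sub>F n in sequentially. R \<le> cmod (Zn n \<omega>)" if R: "R > 0" for R
    proof -
      have "R / (1 + R) < cmod (g (Y \<omega>))"
      proof -
        have "R / (1 + R) < 1" using R by simp
        moreover have "1 \<le> cmod (g (Y \<omega>))" using \<open>\<omega> \<in> B\<close> by (simp add: B_def)
        ultimately show ?thesis by (rule less_le_trans)
      qed
      with lim1 have "\<forall>\<^sub>F n in sequentially. R / (1 + R) < cmod (\<phi> (Zn n \<omega>))"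
        by (auto simp: order_tendsto_iff)
      then show ?thesis
      proof eventually_elim
        case (elim n)
        show ?case
        proof (rule ccontr)
          assume "\<not> R \<le> cmod (Zn n \<omega>)"
          then have "1 / (1 + R) \<le> 1 / (1 + cmod (Zn n \<omega>))"
            using pos[of "Zn n \<omega>"] by (intro divide_left_mono mult_pos_pos) auto
          moreover have "a / (1 + a) = 1 - 1 / (1 + a)" if "0 \<le> a" for a :: real
            using that by (simp add: field_simps)
          ultimately show False
            using elim R unfolding norm_\<phi> by simp
        qed
      qed
    qed
    then have "filterlim (\<lambda>n. cmod (Zn n \<omega>)) at_top sequentially"
      using filterlim_at_top_gt[of _ sequentially 0] by blast
    then show ?thesis by (rule filterlim_norm_at_top_imp_at_infinity)
  qed
  show thesis
  proof
    show "AE \<omega> in \<Omega>. \<omega> \<in> B \<longrightarrow> filterlim (\<lambda>n. Zn n \<omega>) at_infinity sequentially"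
      using ran AE_space[of \<Omega>] by eventually_elim (use escape in blast)
    show "AE \<omega> in \<Omega>. \<omega> \<notin> B \<longrightarrow> (\<lambda>n. Zn n \<omega>) \<longlonglongrightarrow> Z \<omega>"
    proof (intro AE_I2 impI)
      fix \<omega> assume \<omega>: "\<omega> \<in> space \<Omega>" and "\<omega> \<notin> B"
      then have "cmod (g (Y \<omega>)) < 1" by (auto simp: B_def)
      then show "(\<lambda>n. Zn n \<omega>) \<longlonglongrightarrow> Z \<omega>"
        unfolding Zn_def Z_def \<zeta>_def by (intro tendsto_intros lim \<omega>) auto
    qed
  qed (use s \<Omega> Z_meas Zn_meas B distr in auto)
qed

text \<open>Indices outside \<open>{1..k}\<close>, about which nothing is known, are redirected to
  \<open>x 1\<close> so that the map takes all its values in \<open>K\<close>.\<close>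

lemma empirical_eq_distr:
  assumes k: "0 < k" and x: "\<And>j. j \<in> {1..k} \<Longrightarrow> x j \<in> K"
  shows "empirical K k x =
    distr (measure_pmf (pmf_of_set {1..k})) (restrict_space borel K) (\<lambda>j. if j \<in> {1..k} then x j else x 1)"
  unfolding empirical_def distr_def
proof (rule measure_of_eq[THEN trans])
  show "sets (restrict_space borel K) \<subseteq> Pow K" by (auto simp: sets_restrict_space)
  fix A
  have ne: "{1..k} \<noteq> {}" using k by auto
  let ?x' = "\<lambda>j. if j \<in> {1..k} then x j else x 1"
  have "(\<Sum>j = 1..k. indicator A (x j)) = real (card ({1..k} \<inter> ?x' -` A))"
  proof -
    have "(\<Sum>j = 1..k. indicator A (x j)) = (\<Sum>j\<in>{1..k}. of_bool (j \<in> ?x' -` A) :: real)"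
      by (rule sum.cong) (auto simp: indicator_def)
    also have "\<dots> = real (card ({1..k} \<inter> ?x' -` A))"
      by (subst sum_of_bool_eq) (auto simp: Int_def)
    finally show ?thesis .
  qed
  then show "ennreal ((\<Sum>j = 1..k. indicator A (x j)) / real k) =
    emeasure (measure_pmf (pmf_of_set {1..k})) (?x' -` A \<inter> space (measure_pmf (pmf_of_set {1..k})))"
    using ne by (simp add: emeasure_pmf_of_set)
qed (simp add: space_restrict_space)

lemma integral_empirical:
  fixes f :: "complex \<Rightarrow> real"
  assumes k: "0 < k" and x: "\<And>j. j \<in> {1..k} \<Longrightarrow> x j \<in> K"
    and f: "continuous_on K f"
  shows "(\<integral>z. f z \<partial>empirical K k x) = (\<Sum>j\<in>{1..k}. f (x j)) / real k"
proof -
  have ne: "{1..k} \<noteq> {}" using k by auto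
  let ?x' = "\<lambda>j. if j \<in> {1..k} then x j else x 1"
  have x': "?x' \<in> measurable (measure_pmf (pmf_of_set {1..k})) (restrict_space borel K)"
    using x k by (auto simp: measurable_def space_restrict_space)
  have emp: "empirical K k x = distr (measure_pmf (pmf_of_set {1..k})) (restrict_space borel K) ?x'"
    by (rule empirical_eq_distr[OF k]) (rule x)
  have "(\<integral>z. f z \<partial>empirical K k x) = (\<integral>j. f (?x' j) \<partial>measure_pmf (pmf_of_set {1..k}))"
    unfolding emp by (rule integral_distr[OF x' borel_measurable_continuous_on_restrict[OF f]])
  also have "\<dots> = (\<Sum>j\<in>{1..k}. f (?x' j)) / real k"
    using ne by (subst integral_pmf_of_set) auto
  also have "(\<Sum>j\<in>{1..k}. f (?x' j)) = (\<Sum>j\<in>{1..k}. f (x j))"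
    by (rule sum.cong) auto
  finally show ?thesis .
qed

lemma (in prob_space) nn_integral_liminf2:
  fixes u :: "nat \<Rightarrow> 'a \<Rightarrow> 'a \<Rightarrow> ennreal"
  assumes u: "\<And>n. (\<lambda>p. u n (fst p) (snd p)) \<in> borel_measurable (M \<Otimes>\<^sub>M M)"
  shows "(\<integral>\<^sup>+x. \<integral>\<^sup>+y. liminf (\<lambda>n. u n x y) \<partial>M \<partial>M) \<le> liminf (\<lambda>n. \<integral>\<^sup>+x. \<integral>\<^sup>+y. u n x y \<partial>M \<partial>M)"
proof -
  have "(\<integral>\<^sup>+x. \<integral>\<^sup>+y. liminf (\<lambda>n. u n x y) \<partial>M \<partial>M) \<le> (\<integral>\<^sup>+x. liminf (\<lambda>n. \<integral>\<^sup>+y. u n x y \<partial>M) \<partial>M)"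
  proof (intro nn_integral_mono nn_integral_liminf)
    fix x n assume "x \<in> space M"
    from measurable_compose[OF measurable_Pair1'[OF this] u[of n]] show "u n x \<in> borel_measurable M"
      by simp
  qed
  also have "\<dots> \<le> liminf (\<lambda>n. \<integral>\<^sup>+x. \<integral>\<^sup>+y. u n x y \<partial>M \<partial>M)"
    using borel_measurable_nn_integral_fst[OF u] by (intro nn_integral_liminf) simp
  finally show ?thesis .
qed

lemma min_liminf_le: "min c (liminf f) \<le> liminf (\<lambda>n. min c (f n))"
  for c :: "'a::complete_linorder"
  unfolding le_Liminf_iff
proof (intro allI impI)
  fix y assume y: "y < min c (liminf f)"
  then have "\<forall>\<^sub>F n in sequentially. y < f n" by (intro less_LiminfD) auto
  then show "\<forall>\<^sub>F n in sequentially. y < min c (f n)"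
    by eventually_elim (use y in auto)
qed

lemma le_liminf_min_of_nat: "a \<le> liminf (\<lambda>n. min (of_nat n) a)" for a :: ennreal
  unfolding le_Liminf_iff
proof (intro allI impI)
  fix y assume y: "y < a"
  then obtain N where N: "y < of_nat N"
    using ennreal_Ex_less_of_nat[of y] by (metis infinity_ennreal_def top.not_eq_extremum top_greatest not_le)
  show "\<forall>\<^sub>F n in sequentially. y < min (of_nat n) a"
    using eventually_ge_at_top[of N]
  proof eventually_elim
    case (elim n)
    have "y < of_nat n" by (rule less_le_trans[OF N]) (use elim in simp)
    then show ?case using y by simp
  qed
qed

section \<open>Measures of finite energy and compactness of low-energy configurations\<close>

context weighted_set
begin

text \<open>Nonpolarity gives a measure of finite logarithmic energy on a compact subset of
  \<open>{Q < \<infinity>}\<close>, but \<open>Q\<close> may fail to be integrable against it.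
  Conditioning on a sublevel set of \<open>ext_field\<close> of positive measure bounds the field,
  and multiplies the double integral at most by the squared reciprocal of that measure.\<close>

lemma exists_finite_energy:
  assumes np: "\<not> polar {z \<in> K. Q z < \<infinity>}"
  shows "\<exists>\<nu>\<in>probs_on K. energy \<nu> < \<infinity>"
proof -
  obtain \<mu> L where \<mu>: "sets \<mu> = sets borel" "prob_space \<mu>" and L: "compact L" "L \<subseteq> {z \<in> K. Q z < \<infinity>}"
    and L0: "emeasure \<mu> (UNIV - L) = 0" and fin: "log_energy \<mu> \<noteq> \<infinity>"
    using np unfolding polar_def by blast
  interpret borel_prob \<mu> using \<mu> by (simp add: borel_prob_def borel_prob_axioms_def)
  have bp: "borel_prob \<mu>" by unfold_locales
  have AE_L: "AE z in \<mu>. z \<in> L"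
    using L0 L(1) by (intro AE_I[of _ _ "UNIV - L"]) (auto simp: borel_closed compact_imp_closed)
  define f where "f = (\<lambda>(z, t). if z = t then \<infinity> else ereal (- ln (cmod (z - t))))"
  have "f \<in> borel_measurable (borel \<Otimes>\<^sub>M borel)"
    unfolding f_def by measurable
  then have fm: "(\<lambda>p. e2ennreal (f p)) \<in> borel_measurable (\<mu> \<Otimes>\<^sub>M \<mu>)"
    by (simp cong: measurable_cong_sets)
  have P: "(\<integral>\<^sup>+p. e2ennreal (f p) \<partial>(\<mu> \<Otimes>\<^sub>M \<mu>)) \<noteq> \<top>"
  proof
    assume "(\<integral>\<^sup>+p. e2ennreal (f p) \<partial>(\<mu> \<Otimes>\<^sub>M \<mu>)) = \<top>"
    then have "log_energy \<mu> = \<infinity> - enn2ereal (\<integral>\<^sup>+p. e2ennreal (- f p) \<partial>(\<mu> \<Otimes>\<^sub>M \<mu>))"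
      by (simp add: log_energy_def eintegral_def f_def)
    \<comment> \<open>\<open>\<infinity> - a\<close> is \<open>\<infinity>\<close> for every
      nonnegative \<open>a\<close>, even for \<open>a = \<infinity>\<close>, so a value other than
      \<open>\<infinity>\<close> forces the positive part to have finite integral.\<close>
    then show False using fin
      by (cases "enn2ereal (\<integral>\<^sup>+p. e2ennreal (- f p) \<partial>(\<mu> \<Otimes>\<^sub>M \<mu>))") auto
  qed
  obtain b where b: "\<And>z. z \<in> L \<Longrightarrow> cmod z \<le> b"
    using compact_imp_bounded[OF L(1)] by (auto simp: bounded_iff)
  define c where "c = ln (1 + b\<^sup>2)"
  have ln_le: "ln (1 + (cmod z)\<^sup>2) \<le> c" "0 \<le> c" if "z \<in> L" for z
  proof -
    have "(cmod z)\<^sup>2 \<le> b\<^sup>2" using b[OF that] by (intro power_mono) auto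
    then show "ln (1 + (cmod z)\<^sup>2) \<le> c"
      by (simp add: c_def add_pos_nonneg)
    show "0 \<le> c" by (simp add: c_def)
  qed
  \<comment> \<open>On the bounded set \<open>L\<close> the spherical kernel exceeds the positive
    part of the logarithmic one by at most a constant.\<close>
  have ell_le: "ell (sph z t) \<le> e2ennreal (f (z, t)) + ennreal c" if "z \<in> L" "t \<in> L" for z t
  proof (cases "z = t")
    case False
    have "ell (sph z t) \<le> ennreal (- ln (cmod (z - t)) + c)"
      unfolding ell_sph[OF False] using ln_le[OF that(1)] ln_le[OF that(2)] by (intro ennreal_leI) simp
    also have "\<dots> \<le> ennreal (- ln (cmod (z - t))) + ennreal c"
    proof (cases "0 \<le> - ln (cmod (z - t))")
      case True
      then show ?thesis using ln_le(2)[OF that(1)] by (subst ennreal_plus) auto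
    next
      case neg: False
      then have "ennreal (- ln (cmod (z - t)) + c) \<le> ennreal c" by (intro ennreal_leI) simp
      then show ?thesis using neg by (simp add: ennreal_neg)
    qed
    finally show ?thesis using False by (simp add: f_def)
  qed (simp add: f_def e2ennreal_infty)
  have LL: "(\<integral>\<^sup>+z. \<integral>\<^sup>+t. ell (sph z t) \<partial>\<mu> \<partial>\<mu>) \<noteq> \<top>"
  proof -
    have "(\<integral>\<^sup>+z. \<integral>\<^sup>+t. ell (sph z t) \<partial>\<mu> \<partial>\<mu>) \<le> (\<integral>\<^sup>+z. \<integral>\<^sup>+t. e2ennreal (f (z, t)) + ennreal c \<partial>\<mu> \<partial>\<mu>)"
    proof (rule nn_integral_mono_AE)
      show "AE z in \<mu>. (\<integral>\<^sup>+t. ell (sph z t) \<partial>\<mu>) \<le> (\<integral>\<^sup>+t. e2ennreal (f (z, t)) + ennreal c \<partial>\<mu>)"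
        using AE_L
      proof eventually_elim
        case (elim z)
        have "AE t in \<mu>. ell (sph z t) \<le> e2ennreal (f (z, t)) + ennreal c"
          using AE_L by eventually_elim (rule ell_le[OF elim])
        then show ?case by (rule nn_integral_mono_AE)
      qed
    qed
    also have "\<dots> = (\<integral>\<^sup>+p. e2ennreal (f p) + ennreal c \<partial>(\<mu> \<Otimes>\<^sub>M \<mu>))"
      using fm by (intro nn_integral_fst) auto
    also have "\<dots> = (\<integral>\<^sup>+p. e2ennreal (f p) \<partial>(\<mu> \<Otimes>\<^sub>M \<mu>)) + ennreal c * emeasure (\<mu> \<Otimes>\<^sub>M \<mu>) (space (\<mu> \<Otimes>\<^sub>M \<mu>))"
      using fm by (simp add: nn_integral_add)
    also have "emeasure (\<mu> \<Otimes>\<^sub>M \<mu>) (space (\<mu> \<Otimes>\<^sub>M \<mu>)) = 1"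
    proof -
      interpret pair_prob_space \<mu> \<mu> ..
      show ?thesis by (rule P.emeasure_space_1)
    qed
    finally show ?thesis using P by (auto simp: top_unique ennreal_add_eq_top)
  qed
  define S where "S n = {z. ext_field z \<le> of_nat n}" for n :: nat
  have S [measurable]: "S n \<in> sets borel" for n unfolding S_def by measurable
  have "\<exists>n. emeasure \<mu> (S n) \<noteq> 0"
  proof (rule ccontr)
    assume "\<not> ?thesis"
    then have "AE z in \<mu>. z \<notin> S n" for n
      by (intro AE_I[of _ _ "S n"]) auto
    then have "AE z in \<mu>. \<forall>n. z \<notin> S n" by (simp add: AE_all_countable)
    with AE_L have "AE z in \<mu>. False"
    proof eventually_elim
      case (elim z)
      then have "z \<in> K" "Q z < \<infinity>" using L(2) by auto
      then have "ext_field z < \<infinity>" using Q_ge[of z] by (cases "Q z") (auto simp: ext_field_def)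
      then obtain n where "ext_field z < of_nat n" using ennreal_Ex_less_of_nat by auto
      then show ?case using elim(2) by (auto simp: S_def dest: less_imp_le)
    qed
    then show False by simp
  qed
  then obtain n where n: "emeasure \<mu> (S n) \<noteq> 0" by blast
  let ?e = "emeasure \<mu> (S n)" and ?N = "uniform_measure \<mu> (S n)"
  have "prob_space ?N" using n by (intro prob_space_uniform_measure) auto
  then have N: "borel_prob ?N" by (simp add: borel_prob_def borel_prob_axioms_def)
  interpret N: borel_prob ?N by (rule N)
  have AE_S: "AE z in ?N. z \<in> S n"
    by (rule AE_uniform_measureI) (auto)
  then have AE_K: "AE z in ?N. z \<in> K"
    by (rule AE_mp) (auto simp: S_def ext_field_def top_unique split: if_splits intro!: AE_I2)
  have int_le: "(\<integral>\<^sup>+z. g z \<partial>?N) \<le> (\<integral>\<^sup>+z. g z \<partial>\<mu>) / ?e" if "g \<in> borel_measurable borel" for g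
  proof -
    have "(\<integral>\<^sup>+z. g z \<partial>?N) = (\<integral>\<^sup>+z. g z * indicator (S n) z \<partial>\<mu>) / ?e"
      using that by (intro nn_integral_uniform_measure) (auto cong: measurable_cong_sets)
    also have "\<dots> \<le> (\<integral>\<^sup>+z. g z \<partial>\<mu>) / ?e"
      by (intro divide_right_mono_ennreal nn_integral_mono) (auto simp: indicator_def)
    finally show ?thesis .
  qed
  have es: "(\<lambda>p. ell (sph (fst p) (snd p))) \<in> borel_measurable (borel \<Otimes>\<^sub>M \<mu>)"
    using measurable_compose[OF borel_measurable_sph borel_measurable_ell] by (simp cong: measurable_cong_sets)
  have e1: "(\<lambda>t. ell (sph z t)) \<in> borel_measurable borel" for z
    using measurable_compose[OF measurable_Pair1' measurable_compose[OF borel_measurable_sph borel_measurable_ell]]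
    by simp
  have e2: "(\<lambda>z. \<integral>\<^sup>+t. ell (sph z t) \<partial>\<mu>) \<in> borel_measurable borel"
    using borel_measurable_nn_integral_fst[OF es] by simp
  have "(\<integral>\<^sup>+z. \<integral>\<^sup>+t. ell (sph z t) \<partial>?N \<partial>?N) \<le> (\<integral>\<^sup>+z. (\<integral>\<^sup>+t. ell (sph z t) \<partial>\<mu>) / ?e \<partial>?N)"
    by (intro nn_integral_mono int_le e1)
  also have "\<dots> \<le> (\<integral>\<^sup>+z. (\<integral>\<^sup>+t. ell (sph z t) \<partial>\<mu>) / ?e \<partial>\<mu>) / ?e"
    by (intro int_le borel_measurable_divide_ennreal e2) auto
  also have "\<dots> = (\<integral>\<^sup>+z. \<integral>\<^sup>+t. ell (sph z t) \<partial>\<mu> \<partial>\<mu>) / ?e / ?e"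
    using e2 by (subst nn_integral_divide) (auto cong: measurable_cong_sets)
  finally have 1: "(\<integral>\<^sup>+z. \<integral>\<^sup>+t. ell (sph z t) \<partial>?N \<partial>?N) \<noteq> \<top>"
    using LL n by (auto simp: top_unique ennreal_divide_eq_top_iff)
  have "(\<integral>\<^sup>+z. ext_field z \<partial>?N) \<le> (\<integral>\<^sup>+z. of_nat n \<partial>?N)"
    using AE_S by (intro nn_integral_mono_AE) (auto simp: S_def)
  then have 2: "(\<integral>\<^sup>+z. ext_field z \<partial>?N) \<noteq> \<top>"
    using N.emeasure_space_1 by (auto simp: top_unique)
  have "energy (restrict_space ?N K) = energy ?N"
    by (rule energy_restrict[OF N AE_K])
  also have "\<dots> < \<infinity>"
    unfolding energy_def nn_integral_wkernel_eq[OF N N]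
    using 1 2 by (simp add: less_top[symmetric] ennreal_add_eq_top)
  finally have "energy (restrict_space ?N K) < \<infinity>" .
  then show ?thesis using restrict_probs_on(1)[OF N closed_K AE_K] by blast
qed

text \<open>Truncation replaces each infinite diagonal entry by at most \<open>c\<close>; off the
  diagonal it can only lower the sum.\<close>

lemma double_sum_min_le:
  "(\<Sum>i\<in>{1..k}. \<Sum>j\<in>{1..k}. min c (wkernel (x i) (x j))) \<le> 2 * pair_sum wkernel k x + of_nat k * c"
proof -
  have "(\<Sum>i\<in>{1..k}. \<Sum>j\<in>{1..k}. min c (wkernel (x i) (x j))) =
      2 * pair_sum (\<lambda>z t. min c (wkernel z t)) k x + (\<Sum>i\<in>{1..k}. min c (wkernel (x i) (x i)))"
    by (rule sum_square_eq_pair_sum) (simp add: wkernel_commute)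
  also have "\<dots> \<le> 2 * pair_sum wkernel k x + (\<Sum>i\<in>{1..k}. c)"
    unfolding pair_sum_def by (intro add_mono mult_left_mono sum_mono) auto
  finally show ?thesis by simp
qed

text \<open>With the kernel truncated at \<open>N\<close>, a discrete energy is a double integral
  over \<open>\<Omega>\<close> up to an error \<open>N / k\<close>. Fatou in \<open>n\<close> for
  fixed \<open>N\<close>, and then in \<open>N\<close>, bounds the energy of the limit law. The
  truncated bound also shows that no mass escapes, which makes the weak limit a probability measure
  on \<open>K\<close>.\<close>

lemma limit_measure:
  fixes x :: "nat \<Rightarrow> nat \<Rightarrow> complex" and m :: "nat \<Rightarrow> nat"
  assumes x: "\<And>n j. j \<in> {1..m n} \<Longrightarrow> x n j \<in> K"
    and m: "\<And>n. 2 \<le> m n" "filterlim m at_top sequentially"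
    and le: "\<And>n. pair_mean wkernel (m n) (x n) \<le> ennreal (d n)" and d: "d \<longlonglongrightarrow> c'" "\<And>n. 0 \<le> d n"
  obtains s \<nu> where "strict_mono s" "\<nu> \<in> probs_on K" "energy \<nu> \<le> ennreal c'"
    "\<And>f :: complex \<Rightarrow> real. continuous_on K f \<Longrightarrow> bounded (f ` K) \<Longrightarrow>
      (\<lambda>n. \<integral>z. f z \<partial>empirical K (m (s n)) (x (s n))) \<longlonglongrightarrow> (\<integral>z. f z \<partial>\<nu>)"
proof -
  have m0: "0 < m n" for n using m(1)[of n] by simp
  define c where "c = ennreal c'"
  have c': "0 \<le> c'" "c = ennreal c'"
    using LIMSEQ_le_const[OF d(1)] d(2) by (auto simp: c_def)
  obtain s :: "nat \<Rightarrow> nat" and \<Omega> :: "real measure" and Z Zn B where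
    s: "strict_mono s" and \<Omega>: "prob_space \<Omega>" and Zn [measurable]: "\<And>n. Zn n \<in> borel_measurable \<Omega>"
    and Z [measurable]: "Z \<in> borel_measurable \<Omega>" and B [measurable]: "B \<in> sets \<Omega>"
    and D: "\<And>n. distr \<Omega> borel (Zn n) = distr (measure_pmf (pmf_of_set {1..m (s n)})) borel (x (s n))"
    and esc: "AE \<omega> in \<Omega>. \<omega> \<in> B \<longrightarrow> filterlim (\<lambda>n. Zn n \<omega>) at_infinity sequentially"
    and lim: "AE \<omega> in \<Omega>. \<omega> \<notin> B \<longrightarrow> (\<lambda>n. Zn n \<omega>) \<longlonglongrightarrow> Z \<omega>"
    by (rule empirical_measures_subsequence[of m x]) (rule m0, rule that)
  interpret \<Omega>: prob_space \<Omega> by (rule \<Omega>)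
  let ?k = "\<lambda>n. m (s n)"
  have ne: "{1..?k n} \<noteq> {}" for n using m0[of "s n"] by auto
  have nn: "(\<integral>\<^sup>+\<omega>. G (Zn n \<omega>) \<partial>\<Omega>) = ennreal (1 / real (?k n)) * (\<Sum>j\<in>{1..?k n}. G (x (s n) j))"
    if G: "G \<in> borel_measurable borel" for G n
  proof -
    have "(\<integral>\<^sup>+\<omega>. G (Zn n \<omega>) \<partial>\<Omega>) = (\<integral>\<^sup>+z. G z \<partial>distr \<Omega> borel (Zn n))"
      using G by (subst nn_integral_distr) auto
    also have "\<dots> = (\<integral>\<^sup>+j. G (x (s n) j) \<partial>measure_pmf (pmf_of_set {1..?k n}))"
      unfolding D using G by (subst nn_integral_distr) auto
    also have "\<dots> = (\<Sum>j\<in>{1..?k n}. G (x (s n) j)) / of_nat (?k n)"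
      using ne[of n] by (subst nn_integral_pmf_of_set) auto
    also have "\<dots> = ennreal (1 / real (?k n)) * (\<Sum>j\<in>{1..?k n}. G (x (s n) j))"
      using m0[of "s n"]
      by (simp add: divide_ennreal_def ennreal_of_nat_eq_real_of_nat inverse_ennreal inverse_eq_divide mult.commute)
    finally show ?thesis .
  qed
  have in_K: "AE \<omega> in \<Omega>. \<forall>n. Zn n \<omega> \<in> K"
    unfolding AE_all_countable
  proof
    fix n
    have "AE z in distr (measure_pmf (pmf_of_set {1..?k n})) borel (x (s n)). z \<in> K"
      using ne[of n] x closed_K by (subst AE_distr_iff) (auto simp: AE_measure_pmf_iff borel_closed)
    then show "AE \<omega> in \<Omega>. Zn n \<omega> \<in> K"
      unfolding D[symmetric] using closed_K by (subst (asm) AE_distr_iff) (auto simp: borel_closed)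
  qed
  \<comment> \<open>Integrating over two independent copies averages over all \<open>k^2\<close>
    ordered pairs, coinciding ones included.\<close>
  define T where "T N n = (\<integral>\<^sup>+\<omega>. \<integral>\<^sup>+\<omega>'. min (of_nat N) (wkernel (Zn n \<omega>) (Zn n \<omega>')) \<partial>\<Omega> \<partial>\<Omega>)" for N n :: nat
  have wkernel_meas: "(\<lambda>p. wkernel (f (fst p)) (g (snd p))) \<in> borel_measurable (\<Omega> \<Otimes>\<^sub>M \<Omega>)"
    if [measurable]: "f \<in> borel_measurable \<Omega>" "g \<in> borel_measurable \<Omega>" for f g
  proof -
    have "(\<lambda>p. (f (fst p), g (snd p))) \<in> measurable (\<Omega> \<Otimes>\<^sub>M \<Omega>) (borel \<Otimes>\<^sub>M borel)" by measurable
    from measurable_compose[OF this borel_measurable_wkernel] show ?thesis by simp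
  qed
  have T_le: "T N n \<le> ennreal (d (s n)) + ennreal (real N / real (?k n))" for N n
  proof -
    let ?a = "ennreal (1 / real (?k n))" and ?S = "pair_sum wkernel (?k n) (x (s n))"
    have "T N n = (\<integral>\<^sup>+\<omega>. ?a * (\<Sum>j\<in>{1..?k n}. min (of_nat N) (wkernel (Zn n \<omega>) (x (s n) j))) \<partial>\<Omega>)"
      unfolding T_def
      by (intro nn_integral_cong nn borel_measurable_min borel_measurable_wkernel_right) auto
    also have "\<dots> = ?a * (\<Sum>i\<in>{1..?k n}. ?a * (\<Sum>j\<in>{1..?k n}. min (of_nat N) (wkernel (x (s n) i) (x (s n) j))))"
      by (intro nn borel_measurable_times_ennreal borel_measurable_sum borel_measurable_min borel_measurable_wkernel_left) auto
    also have "\<dots> = (?a * ?a) * (\<Sum>i\<in>{1..?k n}. \<Sum>j\<in>{1..?k n}. min (of_nat N) (wkernel (x (s n) i) (x (s n) j)))"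
      by (simp only: sum_distrib_left[symmetric] mult.assoc)
    also have "\<dots> \<le> (?a * ?a) * (2 * ?S + of_nat (?k n) * of_nat N)"
      by (intro mult_left_mono double_sum_min_le) auto
    also have "\<dots> = (?a * ?a * 2) * ?S + (?a * ?a * of_nat (?k n) * of_nat N)"
      by (simp only: distrib_left mult.assoc)
    also have "?a * ?a * of_nat (?k n) * of_nat N = ennreal (real N / real (?k n))"
      using m0[of "s n"]
      by (simp add: ennreal_of_nat_eq_real_of_nat ennreal_mult[symmetric])
    \<comment> \<open>The normalisation changes from all ordered pairs to distinct ones:
      \<open>1 / k^2 \<le> 1 / (k * (k - 1))\<close>.\<close>
    also have "?a * ?a * 2 \<le> ennreal (2 / (real (?k n) * (real (?k n) - 1)))"
    proof -
      have "?a * ?a * 2 = ennreal (2 / (real (?k n) * real (?k n)))"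
        by (simp add: ennreal_mult[symmetric] flip: ennreal_numeral)
      also have "\<dots> \<le> ennreal (2 / (real (?k n) * (real (?k n) - 1)))"
        using m(1)[of "s n"] by (intro ennreal_leI divide_left_mono mult_left_mono mult_pos_pos) auto
      finally show ?thesis .
    qed
    finally have "T N n \<le> pair_mean wkernel (?k n) (x (s n)) + ennreal (real N / real (?k n))"
      by (simp add: pair_mean_def mult_right_mono add_right_mono)
    also have "\<dots> \<le> ennreal (d (s n)) + ennreal (real N / real (?k n))"
      by (intro add_right_mono le)
    finally show ?thesis .
  qed
  have liminf_T: "liminf (T N) \<le> c" for N
  proof -
    have "filterlim (\<lambda>n. real (?k n)) at_top sequentially"
      by (rule filterlim_compose[OF filterlim_real_sequentially
            filterlim_compose[OF m(2) filterlim_subseq[OF s]]])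
    then have "(\<lambda>n. d (s n) + real N / real (?k n)) \<longlonglongrightarrow> c' + 0"
      using LIMSEQ_subseq_LIMSEQ[OF d(1) s, unfolded comp_def]
      by (intro tendsto_add real_tendsto_divide_at_top[OF tendsto_const])
    then have "(\<lambda>n. ennreal (d (s n) + real N / real (?k n))) \<longlonglongrightarrow> ennreal c'"
      by (intro tendsto_ennrealI) simp
    then have "liminf (\<lambda>n. ennreal (d (s n) + real N / real (?k n))) = c"
      using c' by (simp add: lim_imp_Liminf)
    moreover have "liminf (T N) \<le> liminf (\<lambda>n. ennreal (d (s n) + real N / real (?k n)))"
      using T_le[of N] d(2) by (intro Liminf_mono) (auto intro!: always_eventually)
    ultimately show ?thesis by simp
  qed
  have fatou: "(\<integral>\<^sup>+\<omega>. \<integral>\<^sup>+\<omega>'. min (of_nat N) (liminf (\<lambda>n. wkernel (Zn n \<omega>) (Zn n \<omega>'))) \<partial>\<Omega> \<partial>\<Omega>) \<le> c" for N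
  proof -
    have "(\<integral>\<^sup>+\<omega>. \<integral>\<^sup>+\<omega>'. min (of_nat N) (liminf (\<lambda>n. wkernel (Zn n \<omega>) (Zn n \<omega>'))) \<partial>\<Omega> \<partial>\<Omega>)
      \<le> (\<integral>\<^sup>+\<omega>. \<integral>\<^sup>+\<omega>'. liminf (\<lambda>n. min (of_nat N) (wkernel (Zn n \<omega>) (Zn n \<omega>'))) \<partial>\<Omega> \<partial>\<Omega>)"
      by (intro nn_integral_mono min_liminf_le)
    also have "\<dots> \<le> liminf (T N)"
      unfolding T_def by (intro \<Omega>.nn_integral_liminf2 borel_measurable_min wkernel_meas) auto
    finally show ?thesis using liminf_T by (rule order_trans)
  qed
  \<comment> \<open>If \<open>B\<close> had probability \<open>p > 0\<close>, two independent
    escaping points would have infinite limiting interaction with probability at least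
    \<open>p^2\<close>, so \<open>N * p^2 \<le> c'\<close> for every \<open>N\<close>.\<close>
  have B0: "emeasure \<Omega> B = 0"
  proof (rule ccontr)
    assume "emeasure \<Omega> B \<noteq> 0"
    then have p: "0 < measure \<Omega> B" by (simp add: \<Omega>.emeasure_eq_measure zero_less_measure_iff)
    have "real N * (measure \<Omega> B * measure \<Omega> B) \<le> c'" for N
    proof -
      have "of_nat N * (emeasure \<Omega> B * emeasure \<Omega> B) =
          (\<integral>\<^sup>+\<omega>. \<integral>\<^sup>+\<omega>'. of_nat N * indicator B \<omega> * indicator B \<omega>' \<partial>\<Omega> \<partial>\<Omega>)"
        by (simp add: nn_integral_cmult nn_integral_multc mult.assoc)
      also have "\<dots> \<le> (\<integral>\<^sup>+\<omega>. \<integral>\<^sup>+\<omega>'. min (of_nat N) (liminf (\<lambda>n. wkernel (Zn n \<omega>) (Zn n \<omega>'))) \<partial>\<Omega> \<partial>\<Omega>)"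
      proof (rule nn_integral_mono_AE)
        let ?l = "\<lambda>\<omega> \<omega>'. of_nat N * indicator B \<omega> * indicator B \<omega>' :: ennreal"
          and ?r = "\<lambda>\<omega> \<omega>'. min (of_nat N) (liminf (\<lambda>n. wkernel (Zn n \<omega>) (Zn n \<omega>')))"
        show "AE \<omega> in \<Omega>. (\<integral>\<^sup>+\<omega>'. ?l \<omega> \<omega>' \<partial>\<Omega>) \<le> (\<integral>\<^sup>+\<omega>'. ?r \<omega> \<omega>' \<partial>\<Omega>)"
          using esc
        proof eventually_elim
          case (elim \<omega>)
          note \<omega> = this
          have "AE \<omega>' in \<Omega>. ?l \<omega> \<omega>' \<le> ?r \<omega> \<omega>'"
            using esc
          proof eventually_elim
            case (elim \<omega>')
          show ?case
          proof (cases "\<omega> \<in> B \<and> \<omega>' \<in> B")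
            case True
            have "(\<lambda>n. sph (Zn n \<omega>) (Zn n \<omega>')) \<longlonglongrightarrow> 1"
              using True \<omega> elim by (intro sph_tendsto_at_infinity) auto
            then have "\<top> \<le> liminf (\<lambda>n. ell (sph (Zn n \<omega>) (Zn n \<omega>')))"
              using ell_lsc by (fastforce simp: ell_1)
            also have "\<dots> \<le> liminf (\<lambda>n. wkernel (Zn n \<omega>) (Zn n \<omega>'))"
              by (intro Liminf_mono always_eventually) (auto simp: wkernel_def)
            finally show ?thesis using True by (simp add: top_unique)
          qed auto
          qed
          then show ?case by (rule nn_integral_mono_AE)
        qed
      qed
      also have "\<dots> \<le> c" by (rule fatou)
      finally have "ennreal (real N * (measure \<Omega> B * measure \<Omega> B)) \<le> ennreal c'"
        by (simp add: \<Omega>.emeasure_eq_measure ennreal_of_nat_eq_real_of_nat ennreal_mult c')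
      then show ?thesis using c' by simp
    qed
    moreover obtain N where "c' < real N * (measure \<Omega> B * measure \<Omega> B)"
      using reals_Archimedean3[of "measure \<Omega> B * measure \<Omega> B"] p by auto
    ultimately show False by (meson not_le)
  qed
  have lim': "AE \<omega> in \<Omega>. (\<lambda>n. Zn n \<omega>) \<longlonglongrightarrow> Z \<omega>"
  proof -
    have "AE \<omega> in \<Omega>. \<omega> \<notin> B" using B0 by (intro AE_I[of _ _ B]) auto
    with lim show ?thesis by eventually_elim auto
  qed
  have Z_K: "AE \<omega> in \<Omega>. Z \<omega> \<in> K"
    using in_K lim'
    by eventually_elim (use closed_K in \<open>auto intro: closed_sequentially\<close>)
  define M where "M = distr \<Omega> borel Z"
  have M: "borel_prob M" unfolding M_def by (rule borel_prob_distr[OF \<Omega> Z])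
  have M_K: "AE z in M. z \<in> K"
    unfolding M_def using Z_K closed_K by (subst AE_distr_iff) (auto simp: borel_closed)
  define \<nu> where "\<nu> = restrict_space M K"
  have min_le: "(\<integral>\<^sup>+\<omega>. \<integral>\<^sup>+\<omega>'. min (of_nat N) (wkernel (Z \<omega>) (Z \<omega>')) \<partial>\<Omega> \<partial>\<Omega>) \<le> c" for N
  proof -
    have "(\<integral>\<^sup>+\<omega>. \<integral>\<^sup>+\<omega>'. min (of_nat N) (wkernel (Z \<omega>) (Z \<omega>')) \<partial>\<Omega> \<partial>\<Omega>) \<le>
      (\<integral>\<^sup>+\<omega>. \<integral>\<^sup>+\<omega>'. min (of_nat N) (liminf (\<lambda>n. wkernel (Zn n \<omega>) (Zn n \<omega>'))) \<partial>\<Omega> \<partial>\<Omega>)"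
    proof (rule nn_integral_mono_AE)
      let ?l = "\<lambda>\<omega> \<omega>'. min (of_nat N) (wkernel (Z \<omega>) (Z \<omega>'))"
        and ?r = "\<lambda>\<omega> \<omega>'. min (of_nat N) (liminf (\<lambda>n. wkernel (Zn n \<omega>) (Zn n \<omega>')))"
      show "AE \<omega> in \<Omega>. (\<integral>\<^sup>+\<omega>'. ?l \<omega> \<omega>' \<partial>\<Omega>) \<le> (\<integral>\<^sup>+\<omega>'. ?r \<omega> \<omega>' \<partial>\<Omega>)"
        using lim'
      proof eventually_elim
        case (elim \<omega>)
        note \<omega> = this
        have "AE \<omega>' in \<Omega>. ?l \<omega> \<omega>' \<le> ?r \<omega> \<omega>'"
          using lim' by eventually_elim (intro min.mono order_refl wkernel_lsc \<omega>)
        then show ?case by (rule nn_integral_mono_AE)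
      qed
    qed
    also have "\<dots> \<le> c" by (rule fatou)
    finally show ?thesis .
  qed
  have nn_M: "(\<integral>\<^sup>+z. h z \<partial>M) = (\<integral>\<^sup>+\<omega>. h (Z \<omega>) \<partial>\<Omega>)" if "h \<in> borel_measurable borel" for h
    unfolding M_def using that Z by (subst nn_integral_distr) auto
  have "energy \<nu> = energy M" unfolding \<nu>_def by (rule energy_restrict[OF M M_K])
  also have "\<dots> = (\<integral>\<^sup>+\<omega>. \<integral>\<^sup>+t. wkernel (Z \<omega>) t \<partial>M \<partial>\<Omega>)"
    unfolding energy_def by (rule nn_M[OF nn_integral_wkernel_measurable[OF M]])
  also have "\<dots> = (\<integral>\<^sup>+\<omega>. \<integral>\<^sup>+\<omega>'. wkernel (Z \<omega>) (Z \<omega>') \<partial>\<Omega> \<partial>\<Omega>)"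
    by (intro nn_integral_cong nn_M borel_measurable_wkernel_right)
  also have "\<dots> \<le> (\<integral>\<^sup>+\<omega>. \<integral>\<^sup>+\<omega>'. liminf (\<lambda>N. min (of_nat N) (wkernel (Z \<omega>) (Z \<omega>'))) \<partial>\<Omega> \<partial>\<Omega>)"
    by (intro nn_integral_mono le_liminf_min_of_nat)
  also have "\<dots> \<le> liminf (\<lambda>N. \<integral>\<^sup>+\<omega>. \<integral>\<^sup>+\<omega>'. min (of_nat N) (wkernel (Z \<omega>) (Z \<omega>')) \<partial>\<Omega> \<partial>\<Omega>)"
    by (intro \<Omega>.nn_integral_liminf2 borel_measurable_min wkernel_meas) auto
  also have "\<dots> \<le> c"
    using Liminf_mono[of _ "\<lambda>_. c" sequentially] min_le by (auto simp: Liminf_const)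
  finally have energy_le: "energy \<nu> \<le> ennreal c'" by (simp only: c'(2))
  have conv: "(\<lambda>n. \<integral>z. f z \<partial>empirical K (?k n) (x (s n))) \<longlonglongrightarrow> (\<integral>z. f z \<partial>\<nu>)"
    if f: "continuous_on K f" "bounded (f ` K)" for f :: "complex \<Rightarrow> real"
  proof -
    obtain b where b: "\<And>z. z \<in> K \<Longrightarrow> \<bar>f z\<bar> \<le> b" using f(2) by (auto simp: bounded_iff)
    \<comment> \<open>All variables stay in \<open>K\<close> almost surely, so extending
      \<open>f\<close> by \<open>0\<close> does no harm although it may create a jump at the
      boundary of \<open>K\<close>.\<close>
    define F where "F z = indicator K z * f z" for z
    have F [measurable]: "F \<in> borel_measurable borel"
      using borel_measurable_continuous_on_indicator[OF _ f(1)] closed_K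
      by (simp add: F_def[abs_def] borel_closed)
    have "(\<lambda>n. \<integral>\<omega>. F (Zn n \<omega>) \<partial>\<Omega>) \<longlonglongrightarrow> (\<integral>\<omega>. F (Z \<omega>) \<partial>\<Omega>)"
    proof (rule integral_dominated_convergence[where w = "\<lambda>_. b"])
      show "AE \<omega> in \<Omega>. (\<lambda>n. F (Zn n \<omega>)) \<longlonglongrightarrow> F (Z \<omega>)"
        using in_K lim' Z_K
      proof eventually_elim
        case (elim \<omega>)
        then have "(\<lambda>n. f (Zn n \<omega>)) \<longlonglongrightarrow> f (Z \<omega>)"
          by (intro continuous_on_tendsto_compose[OF f(1)]) auto
        then show ?case using elim by (simp add: F_def)
      qed
      show "AE \<omega> in \<Omega>. norm (F (Zn n \<omega>)) \<le> b" for n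
        using in_K by eventually_elim (use b in \<open>auto simp: F_def\<close>)
    qed auto
    moreover have "(\<integral>\<omega>. F (Zn n \<omega>) \<partial>\<Omega>) = (\<integral>z. f z \<partial>empirical K (?k n) (x (s n)))" for n
    proof -
      have "(\<integral>\<omega>. F (Zn n \<omega>) \<partial>\<Omega>) = (\<integral>z. F z \<partial>distr \<Omega> borel (Zn n))"
        by (subst integral_distr) auto
      also have "\<dots> = (\<integral>j. F (x (s n) j) \<partial>measure_pmf (pmf_of_set {1..?k n}))"
        unfolding D by (subst integral_distr) auto
      also have "\<dots> = (\<Sum>j\<in>{1..?k n}. F (x (s n) j)) / real (?k n)"
        using ne[of n] by (subst integral_pmf_of_set) auto
      also have "(\<Sum>j\<in>{1..?k n}. F (x (s n) j)) = (\<Sum>j\<in>{1..?k n}. f (x (s n) j))"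
        using x by (intro sum.cong) (auto simp: F_def)
      also have "\<dots> / real (?k n) = (\<integral>z. f z \<partial>empirical K (?k n) (x (s n)))"
        by (rule integral_empirical[symmetric]) (use m0 x f in auto)
      finally show ?thesis .
    qed
    moreover have "(\<integral>\<omega>. F (Z \<omega>) \<partial>\<Omega>) = (\<integral>z. f z \<partial>\<nu>)"
      unfolding \<nu>_def restrict_probs_on(3)[OF M closed_K M_K] F_def[symmetric]
      unfolding M_def by (rule integral_distr[symmetric]) auto
    ultimately show ?thesis by simp
  qed
  show thesis
    by (rule that[OF s _ energy_le conv]) (auto simp: \<nu>_def intro!: restrict_probs_on(1)[OF M closed_K M_K])
qed

end

subsection \<open>The theorem\<close>

lemma eventually_lsc_on:
  assumes "lsc_on K Q" "z \<in> K" "c < Q z"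
  shows "\<forall>\<^sub>F t in nhds z. t \<in> K \<longrightarrow> c < Q t"
proof -
  have "\<forall>\<^sub>F t in at z within K. c < Q t"
    using assms unfolding lsc_on_def by blast
  then show ?thesis
    unfolding eventually_at_filter by eventually_elim (use assms(3) in auto)
qed

lemma lsc_on_bounded_below:
  assumes lsc: "lsc_on K Q" and Q: "\<And>z. z \<in> K \<Longrightarrow> Q z \<noteq> -\<infinity>" and S: "compact S" "S \<subseteq> K"
  obtains b :: real where "\<And>z. z \<in> S \<Longrightarrow> ereal b \<le> Q z"
proof -
  have "\<exists>b::real. \<forall>z\<in>S. ereal b \<le> Q z"
  proof (rule ccontr)
    assume "\<not> ?thesis"
    then have "\<forall>n::nat. \<exists>z\<in>S. Q z < ereal (- real n)" by (auto simp: not_le)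
    then obtain z where z: "\<And>n. z n \<in> S" "\<And>n. Q (z n) < ereal (- real n)" by metis
    obtain l s where l: "l \<in> S" "strict_mono (s :: nat \<Rightarrow> nat)" "(z \<circ> s) \<longlonglongrightarrow> l"
      using S(1) z(1) unfolding compact_def by metis
    have lK: "l \<in> K" using l(1) S(2) by auto
    then obtain c where "ereal c < Q l"
      using Q[of l] by (metis ereal_dense2 ereal_infty_less(2))
    then have "\<forall>\<^sub>F n in sequentially. z (s n) \<in> K \<longrightarrow> ereal c < Q (z (s n))"
      using eventually_compose_filterlim[OF eventually_lsc_on[OF lsc lK] l(3)] by simp
    moreover have "\<forall>\<^sub>F n in sequentially. - c \<le> real n"
      by (rule eventually_ge_at_top[of "nat \<lceil>- c\<rceil>", THEN eventually_mono]) linarith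
    ultimately have "\<forall>\<^sub>F n in sequentially. False"
    proof eventually_elim
      case (elim n)
      have "ereal c < Q (z (s n))" using elim(1) z(1) S(2) by blast
      also have "\<dots> < ereal (- real (s n))" by (rule z(2))
      finally show ?case using elim(2) seq_suble[OF l(2), of n] by simp
    qed
    then show False by simp
  qed
  then show thesis using that by blast
qed

lemma weakly_admissible_imp_weighted_set:
  assumes K: "closed K" and Q: "weakly_admissible K Q"
  obtains C where "weighted_set K Q C"
proof -
  have lsc: "lsc_on K Q" and Q_ne: "\<And>z. z \<in> K \<Longrightarrow> Q z \<noteq> -\<infinity>"
    using Q by (auto simp: weakly_admissible_def)
  have "\<exists>R c. \<forall>z\<in>K. R < cmod z \<longrightarrow> ereal (ln (1 + (cmod z)\<^sup>2) / 2 - c) \<le> Q z"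
  proof (cases "bounded K")
    case True
    then obtain R where "\<forall>z\<in>K. cmod z \<le> R" by (auto simp: bounded_iff)
    then show ?thesis by (intro exI[of _ R]) force
  next
    case False
    let ?F = "inf at_infinity (principal K)"
    have "\<bar>Liminf ?F (\<lambda>z. Q z - ereal (ln (cmod z)))\<bar> \<noteq> \<infinity>"
      using False Q by (auto simp: weakly_admissible_def)
    then obtain c' where "Liminf ?F (\<lambda>z. Q z - ereal (ln (cmod z))) = ereal c'"
      by (cases "Liminf ?F (\<lambda>z. Q z - ereal (ln (cmod z)))") auto
    then have "ereal (c' - 1) < Liminf ?F (\<lambda>z. Q z - ereal (ln (cmod z)))" by simp
    then obtain c where "ereal c < Liminf ?F (\<lambda>z. Q z - ereal (ln (cmod z)))" by blast
    then have "\<forall>\<^sub>F z in ?F. ereal c < Q z - ereal (ln (cmod z))"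
      by (rule less_LiminfD)
    then have "\<forall>\<^sub>F z in at_infinity. z \<in> K \<longrightarrow> ereal c < Q z - ereal (ln (cmod z))"
      by (simp add: eventually_inf_principal)
    then obtain R where R: "\<And>z. R \<le> cmod z \<Longrightarrow> z \<in> K \<Longrightarrow> ereal c < Q z - ereal (ln (cmod z))"
      by (auto simp: eventually_at_infinity)
    \<comment> \<open>The constant \<open>ln 2 / 2\<close> comes from
      \<open>1 + r^2 \<le> 2 * r^2\<close> for \<open>r \<ge> 1\<close>.\<close>
    have "ereal (ln (1 + (cmod z)\<^sup>2) / 2 - (ln 2 / 2 - c)) \<le> Q z" if z: "z \<in> K" "max R 1 < cmod z" for z
    proof -
      have "0 < cmod z" using z(2) by linarith
      have "1 \<le> (cmod z)\<^sup>2" using z(2) by (simp add: one_le_power)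
      then have "ln (1 + (cmod z)\<^sup>2) \<le> ln (2 * (cmod z)\<^sup>2)"
        by (intro ln_mono) simp_all
      also have "\<dots> = ln 2 + 2 * ln (cmod z)" using \<open>0 < cmod z\<close> by (simp add: ln_mult ln_realpow)
      finally have "ln (1 + (cmod z)\<^sup>2) / 2 - (ln 2 / 2 - c) \<le> c + ln (cmod z)" by simp
      moreover have "ereal (c + ln (cmod z)) \<le> Q z"
        using R[of z] z by (cases "Q z") auto
      ultimately show ?thesis by (meson ereal_less_eq(3) order_trans)
    qed
    then show ?thesis by blast
  qed
  then obtain R c where out: "\<And>z. z \<in> K \<Longrightarrow> R < cmod z \<Longrightarrow> ereal (ln (1 + (cmod z)\<^sup>2) / 2 - c) \<le> Q z"
    by blast
  obtain b where b: "\<And>z. z \<in> K \<inter> cball 0 R \<Longrightarrow> ereal b \<le> Q z"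
    by (rule lsc_on_bounded_below[OF lsc Q_ne, of "K \<inter> cball 0 R"]) (use K in auto)
  \<comment> \<open>The three entries serve nonnegativity, the points outside the ball and the
    points inside it.\<close>
  define C where "C = max 0 (max c (ln (1 + R\<^sup>2) / 2 - b))"
  have "ereal (ln (1 + (cmod z)\<^sup>2) / 2 - C) \<le> Q z" if z: "z \<in> K" for z
  proof (cases "R < cmod z")
    case True
    have "ereal (ln (1 + (cmod z)\<^sup>2) / 2 - C) \<le> ereal (ln (1 + (cmod z)\<^sup>2) / 2 - c)"
      by (simp add: C_def)
    then show ?thesis using out[OF z True] by (rule order_trans)
  next
    case False
    then have "(cmod z)\<^sup>2 \<le> R\<^sup>2" by (intro power_mono) auto
    then have "ln (1 + (cmod z)\<^sup>2) \<le> ln (1 + R\<^sup>2)" by (simp add: add_pos_nonneg)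
    then have "ereal (ln (1 + (cmod z)\<^sup>2) / 2 - C) \<le> ereal b" by (simp add: C_def)
    also have "\<dots> \<le> Q z" using b[of z] False z by simp
    finally show ?thesis .
  qed
  then have "weighted_set K Q C"
    using K lsc by unfold_locales (auto simp: C_def)
  then show thesis by (rule that)
qed

text \<open>As \<open>psi C\<close> is at most \<open>exp (2 * C)\<close>, the bound in the first
  claim is a nonnegative real, which \<open>ennreal\<close> does not cut off.\<close>

lemma le_psiD:
  assumes "0 < y" "y \<le> psi C a"
  shows "a \<le> ennreal (2 * C - ln y)" "0 \<le> 2 * C - ln y"
proof -
  have "psi C a \<le> exp (2 * C)"
    using psi_mono[of 0 a C] by (simp add: psi_def)
  then have "ln y \<le> ln (exp (2 * C))" using assms by (intro ln_mono) auto
  then show "0 \<le> 2 * C - ln y" by simp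
  then have "psi C (ennreal (2 * C - ln y)) = y" using assms by (simp add: psi_ennreal)
  with assms(2) show "a \<le> ennreal (2 * C - ln y)" by (metis psi_le_iff)
qed

section \<open>Existence of the minimizer and limits of near-optimal points\<close>

context weighted_set
begin

text \<open>A minimizing sequence of measures is traded for finite configurations with almost the
  same mean interaction, so that \<open>limit_measure\<close> supplies the compactness.\<close>

lemma minimizer_exists:
  assumes fin: "\<exists>\<nu>\<in>probs_on K. energy \<nu> < \<infinity>"
  obtains \<nu> where "\<nu> \<in> probs_on K" "energy \<nu> < \<infinity>" "\<And>\<rho>. \<rho> \<in> probs_on K \<Longrightarrow> energy \<nu> \<le> energy \<rho>"
proof -
  define V where "V = (INF \<mu>\<in>probs_on K. energy \<mu>)"
  have "V < \<infinity>" using fin unfolding V_def by (meson INF_lower le_less_trans)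
  then obtain v where v: "0 \<le> v" "V = ennreal v" by (cases V rule: ennreal_cases) auto
  \<comment> \<open>\<open>n + 2\<close> points, since a mean over pairs needs at least two.\<close>
  have "\<exists>x. (\<forall>j\<in>{1..n + 2}. x j \<in> K) \<and> pair_mean wkernel (n + 2) x \<le> ennreal (v + 1 / real (Suc n))" for n
  proof -
    have "V < ennreal (v + 1 / real (Suc n))"
      unfolding v(2) using v(1) by (intro ennreal_lessI) (auto simp: add_nonneg_pos)
    then obtain \<mu> where \<mu>: "\<mu> \<in> probs_on K" "energy \<mu> < ennreal (v + 1 / real (Suc n))"
      unfolding V_def by (auto simp: INF_less_iff)
    interpret prob_space \<mu> by (rule probs_onD(1)[OF \<mu>(1)])
    have "2 \<le> n + 2" by simp
    from exists_pair_mean_le[OF probs_onD(5)[OF \<mu>(1) borel_measurable_wkernel] this]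
    obtain x where "\<forall>j\<in>{1..n + 2}. x j \<in> K" "pair_mean wkernel (n + 2) x \<le> energy \<mu>"
      unfolding energy_def probs_onD(3)[OF \<mu>(1)] by auto
    then show ?thesis using \<mu>(2) by (meson le_less_trans less_imp_le)
  qed
  then obtain x where x: "\<And>n j. j \<in> {1..n + 2} \<Longrightarrow> x n j \<in> K"
    "\<And>n. pair_mean wkernel (n + 2) (x n) \<le> ennreal (v + 1 / real (Suc n))" by metis
  have d: "(\<lambda>n. v + 1 / real (Suc n)) \<longlonglongrightarrow> v"
    using tendsto_add[OF tendsto_const[of v] LIMSEQ_Suc[OF lim_inverse_n']] by simp
  obtain s \<nu> where "\<nu> \<in> probs_on K" "energy \<nu> \<le> ennreal v"
    by (rule limit_measure[OF x(1) _ _ x(2) d])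
       (use v in \<open>auto intro!: filterlim_subseq strict_monoI\<close>)
  moreover have "V \<le> energy \<rho>" if "\<rho> \<in> probs_on K" for \<rho>
    unfolding V_def using that by (rule INF_lower)
  ultimately show thesis
    using that[of \<nu>] v(2) by (metis ennreal_less_top infinity_ennreal_def le_less_trans order_trans)
qed

lemma weak_limit_unique:
  assumes \<mu>: "\<mu> \<in> probs_on K" and \<nu>: "\<nu> \<in> probs_on K"
    and eq: "\<And>f :: complex \<Rightarrow> real. continuous_on K f \<Longrightarrow> bounded (f ` K) \<Longrightarrow> (\<integral>z. f z \<partial>\<mu>) = (\<integral>z. f z \<partial>\<nu>)"
  shows "\<mu> = \<nu>"
proof -
  have "to_borel \<mu> = to_borel \<nu>"
  proof (rule borel_prob_eqI_continuous[OF borel_prob_to_borel[OF \<mu>] borel_prob_to_borel[OF \<nu>]])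
    fix f :: "complex \<Rightarrow> real" assume f: "continuous_on UNIV f" "\<And>x. \<bar>f x\<bar> \<le> 1"
    have fm: "f \<in> borel_measurable borel" by (rule borel_measurable_continuous_onI[OF f(1)])
    have "(\<integral>z. f z \<partial>\<mu>) = (\<integral>z. f z \<partial>\<nu>)"
      by (rule eq) (use f in \<open>auto intro: continuous_on_subset simp: bounded_iff\<close>)
    then show "(\<integral>z. f z \<partial>to_borel \<mu>) = (\<integral>z. f z \<partial>to_borel \<nu>)"
      unfolding to_borel_def by (simp add: integral_distr[OF measurable_ident_probs_on fm] \<mu> \<nu>)
  qed
  then show ?thesis by (rule to_borel_inject[OF \<mu> \<nu>])
qed

text \<open>Convergence is asked of the lower bounds \<open>y\<close> and not of the roots, so that
  a constant \<open>y\<close> can serve in arguments about upper limits.\<close>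

lemma limit_of_large_VDM_root:
  fixes x :: "nat \<Rightarrow> nat \<Rightarrow> complex"
  assumes x: "\<And>n j. j \<in> {1..m n} \<Longrightarrow> x n j \<in> K" and m: "\<And>n. 2 \<le> m n" "strict_mono m"
    and y: "\<And>n. 0 < y n" "\<And>n. y n \<le> VDM_root Q (m n) (x n)" "y \<longlonglongrightarrow> l" "0 < l"
  obtains s \<nu> where "strict_mono s" "\<nu> \<in> probs_on K" "energy \<nu> \<le> ennreal (2 * C - ln l)"
    "\<And>f :: complex \<Rightarrow> real. continuous_on K f \<Longrightarrow> bounded (f ` K) \<Longrightarrow>
      (\<lambda>n. \<integral>z. f z \<partial>empirical K (m (s n)) (x (s n))) \<longlonglongrightarrow> (\<integral>z. f z \<partial>\<nu>)"
proof -
  have le: "y n \<le> psi C (pair_mean wkernel (m n) (x n))" for n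
    using y(2)[of n] VDM_root_eq[OF m(1) x] by simp
  have d: "(\<lambda>n. 2 * C - ln (y n)) \<longlonglongrightarrow> 2 * C - ln l"
    using y(3,4) by (intro tendsto_intros) auto
  show thesis
    by (rule limit_measure[OF x m(1) filterlim_subseq[OF m(2)] le_psiD(1)[OF y(1) le] d le_psiD(2)[OF y(1) le]])
       (assumption, rule that)
qed

end

theorem theorem3p7:
  fixes K :: "complex set" and Q :: "complex \<Rightarrow> ereal"
  assumes "closed K" and "\<not> polar K" and "weakly_admissible K Q"
  shows "(\<forall>k\<ge>2. diamQ Q K k < \<infinity>)
    \<and> (\<forall>(x :: nat \<Rightarrow> nat \<Rightarrow> complex) \<mu>.
          (\<forall>k\<ge>2. \<forall>j\<in>{1..k}. x k j \<in> K) \<and> \<mu> \<in> probs_on K \<and>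
          weak_conv_on K (\<lambda>k. empirical K k (x k)) \<mu>
          \<longrightarrow> limsup (\<lambda>k. ereal (VDM_root Q k (x k))) \<le> exp_neg_ereal (energyQ Q \<mu>))
    \<and> ((\<lambda>k. diamQ Q K k) \<longlonglongrightarrow> exp_neg_ereal (V_w K Q))
    \<and> (\<forall>x :: nat \<Rightarrow> nat \<Rightarrow> complex.
          (\<forall>k\<ge>2. \<forall>j\<in>{1..k}. x k j \<in> K) \<and>
          ((\<lambda>k. ereal (VDM_root Q k (x k))) \<longlonglongrightarrow> exp_neg_ereal (V_w K Q))
          \<longrightarrow> weak_conv_on K (\<lambda>k. empirical K k (x k)) (mu_KQ K Q))"
proof -
  obtain C where "weighted_set K Q C"
    using weakly_admissible_imp_weighted_set[OF assms(1,3)] .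
  then interpret weighted_set K Q C .
  have "\<not> polar {z \<in> K. Q z < \<infinity>}" using assms(3) by (simp add: weakly_admissible_def)
  from minimizer_exists[OF exists_finite_energy[OF this]]
  obtain \<nu>0 where \<nu>0: "\<nu>0 \<in> probs_on K" "energy \<nu>0 < \<infinity>"
    and min: "\<And>\<rho>. \<rho> \<in> probs_on K \<Longrightarrow> energy \<nu>0 \<le> energy \<rho>" by blast
  define v where "v = enn2real (energy \<nu>0)"
  have v: "0 \<le> v" "energy \<nu>0 = ennreal v" using \<nu>0(2) by (simp_all add: v_def)
  have energyQ_le: "energyQ Q \<mu> \<le> energyQ Q \<rho> \<longleftrightarrow> energy \<mu> \<le> energy \<rho>"
    if "\<mu> \<in> probs_on K" "\<rho> \<in> probs_on K" for \<mu> \<rho>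
    unfolding energyQ_eq[OF that(1)] energyQ_eq[OF that(2)]
    by (cases "energy \<mu>" rule: ennreal_cases; cases "energy \<rho>" rule: ennreal_cases)
       (auto simp: top_unique)
  have V: "V_w K Q = energyQ Q \<nu>0"
    unfolding V_w_def
    by (rule antisym) (auto intro!: INF_lower INF_greatest simp: energyQ_le \<nu>0(1) min)
  have unique: "\<mu> = \<nu>0" if "\<mu> \<in> probs_on K" "energy \<mu> \<le> ennreal v" for \<mu>
    by (rule energy_minimizer_unique[OF that(1) \<nu>0(1) _ refl \<nu>0(2) min])
       (use that v min in \<open>auto intro: antisym\<close>)
  have mu: "mu_KQ K Q = \<nu>0"
    unfolding mu_KQ_def
  proof (rule the_equality)
    fix \<mu> assume \<mu>: "\<mu> \<in> probs_on K \<and> energyQ Q \<mu> = V_w K Q"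
    then have "energy \<mu> \<le> energy \<nu>0" using energyQ_le[of \<mu> \<nu>0] \<nu>0(1) V by auto
    then show "\<mu> = \<nu>0" using unique \<mu> v(2) by simp
  qed (simp add: V \<nu>0(1))
  \<comment> \<open>\<open>l\<close> is positive because the minimal energy is finite; this permits
    the logarithms taken below.\<close>
  define l where "l = psi C (energy \<nu>0)"
  have l: "0 < l" "2 * C - ln l = v" by (simp_all add: l_def v psi_ennreal)
  have exp_V: "exp_neg_ereal (V_w K Q) = ereal l"
    unfolding V energyQ_eq[OF \<nu>0(1)] exp_neg_ereal_eq_psi l_def ..
  have root_le: "VDM_root Q k x \<le> exp (2 * C)" if "2 \<le> k" "\<forall>j\<in>{1..k}. x j \<in> K" for k x
  proof -
    have "VDM_root Q k x = psi C (pair_mean wkernel k x)"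
      by (rule VDM_root_eq) (use that in blast)+
    then show ?thesis using psi_mono[of 0 "pair_mean wkernel k x" C] by (simp add: psi_def)
  qed

  have part0: "diamQ Q K k < \<infinity>" if "2 \<le> k" for k
  proof -
    have "diamQ Q K k \<le> ereal (exp (2 * C))"
      unfolding diamQ_def by (rule SUP_least) (use root_le that in auto)
    then show ?thesis by (rule le_less_trans) simp
  qed

  have part1: "limsup (\<lambda>k. ereal (VDM_root Q k (x k))) \<le> exp_neg_ereal (energyQ Q \<mu>)"
    if x: "\<And>k j. 2 \<le> k \<Longrightarrow> j \<in> {1..k} \<Longrightarrow> x k j \<in> K" and \<mu>: "\<mu> \<in> probs_on K"
      and conv: "weak_conv_on K (\<lambda>k. empirical K k (x k)) \<mu>" for x \<mu>
    unfolding Limsup_le_iff energyQ_eq[OF \<mu>] exp_neg_ereal_eq_psi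
  proof (intro allI impI)
    fix y assume y: "ereal (psi C (energy \<mu>)) < y"
    then obtain b where b: "psi C (energy \<mu>) < b" "ereal b < y"
      using ereal_dense2 by (metis less_ereal.simps(1))
    \<comment> \<open>The points are known to lie in \<open>K\<close> only for
      \<open>k \<ge> 2\<close>; with this guard, a subsequence of counterexamples consists of such
      \<open>k\<close>.\<close>
    have "\<forall>\<^sub>F k in sequentially. 2 \<le> k \<longrightarrow> VDM_root Q k (x k) < b"
    proof (rule ccontr)
      assume "\<not> ?thesis"
      from not_eventually_sequentiallyD[OF this] obtain m :: "nat \<Rightarrow> nat"
        where m: "strict_mono m" "\<And>n. 2 \<le> m n" "\<And>n. b \<le> VDM_root Q (m n) (x (m n))"
        by (auto simp: not_less)
      have b0: "0 < b" using b(1) by (smt (verit) psi_def exp_gt_zero)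
      obtain s \<nu> where s: "strict_mono s" and \<nu>: "\<nu> \<in> probs_on K" "energy \<nu> \<le> ennreal (2 * C - ln b)"
        and lim: "\<And>f :: complex \<Rightarrow> real. continuous_on K f \<Longrightarrow> bounded (f ` K) \<Longrightarrow>
          (\<lambda>n. \<integral>z. f z \<partial>empirical K (m (s n)) (x (m (s n)))) \<longlonglongrightarrow> (\<integral>z. f z \<partial>\<nu>)"
        by (rule limit_of_large_VDM_root[of m "\<lambda>n. x (m n)" "\<lambda>_. b" b]) (use m x b0 in auto)
      have "\<mu> = \<nu>"
      proof (rule weak_limit_unique[OF \<mu> \<nu>(1)])
        fix f :: "complex \<Rightarrow> real" assume f: "continuous_on K f" "bounded (f ` K)"
        have "(\<lambda>k. \<integral>z. f z \<partial>empirical K k (x k)) \<longlonglongrightarrow> (\<integral>z. f z \<partial>\<mu>)"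
          using conv f by (simp add: weak_conv_on_def)
        from LIMSEQ_subseq_LIMSEQ[OF this strict_mono_o[OF m(1) s]] lim[OF f]
        show "(\<integral>z. f z \<partial>\<mu>) = (\<integral>z. f z \<partial>\<nu>)"
          by (simp add: comp_def LIMSEQ_unique)
      qed
      \<comment> \<open>A single member of the subsequence shows that \<open>2 * C - ln b\<close> is
        nonnegative, hence faithfully represented by \<open>ennreal\<close>.\<close>
      have "b \<le> psi C (pair_mean wkernel (m 0) (x (m 0)))"
        using m(3)[of 0] VDM_root_eq[OF m(2), of 0 "x (m 0)"] x m(2) by simp
      from le_psiD(2)[OF b0 this] have "psi C (ennreal (2 * C - ln b)) = b"
        using b0 by (simp add: psi_ennreal)
      then have "b \<le> psi C (energy \<mu>)"
        using psi_mono[OF \<nu>(2), of C] \<open>\<mu> = \<nu>\<close> by simp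
      then show False using b(1) by simp
    qed
    moreover have "\<forall>\<^sub>F k in sequentially. 2 \<le> k" by (rule eventually_ge_at_top)
    ultimately show "\<forall>\<^sub>F k in sequentially. ereal (VDM_root Q k (x k)) < y"
    proof eventually_elim
      case (elim k)
      then have "ereal (VDM_root Q k (x k)) < ereal b" by simp
      then show ?case using b(2) by (rule less_trans)
    qed
  qed

  \<comment> \<open>Averaging over the minimizer gives this bound for every \<open>k\<close>, not
    only in the limit.\<close>
  have diam_ge: "ereal l \<le> diamQ Q K k" if k: "2 \<le> k" for k
  proof -
    interpret prob_space \<nu>0 by (rule probs_onD(1)[OF \<nu>0(1)])
    from exists_pair_mean_le[OF probs_onD(5)[OF \<nu>0(1) borel_measurable_wkernel] k]
    obtain x where x: "\<forall>j\<in>{1..k}. x j \<in> K" "pair_mean wkernel k x \<le> energy \<nu>0"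
      unfolding energy_def probs_onD(3)[OF \<nu>0(1)] by auto
    have "l \<le> VDM_root Q k x"
      unfolding l_def using VDM_root_eq[OF k, of x] x psi_mono[OF x(2)] by simp
    also have "ereal (VDM_root Q k x) \<le> diamQ Q K k"
      unfolding diamQ_def using x(1) by (intro SUP_upper) auto
    finally show ?thesis by simp
  qed

  have part2: "(\<lambda>k. diamQ Q K k) \<longlonglongrightarrow> ereal l"
  proof (rule order_tendstoI)
    fix a assume a: "a < ereal l"
    show "\<forall>\<^sub>F k in sequentially. a < diamQ Q K k"
      using eventually_ge_at_top[of 2] by eventually_elim (rule less_le_trans[OF a diam_ge])
  next
    fix a assume "ereal l < a"
    then obtain b where b: "l < b" "ereal b < a"
      using ereal_dense2 by (metis less_ereal.simps(1))
    have "\<forall>\<^sub>F k in sequentially. 2 \<le> k \<longrightarrow> diamQ Q K k < a"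
    proof (rule ccontr)
      assume "\<not> ?thesis"
      from not_eventually_sequentiallyD[OF this] obtain m :: "nat \<Rightarrow> nat"
        where m: "strict_mono m" "\<And>n. 2 \<le> m n" "\<And>n. a \<le> diamQ Q K (m n)"
        by (auto simp: not_less)
      \<comment> \<open>The supremum in \<open>diamQ\<close> need not be attained, so the points are
        only asked to exceed \<open>b\<close>, which is still above \<open>l\<close>.\<close>
      have "\<exists>x. (\<forall>j\<in>{1..m n}. x j \<in> K) \<and> b < VDM_root Q (m n) x" for n
        using less_le_trans[OF b(2) m(3)[of n]] by (auto simp: diamQ_def less_SUP_iff)
      then obtain x where x: "\<And>n j. j \<in> {1..m n} \<Longrightarrow> x n j \<in> K" "\<And>n. b < VDM_root Q (m n) (x n)"
        by metis
      obtain \<nu> where \<nu>: "\<nu> \<in> probs_on K" "energy \<nu> \<le> ennreal (2 * C - ln b)"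
        by (rule limit_of_large_VDM_root[of m x "\<lambda>_. b" b]) (use m x b(1) l(1) in \<open>auto intro: less_imp_le\<close>)
      \<comment> \<open>The limit measure would have energy below the minimum
        \<open>v\<close>.\<close>
      have "ln l < ln b" using b(1) l(1) by simp
      then have "2 * C - ln b < v" using l(2) by linarith
      moreover have "ennreal v \<le> ennreal (2 * C - ln b)"
        using min[OF \<nu>(1)] \<nu>(2) v(2) by simp
      moreover have "0 \<le> 2 * C - ln b"
      proof (rule le_psiD(2))
        show "b \<le> psi C (pair_mean wkernel (m 0) (x 0))"
          using x(2)[of 0] VDM_root_eq[OF m(2)[of 0], of "x 0"] x(1)[of _ 0] by simp
      qed (use b(1) l(1) in simp)
      ultimately show False by simp
    qed
    then show "\<forall>\<^sub>F k in sequentially. diamQ Q K k < a"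
      using eventually_ge_at_top[of 2] by eventually_elim auto
  qed

  have part3: "weak_conv_on K (\<lambda>k. empirical K k (x k)) \<nu>0"
    if x: "\<And>k j. 2 \<le> k \<Longrightarrow> j \<in> {1..k} \<Longrightarrow> x k j \<in> K"
      and conv: "(\<lambda>k. ereal (VDM_root Q k (x k))) \<longlonglongrightarrow> ereal l" for x
    unfolding weak_conv_on_def
  proof (intro allI impI)
    fix f :: "complex \<Rightarrow> real" assume f: "continuous_on K f \<and> bounded (f ` K)"
    have root: "(\<lambda>k. VDM_root Q k (x k)) \<longlonglongrightarrow> l" using conv by simp
    show "(\<lambda>k. \<integral>z. f z \<partial>empirical K k (x k)) \<longlonglongrightarrow> (\<integral>z. f z \<partial>\<nu>0)"
    proof (rule ccontr)
      let ?P = "\<lambda>e k. dist (\<integral>z. f z \<partial>empirical K k (x k)) (\<integral>z. f z \<partial>\<nu>0) < e"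
      assume "\<not> ?thesis"
      then obtain e where e: "0 < e" "\<not> (\<forall>\<^sub>F k in sequentially. ?P e k)"
        by (auto simp: tendsto_iff)
      \<comment> \<open>Positivity of the roots, which \<open>l > 0\<close> grants eventually, is
        carried into the subsequence because their logarithms are taken there.\<close>
      have "\<not> (\<forall>\<^sub>F k in sequentially. 2 \<le> k \<and> 0 < VDM_root Q k (x k) \<longrightarrow> ?P e k)"
      proof
        assume "\<forall>\<^sub>F k in sequentially. 2 \<le> k \<and> 0 < VDM_root Q k (x k) \<longrightarrow> ?P e k"
        moreover have "\<forall>\<^sub>F k in sequentially. 0 < VDM_root Q k (x k)"
          using root l(1) by (simp add: order_tendsto_iff)
        ultimately have "\<forall>\<^sub>F k in sequentially. ?P e k"
          using eventually_ge_at_top[of 2] by eventually_elim auto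
        then show False using e(2) by simp
      qed
      from not_eventually_sequentiallyD[OF this] obtain m :: "nat \<Rightarrow> nat"
        where m: "strict_mono m" "\<And>n. 2 \<le> m n" "\<And>n. 0 < VDM_root Q (m n) (x (m n))"
          "\<And>n. \<not> ?P e (m n)"
        by auto
      have y: "(\<lambda>n. VDM_root Q (m n) (x (m n))) \<longlonglongrightarrow> l"
        using LIMSEQ_subseq_LIMSEQ[OF root m(1)] by (simp add: comp_def)
      obtain s \<nu> where s: "strict_mono s" and \<nu>: "\<nu> \<in> probs_on K" "energy \<nu> \<le> ennreal (2 * C - ln l)"
        and lim: "\<And>f :: complex \<Rightarrow> real. continuous_on K f \<Longrightarrow> bounded (f ` K) \<Longrightarrow>
          (\<lambda>n. \<integral>z. f z \<partial>empirical K (m (s n)) (x (m (s n)))) \<longlonglongrightarrow> (\<integral>z. f z \<partial>\<nu>)"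
        by (rule limit_of_large_VDM_root[of m "\<lambda>n. x (m n)" "\<lambda>n. VDM_root Q (m n) (x (m n))" l])
           (use m x y l(1) in auto)
      \<comment> \<open>Any subsequential limit has minimal energy and is therefore
        \<open>\<nu>0\<close>, which contradicts staying at distance \<open>e\<close>.\<close>
      have "\<nu> = \<nu>0" using unique \<nu> l(2) by simp
      with lim[of f] f have "(\<lambda>n. \<integral>z. f z \<partial>empirical K (m (s n)) (x (m (s n)))) \<longlonglongrightarrow> (\<integral>z. f z \<partial>\<nu>0)"
        by simp
      then have "\<forall>\<^sub>F n in sequentially. ?P e (m (s n))" using e(1) by (simp add: tendsto_iff)
      then show False using m(4) by simp
    qed
  qed

  show ?thesis
    unfolding exp_V mu using part0 part1 part2 part3 by blast
qed

end
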